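(* Let $x_1,\ldots,x_n\in\mathbb{R}^d$ be data points, $q\in\mathbb{R}^d$ a query, and $n_o\ge1$. Suppose an RP tree (as described in the context) is built on the data and used to answer query $q$. Let $\beta=3/4$ and $\ell=\log_{1/\beta}(n/n_o)$. Then the probability, over the randomness in tree construction, that it fails to return the nearest neighbor $x_{(1)}$ of $q$ is at most $$\sum_{i=0}^{\ell}\Phi_{\beta^i n}\ln\frac{2e}{\Phi_{\beta^i n}},$$ and, for $k\ge1$, the probability that it fails to return the $k$ nearest neighbors $x_{(1)},\ldots,x_{(k)}$ is at most $$\left(2k\sum_{i=0}^{\ell}\Phi_{k,\beta^i n}\ln\frac{2e}{k\,\Phi_{k,\beta^i n}}\right)+\frac{16(k-1)}{n_o},$$ where $\Phi_m=\Phi_m(q,\{x_1,\ldots,x_n\})$ and $\Phi_{k,m}=\Phi_{k,m}(q,\{x_1,\ldots,x_n\})$.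
   Context: RP tree construction on a set $S$: if $|S|\le n_o$, return a leaf containing $S$; otherwise pick $U$ uniformly at random from the unit sphere $S^{d-1}$ and $\beta'$ uniformly at random from $[1/4,3/4]$ (independently at each node), let $v$ be the $\beta'$-fractile of the projections $\{x\cdot U: x\in S\}$, send $x$ to the left child if $x\cdot U<v$ and to the right otherwise, and recurse on both children. Each data point lies in exactly one leaf. A query $q$ is routed by the same rules to a single leaf, and the answer is the nearest neighbor (resp. $k$ nearest neighbors) of $q$ among the data points in that leaf. Discretization issues are ignored (fractile splits divide the data at exactly the stated fraction). $x_{(1)},\ldots,x_{(n)}$ orders the data by increasing Euclidean distance from $q$. For $m\le n$, $\Phi_m(q,\{x_i\})=\frac1m\sum_{i=2}^m\frac{\|q-x_{(1)}\|}{\|q-x_{(i)}\|}$ and $\Phi_{k,m}(q,\{x_i\})=\frac1m\sum_{i=k+1}^m\frac{(\|q-x_{(1)}\|+\cdots+\|q-x_{(k)}\|)/k}{\|q-x_{(i)}\|}$ (for non-integer $m$ the sums run to $\lfloor m\rfloor$).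
   Formalization: The k-neighbor bound is stated under the extra condition k·Φ_{k,β^i n} ≤ 4 for all 0 ≤ i ≤ ℓ (otherwise the printed bound can be negative); data points are distinct, k ≤ n, and fractiles are taken by linear interpolation. *)

theory Defs
  imports "HOL-Probability.Probability"
begin

(* The uniform distribution on the unit sphere: the direction z / norm z of a uniformly
   distributed point z of the unit ball. In dimension 1 it is uniform on {-1, 1}. *)
definition sphere_uniform :: "'a::euclidean_space measure" where
  "sphere_uniform = distr (uniform_measure lborel (ball 0 1)) borel sgn"

(* One independent pair (U, b) per potential node of the tree. A node is addressed by its
   path from the root (False = left, True = right). *)
definition rp_random :: "(bool list \<Rightarrow> 'a::euclidean_space \<times> real) measure" where
  "rp_random = PiM UNIV (\<lambda>_. sphere_uniform \<Otimes>\<^sub>M uniform_measure lborel {1/4..3/4})"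

(* The b-fractile (0 \<le> b < 1) of at least two reals ys!0 \<le> ... \<le> ys!(size A - 1), with the
   usual linear interpolation: ys!j is the fractile of order j / (size A - 1). For distinct
   values and 1/4 < b < 3/4, at most 3/4 of the values lie strictly below it and at most
   3/4 of them lie at or above it, with no rounding loss. *)
definition fractile :: "real \<Rightarrow> real multiset \<Rightarrow> real" where
  "fractile b A =
    (let ys = sorted_list_of_multiset A;
         h = b * real (size A - 1);
         j = nat \<lfloor>h\<rfloor>
     in ys ! j + (h - real j) * (ys ! Suc j - ys ! j))"

definition split_value :: "'a::euclidean_space set \<Rightarrow> 'a \<times> real \<Rightarrow> real" where
  "split_value S ub = fractile (snd ub) (image_mset (\<lambda>x. x \<bullet> fst ub) (mset_set S))"

datatype 'a rp_tree = Leaf "'a set" | Node 'a real "'a rp_tree" "'a rp_tree"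

(* rp_build n\<^sub>o \<omega> S builds the tree on the finite set S with leaf size n\<^sub>o, using \<omega> [] at the root.
   The recursion stops as well if the split is trivial; for distinct points this
   happens only on the null event that two of them have equal projections. *)
function rp_build :: "nat \<Rightarrow> (bool list \<Rightarrow> 'a::euclidean_space \<times> real) \<Rightarrow> 'a set \<Rightarrow> 'a rp_tree" where
  "rp_build n\<^sub>o \<omega> S =
    (if card S \<le> n\<^sub>o then Leaf S
     else
       let U = fst (\<omega> []);
           v = split_value S (\<omega> []);
           L = {x \<in> S. x \<bullet> U < v};
           R = {x \<in> S. \<not> x \<bullet> U < v}
       in if L = {} \<or> R = {} then Leaf S
          else Node U v (rp_build n\<^sub>o (\<lambda>p. \<omega> (False # p)) L) (rp_build n\<^sub>o (\<lambda>p. \<omega> (True # p)) R))"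
  by pat_completeness auto
termination
proof (relation "Wellfounded.measure (\<lambda>(_, _, S). card S)", goal_cases)
  case 1
  show ?case by simp
next
  case (2 n\<^sub>o \<omega> S U v L R)
  then have "finite S" using card.infinite by fastforce
  moreover have "L \<subset> S" using 2 by blast
  ultimately show ?case using psubset_card_mono by auto
next
  case (3 n\<^sub>o \<omega> S U v L R)
  then have "finite S" using card.infinite by fastforce
  moreover have "R \<subset> S" using 3 by blast
  ultimately show ?case using psubset_card_mono by auto
qed

declare rp_build.simps [simp del]

primrec rp_leaf :: "'a::euclidean_space \<Rightarrow> 'a rp_tree \<Rightarrow> 'a set" where
  "rp_leaf q (Leaf S) = S"
| "rp_leaf q (Node U v l r) = (if q \<bullet> U < v then rp_leaf q l else rp_leaf q r)"

(* A is a set of k nearest neighbors of q among the points of C. *)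
definition nearest_neighbors :: "'a::euclidean_space \<Rightarrow> nat \<Rightarrow> 'a set \<Rightarrow> 'a set \<Rightarrow> bool" where
  "nearest_neighbors q k C A \<longleftrightarrow>
     A \<subseteq> C \<and> card A = k \<and> (\<forall>a\<in>A. \<forall>c\<in>C - A. norm (q - a) \<le> norm (q - c))"

(* In the next two definitions y 1, y 2, ... are the data points in order of increasing
   distance from q. *)
definition Phi :: "'a::euclidean_space \<Rightarrow> (nat \<Rightarrow> 'a) \<Rightarrow> real \<Rightarrow> real" where
  "Phi q y m = 1 / m * (\<Sum>i = 2..nat \<lfloor>m\<rfloor>. norm (q - y 1) / norm (q - y i))"

definition Phi_k :: "'a::euclidean_space \<Rightarrow> (nat \<Rightarrow> 'a) \<Rightarrow> nat \<Rightarrow> real \<Rightarrow> real" where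
  "Phi_k q y k m =
     1 / m * (\<Sum>i = k + 1..nat \<lfloor>m\<rfloor>. ((\<Sum>j = 1..k. norm (q - y j)) / real k) / norm (q - y i))"

(* rp_random is a probability space and every event about the leaf containing q is measurable,
   so measures of such events are genuine probabilities. *)
lemma prob_space_rp_random: "prob_space (rp_random :: (bool list \<Rightarrow> 'a::euclidean_space \<times> real) measure)"
proof -
  have "prob_space (uniform_measure lborel (ball (0::'a) 1))"
    using emeasure_lborel_ball_finite[of "0::'a" 1] content_ball_pos[of 1 "0::'a"]
    by (intro prob_space_uniform_measure) (auto simp: measure_def)
  then interpret A: prob_space "sphere_uniform :: 'a measure"
    unfolding sphere_uniform_def by (rule prob_space.prob_space_distr) simp
  interpret B: prob_space "uniform_measure lborel {1/4..3/4::real}"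
    by (intro prob_space_uniform_measure) auto
  interpret pair_prob_space "sphere_uniform :: 'a measure" "uniform_measure lborel {1/4..3/4::real}" ..
  show ?thesis unfolding rp_random_def by (intro prob_space_PiM) unfold_locales
qed

lemma nth_insort:
  fixes a :: "'b::linorder"
  assumes "sorted ys" and "j \<le> length ys"
  shows "insort a ys ! j =
    (if j = 0 then (if ys = [] then a else min a (ys ! 0))
     else if j = length ys then max a (ys ! (j - 1))
     else max (ys ! (j - 1)) (min a (ys ! j)))"
  using assms
proof (induction ys arbitrary: j)
  case (Cons b ys)
  show ?case
  proof (cases j)
    case (Suc i)
    have b: "b \<le> ys ! i'" if "i' < length ys" for i'
      using that Cons.prems by auto
    have le: "a \<le> (b # ys) ! i'" if "a \<le> b" "i' \<le> length ys" for i'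
      using that b[of "i' - 1"] by (cases i') auto
    show ?thesis
    proof (cases "a \<le> b")
      case True
      then show ?thesis
        using Suc le[OF True, of i] Cons.prems(2)
        by (auto simp: max_absorb2 min.coboundedI1 intro!: max_absorb1[symmetric])
    next
      case False
      then show ?thesis
        using Suc b[of 0] Cons.prems Cons.IH[of i]
        by (cases i) (auto simp: max_def min_def nth_Cons')
    qed
  qed (auto simp: min_def)
qed auto

lemma measurable_sort_nth:
  fixes f :: "'c \<Rightarrow> 'b \<Rightarrow> real"
  assumes "\<And>x. x \<in> set xs \<Longrightarrow> f x \<in> borel_measurable M"
  shows "(\<lambda>\<omega>. sort (map (\<lambda>x. f x \<omega>) xs) ! j) \<in> borel_measurable M"
  using assms
proof (induction xs arbitrary: j)
  case (Cons a xs)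
  note [measurable] = Cons.IH
  have [measurable]: "f a \<in> borel_measurable M" using Cons.prems by simp
  show ?case
  proof (cases "j \<le> length xs")
    case True
    have "(\<lambda>\<omega>. sort (map (\<lambda>x. f x \<omega>) (a # xs)) ! j) =
      (\<lambda>\<omega>. if j = 0 then (if xs = [] then f a \<omega> else min (f a \<omega>) (sort (map (\<lambda>x. f x \<omega>) xs) ! 0))
        else if j = length xs then max (f a \<omega>) (sort (map (\<lambda>x. f x \<omega>) xs) ! (j - 1))
        else max (sort (map (\<lambda>x. f x \<omega>) xs) ! (j - 1)) (min (f a \<omega>) (sort (map (\<lambda>x. f x \<omega>) xs) ! j)))"
      using True by (auto simp: nth_insort fun_eq_iff simp flip: length_0_conv)
    also have "\<dots> \<in> borel_measurable M"
      using Cons.prems by measurable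
    finally show ?thesis .
  next
    case False
    have out: "ys ! j = [] ! (j - length ys)" if "length ys \<le> j" for ys :: "real list"
      using that by (induction ys arbitrary: j) (auto simp: nth_Cons')
    show ?thesis using False by (subst out) auto
  qed
qed auto

lemma measurable_split_value [measurable]:
  assumes "finite S"
  shows "split_value S \<in> borel_measurable (borel \<Otimes>\<^sub>M borel)"
proof -
  obtain xs where xs: "set xs = S" "distinct xs" using assms finite_distinct_list by blast
  have eq: "sorted_list_of_multiset (image_mset (\<lambda>x. x \<bullet> U) (mset_set S)) = sort (map (\<lambda>x. x \<bullet> U) xs)" for U
    using xs by (metis mset_map mset_set_set sorted_list_of_multiset_mset)
  have [measurable]: "(\<lambda>ub::'a \<times> real. sort (map (\<lambda>x. x \<bullet> fst ub) xs) ! j) \<in> borel_measurable (borel \<Otimes>\<^sub>M borel)" for j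
    by (rule measurable_sort_nth) simp
  show ?thesis
    unfolding split_value_def fractile_def Let_def eq size_image_mset size_mset_set by measurable
qed

lemma measurable_rp_leaf:
  fixes S :: "'a::euclidean_space set"
  assumes "finite S"
  shows "(\<lambda>\<omega>. rp_leaf q (rp_build n\<^sub>o \<omega> S)) \<in> rp_random \<rightarrow>\<^sub>M count_space UNIV"
  using assms
proof (induction "card S" arbitrary: S rule: less_induct)
  case less
  have shift: "(\<lambda>\<omega> p. \<omega> (b # p)) \<in> (rp_random :: (bool list \<Rightarrow> 'a \<times> real) measure) \<rightarrow>\<^sub>M rp_random" for b
    unfolding rp_random_def by (rule measurable_PiM_single') (auto simp: space_PiM)
  have [measurable_cong]: "sets (sphere_uniform \<Otimes>\<^sub>M uniform_measure lborel {1/4..3/4}) = sets (borel \<Otimes>\<^sub>M borel :: ('a \<times> real) measure)"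
    by (intro sets_pair_measure_cong) (auto simp: sphere_uniform_def)
  have root [measurable]: "(\<lambda>\<omega>. \<omega> []) \<in> (rp_random :: (bool list \<Rightarrow> 'a \<times> real) measure) \<rightarrow>\<^sub>M borel \<Otimes>\<^sub>M borel"
    unfolding rp_random_def by measurable
  note [measurable] = measurable_split_value[OF less.prems]
  define L where "L \<omega> = {x \<in> S. x \<bullet> fst (\<omega> []) < split_value S (\<omega> [])}" for \<omega> :: "bool list \<Rightarrow> 'a \<times> real"
  define G where "G A \<omega> =
      (if card S \<le> n\<^sub>o \<or> A = {} \<or> A = S then S
       else if q \<bullet> fst (\<omega> []) < split_value S (\<omega> [])
       then rp_leaf q (rp_build n\<^sub>o (\<lambda>p. \<omega> (False # p)) A)
       else rp_leaf q (rp_build n\<^sub>o (\<lambda>p. \<omega> (True # p)) (S - A)))" for A \<omega>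
  have R: "{x \<in> S. \<not> x \<bullet> fst (\<omega> []) < split_value S (\<omega> [])} = S - L \<omega>" for \<omega>
    by (auto simp: L_def)
  have eq: "rp_leaf q (rp_build n\<^sub>o \<omega> S) = G (L \<omega>) \<omega>" for \<omega>
  proof -
    have "S - L \<omega> = {} \<longleftrightarrow> L \<omega> = S" by (auto simp: L_def)
    then show ?thesis
      unfolding rp_build.simps[of n\<^sub>o \<omega> S] Let_def R[of \<omega>] L_def[of \<omega>, symmetric] G_def
      by simp
  qed
  have G: "G A \<in> rp_random \<rightarrow>\<^sub>M count_space UNIV" if "A \<in> Pow S" for A
  proof (cases "card S \<le> n\<^sub>o \<or> A = {} \<or> A = S")
    case False
    have "card A < card S" "card (S - A) < card S"
      using False that less.prems by (auto intro!: psubset_card_mono)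
    moreover have "finite A" using that less.prems finite_subset by auto
    ultimately have [measurable]:
      "(\<lambda>\<omega>. rp_leaf q (rp_build n\<^sub>o (\<lambda>p. \<omega> (False # p)) A)) \<in> rp_random \<rightarrow>\<^sub>M count_space UNIV"
      "(\<lambda>\<omega>. rp_leaf q (rp_build n\<^sub>o (\<lambda>p. \<omega> (True # p)) (S - A))) \<in> rp_random \<rightarrow>\<^sub>M count_space UNIV"
      using measurable_compose[OF shift less.hyps] less.prems by auto
    show ?thesis unfolding G_def using False by simp
  next
    case True
    then have "G A = (\<lambda>_. S)" by (auto simp: G_def)
    then show ?thesis by simp
  qed
  have "L \<in> rp_random \<rightarrow>\<^sub>M count_space (Pow S)"
  proof (rule measurable_count_space_eq2[THEN iffD2])
    have "L -` {A} \<inter> space rp_random \<in> sets rp_random" if "A \<subseteq> S" for A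
    proof -
      have "L \<omega> = A \<longleftrightarrow> (\<forall>x\<in>S. (x \<bullet> fst (\<omega> []) < split_value S (\<omega> [])) = (x \<in> A))" for \<omega>
        unfolding L_def using that by blast
      then have "L -` {A} \<inter> space rp_random =
        {\<omega> \<in> space rp_random. \<forall>x\<in>S. (x \<bullet> fst (\<omega> []) < split_value S (\<omega> [])) = (x \<in> A)}"
        by blast
      also have "\<dots> \<in> sets rp_random"
        using less.prems by measurable
      finally show ?thesis .
    qed
    moreover have "L \<omega> \<in> Pow S" for \<omega>
      unfolding L_def by blast
    ultimately show "L \<in> space rp_random \<rightarrow> Pow S \<and> (\<forall>A\<in>Pow S. L -` {A} \<inter> space rp_random \<in> sets rp_random)"
      by blast
  qed (use less.prems in simp)
  from measurable_compose_countable'[OF G this] show ?case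
    unfolding eq using less.prems by (simp add: countable_finite)
qed

lemma sets_rp_event:
  assumes "finite S"
  shows "{\<omega> \<in> space rp_random. P (rp_leaf q (rp_build n\<^sub>o \<omega> S))} \<in> sets rp_random"
  using measurable_sets[OF measurable_rp_leaf[OF assms], of "Collect P"]
  by (simp add: vimage_def Int_def conj_commute)

end

theory Submission
  imports Defs
begin

text \<open>
  Consider a cell of \<open>m\<close> points that contains the point \<open>x\<close> nearest to
  \<open>q\<close>. For a fixed direction, the split separates \<open>q\<close> from \<open>x\<close> only if
  the fraction falls into an interval of length at most \<open>1 / (m - 1)\<close> times the number of points
  projected between them, where a point \<open>z\<close> just beyond \<open>q\<close> counts by the fraction
  (its overlap) of the gap it spans with \<open>x\<close> that lies before \<open>q\<close>. Rotation
  invariance reduces the average of the overlap to an integral over a circle, which is at most \<open>(a /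
  \<pi>) (2 + ln (1 / a))\<close> for \<open>a = \<parallel>q - x\<parallel> / \<parallel>q -
  z\<parallel>\<close>. By concavity a split of the cell fails with probability at most \<open>2 H (A / (m -
  1))\<close>, where \<open>H a\<close> is this bound and \<open>A\<close> is the sum of the ratios of the
  \<open>m - 1\<close> nearest other points. As \<open>ln \<pi> \<ge> 1\<close>, this is at most \<open>G (2 A
  / (\<pi> (m - 1)))\<close> for \<open>G x = x ln (2 e / x)\<close>.

  A split leaves at most three quarters of the points on either side, so every cell on the way to
  \<open>q\<close> can be charged to a different level \<open>(3/4)\<^sup>i n\<close>, namely the one in
  \<open>[m, 4 m / 3)\<close>. This pays for \<open>m \<ge> 7\<close>; the smallest cells need numerical
  estimates, and share several levels.

  For \<open>k \<ge> 2\<close> neighbors there is an additional term \<open>2 (k - 1) / (m - 1)\<close>, which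
  sums to a geometric series dominated by the leaf size. The other terms have so much slack that they fit into
  their levels, unless some level has \<open>k \<Phi> > 1/2\<close> or \<open>n\<^sub>o \<le> 16 (k -
  1)\<close>; then the claimed bound is at least 1.
\<close>

subsection \<open>Costs of levels and of nodes\<close>

text \<open>The bound for one neighbor has no additive term, so the failure probability of a split
  must vanish with the ratios. Counting data points is too coarse: the fractile is interpolated, so
  the split may fall into the gap just beyond \<open>q\<close>, and charging this gap as a whole
  point would cost a constant times 1/(m - 1) at every cell. The overlap charges only the part
  before \<open>q\<close>. Its tail is the source of the logarithm: it reaches u with probability at
  most a/(2u), unless u is of order a or smaller. The other difficulty is the constant 1 in front of
  the sum. Averages in a cell have denominator m - 1, but its level can be almost 4m/3. The required
  2/\<pi> is below 3(m - 1)/(4m) only from m = 7 on. The thresholds 8/3, 32/9 and 128/27 used for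
  smaller cells are 2 times powers of 4/3: they decide how many further levels stay at or above 2,
  the smallest size of a cell that is split. With several neighbors, splits between two of them
  cannot be avoided however small the ratios are, whence the additive term.\<close>

definition level_cost :: "real \<Rightarrow> real" where
  "level_cost x = x * ln (2 * exp 1 / x)"

text \<open>\<open>level_cost\<close> and \<open>node_cost\<close> are the functions
  \<open>G\<close> and \<open>H\<close> of the overview. The factor \<open>x\<close> makes both
  vanish at 0, whatever the default value of the logarithm.\<close>

definition node_cost :: "real \<Rightarrow> real" where
  "node_cost x = x / pi * (2 + ln (1 / x))"

lemma level_cost_0 [simp]: "level_cost 0 = 0"
  by (simp add: level_cost_def)

lemma node_cost_0 [simp]: "node_cost 0 = 0"
  by (simp add: node_cost_def)

lemma level_cost_eq: "x > 0 \<Longrightarrow> level_cost x = x * (1 + ln 2 - ln x)"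
  by (simp add: level_cost_def ln_div ln_mult)

lemma node_cost_eq: "x > 0 \<Longrightarrow> node_cost x = x / pi * (2 - ln x)"
  by (simp add: node_cost_def ln_div)

text \<open>The function t (c - ln t) has derivative c - 1 - ln t, which stays nonnegative up to
  \<open>y\<close>. Both costs have this form up to a factor.\<close>

lemma mult_const_minus_ln_mono:
  fixes c :: real
  assumes "0 < x" "x \<le> y" "ln y + 1 \<le> c"
  shows "x * (c - ln x) \<le> y * (c - ln y)"
proof -
  have "ln (y / x) \<le> y / x - 1" using assms by (intro ln_le_minus_one) auto
  then have "x * (ln y - ln x) \<le> y - x"
    using assms by (simp add: ln_div field_simps)
  moreover have "(y - x) * 1 \<le> (y - x) * (c - ln y)"
    using assms by (intro mult_left_mono) auto
  ultimately show ?thesis by (simp add: algebra_simps)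
qed

text \<open>The derivative ln 2 - ln x changes sign at 2, hence this range.\<close>

lemma level_cost_mono:
  assumes "0 \<le> x" "x \<le> y" "y \<le> 2"
  shows "level_cost x \<le> level_cost y"
proof (cases "x = 0")
  case True
  then show ?thesis
  proof (cases "y = 0")
    case False
    have "ln y \<le> ln 2" using assms False by (subst ln_le_cancel_iff) auto
    then have "0 \<le> y * (1 + ln 2 - ln y)" using assms by (intro mult_nonneg_nonneg) auto
    then show ?thesis using True False assms level_cost_eq[of y] by simp
  qed simp
next
  case False
  have "ln y \<le> ln 2" using assms False by (subst ln_le_cancel_iff) auto
  then show ?thesis
    using assms False mult_const_minus_ln_mono[of x y "1 + ln 2"] by (simp add: level_cost_eq)
qed

text \<open>The logarithm changes sign at 2e, which is above 4. The limit 4 is the one that the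
  theorem puts on k times \<open>Phi_k\<close>.\<close>

lemma level_cost_nonneg:
  assumes "0 \<le> x" "x \<le> 4"
  shows "0 \<le> level_cost x"
proof (cases "x = 0")
  case False
  have "1 \<le> 2 * exp 1 / x"
    using assms False exp_ge_add_one_self[of 1] by (simp add: field_simps)
  then show ?thesis using assms by (simp add: level_cost_def)
qed simp

text \<open>Both logarithms grow when their arguments are replaced by the sum. Subadditivity allows
  one split to be paid by several levels.\<close>

lemma level_cost_add_le:
  assumes "0 \<le> x" "0 \<le> y"
  shows "level_cost (x + y) \<le> level_cost x + level_cost y"
proof (cases "x = 0 \<or> y = 0")
  case False
  then have xy: "x > 0" "y > 0" using assms by auto
  have "ln x \<le> ln (x + y)" "ln y \<le> ln (x + y)" using xy by auto
  then have "x * ln x \<le> x * ln (x + y)" "y * ln y \<le> y * ln (x + y)" using xy by auto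
  moreover have "level_cost (x + y) = (x + y) * (1 + ln 2) - x * ln (x + y) - y * ln (x + y)"
    using xy level_cost_eq[of "x + y"] by (simp add: algebra_simps)
  moreover have "level_cost x + level_cost y = (x + y) * (1 + ln 2) - x * ln x - y * ln y"
    using xy by (simp add: level_cost_eq algebra_simps)
  ultimately show ?thesis by linarith
qed auto

lemma node_cost_mono:
  assumes "0 \<le> x" "x \<le> y" "y \<le> 1"
  shows "node_cost x \<le> node_cost y"
proof (cases "x = 0")
  case True
  have "0 \<le> node_cost y"
  proof (cases "y = 0")
    case False
    then show ?thesis using assms by (auto simp: node_cost_def intro!: mult_nonneg_nonneg add_nonneg_nonneg)
  qed simp
  then show ?thesis using True by simp
next
  case False
  have "ln y \<le> 0" using assms False by simp
  then have "x * (2 - ln x) \<le> y * (2 - ln y)"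
    using assms False by (intro mult_const_minus_ln_mono) linarith+
  then show ?thesis
    using assms False by (simp add: node_cost_eq divide_right_mono)
qed

lemma node_cost_nonneg:
  assumes "0 \<le> x" "x \<le> 1"
  shows "0 \<le> node_cost x"
  using node_cost_mono[of 0 x] assms by simp

text \<open>Jensen's inequality, padded with zeros to \<open>N\<close> terms. The padding is there
  because a cell of m points has m - k points besides the neighbors, while its averages are taken
  over m - 1.\<close>

lemma sum_node_cost_le:
  assumes "finite J" "card J \<le> N" "N > 0" "\<And>j. j \<in> J \<Longrightarrow> 0 \<le> f j"
  shows "(\<Sum>j\<in>J. node_cost (f j)) \<le> real N * node_cost (sum f J / real N)"
proof (cases "sum f J = 0")
  case True
  then have "\<And>j. j \<in> J \<Longrightarrow> f j = 0" using assms sum_nonneg_eq_0_iff by blast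
  then show ?thesis using True by simp
next
  case False
  define A where "A = sum f J"
  have "0 \<le> A" unfolding A_def using assms(4) by (intro sum_nonneg) auto
  then have A: "A > 0" using False by (simp add: A_def)
  \<comment> \<open>The right side is the tangent of \<open>node_cost\<close> at
    \<open>A / N\<close>, evaluated at \<open>f j\<close>.\<close>
  have 1: "node_cost (f j) \<le> f j / pi * (2 + ln (N / A)) + (A / N - f j) / pi" if "j \<in> J" for j
  proof (cases "f j = 0")
    case True
    then show ?thesis using A assms by simp
  next
    case False
    then have fj: "f j > 0" using assms(4)[OF that] by simp
    have "ln (A / N / f j) \<le> A / N / f j - 1"
      using A fj assms by (intro ln_le_minus_one) auto
    then have "f j * ln (A / N / f j) \<le> f j * (A / N / f j - 1)"
      using fj by simp
    also have "\<dots> = A / N - f j" using fj by (simp add: field_simps)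
    finally have "f j * (- ln (f j)) \<le> A / N - f j + f j * ln (N / A)"
      using A fj assms by (simp add: ln_div ln_mult algebra_simps)
    then have "f j * (2 - ln (f j)) / pi \<le> (f j * (2 + ln (N / A)) + (A / N - f j)) / pi"
      by (intro divide_right_mono) (auto simp: algebra_simps)
    then show ?thesis using fj by (simp add: node_cost_eq add_divide_distrib)
  qed
  have "(\<Sum>j\<in>J. node_cost (f j)) \<le> (\<Sum>j\<in>J. f j / pi * (2 + ln (N / A)) + (A / N - f j) / pi)"
    by (intro sum_mono 1)
  also have "\<dots> = A / pi * (2 + ln (N / A)) + (card J * (A / N) - A) / pi"
    by (simp add: sum.distrib A_def sum_distrib_right[symmetric] sum_divide_distrib[symmetric] sum_subtractf)
  also have "\<dots> \<le> A / pi * (2 + ln (N / A))"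
  proof -
    have "card J * (A / N) \<le> N * (A / N)" using A assms by (intro mult_right_mono) auto
    also have "\<dots> = A" using assms by simp
    finally show ?thesis by (simp add: divide_le_0_iff)
  qed
  also have "\<dots> = real N * node_cost (A / N)"
    using assms A by (simp add: node_cost_def)
  finally show ?thesis by (simp add: A_def)
qed

lemma ln_pi_ge_1: "1 \<le> ln pi"
proof -
  have "exp 1 \<le> (pi::real)" using exp_le pi_gt3 by linarith
  then have "ln (exp 1) \<le> ln (pi::real)" by (subst ln_le_cancel_iff) auto
  then show ?thesis by simp
qed

lemma node_cost_le_level_cost:
  assumes "0 \<le> x"
  shows "2 * node_cost x \<le> level_cost (2 * x / pi)"
proof (cases "x = 0")
  case False
  then have x: "x > 0" using assms by auto
  have "x * (2 * 2 - 2 * ln x) \<le> x * (2 * (1 + ln pi) - 2 * ln x)"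
    using x ln_pi_ge_1 by (intro mult_left_mono) auto
  then have "x * (2 * 2 - 2 * ln x) / pi \<le> x * (2 * (1 + ln pi) - 2 * ln x) / pi"
    by (intro divide_right_mono) auto
  moreover have "2 * node_cost x = x * (2 * 2 - 2 * ln x) / pi"
    using x by (simp add: node_cost_eq field_simps)
  moreover have "ln (2 * x / pi) = ln 2 + ln x - ln pi"
    using x by (simp add: ln_div ln_mult)
  then have "level_cost (2 * x / pi) = 2 * x / pi * (1 + ln 2 - (ln 2 + ln x - ln pi))"
    using x level_cost_eq[of "2 * x / pi"] by simp
  then have "level_cost (2 * x / pi) = x * (2 * (1 + ln pi) - 2 * ln x) / pi"
    by (simp add: algebra_simps)
  ultimately show ?thesis by simp
qed simp

text \<open>Induction on the size: the largest element of \<open>J\<close> is at least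
  \<open>k + card J\<close>, so its term is at most the last one on the right.\<close>

lemma card_sum_antimono_le:
  fixes f :: "nat \<Rightarrow> real"
  assumes "finite J" "\<And>j. j \<in> J \<Longrightarrow> k < j \<and> j \<le> n"
    and "\<And>i j. k < i \<Longrightarrow> i \<le> j \<Longrightarrow> j \<le> n \<Longrightarrow> f j \<le> f i"
  shows "sum f J \<le> (\<Sum>j = k + 1..k + card J. f j)"
  using assms(1,2)
proof (induction "card J" arbitrary: J)
  case (Suc c)
  define b where "b = Max J"
  have ne: "J \<noteq> {}" using Suc by auto
  have b: "b \<in> J" "\<And>j. j \<in> J \<Longrightarrow> j \<le> b" using Suc.prems ne by (auto simp: b_def)
  have "J \<subseteq> {k + 1..b}" using Suc.prems b by force
  then have "card J \<le> card {k + 1..b}" by (rule card_mono[rotated]) simp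
  then have le: "k + card J \<le> b" using b(1) Suc.prems(2) by fastforce
  have c: "card (J - {b}) = c" using Suc b by simp
  have "sum f J = f b + sum f (J - {b})" using Suc.prems b by (simp add: sum.remove)
  also have "sum f (J - {b}) \<le> (\<Sum>j = k + 1..k + card (J - {b}). f j)"
    by (rule Suc.hyps(1)) (use c Suc.prems in auto)
  also have "f b \<le> f (k + card J)"
    using le Suc.prems(2)[OF b(1)] Suc.hyps(2) by (intro assms(3)) auto
  also have "f (k + card J) + (\<Sum>j = k + 1..k + card (J - {b}). f j) = (\<Sum>j = k + 1..k + card J. f j)"
    unfolding c Suc.hyps(2)[symmetric] by simp
  finally show ?case by simp
qed simp

subsection \<open>Fractile splits of points on a line\<close>

lemma strict_sorted_below_nth:
  fixes ys :: "real list"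
  assumes "sorted ys" "distinct ys" "j < length ys"
  shows "card {z \<in> set ys. z < ys ! j} = j"
proof -
  have "{z \<in> set ys. z < ys ! j} = (!) ys ` {..<j}"
  proof (intro set_eqI iffI)
    fix z assume "z \<in> {z \<in> set ys. z < ys ! j}"
    then obtain i where i: "i < length ys" "z = ys ! i" "ys ! i < ys ! j"
      by (auto simp: in_set_conv_nth)
    then have "i < j" using sorted_nth_mono[OF assms(1), of j i] by (meson leD leI)
    then show "z \<in> (!) ys ` {..<j}" using i by auto
  next
    fix z assume "z \<in> (!) ys ` {..<j}"
    then obtain i where i: "i < j" "z = ys ! i" by auto
    then have "ys ! i \<le> ys ! j" "ys ! i \<noteq> ys ! j"
      using assms by (auto simp: sorted_nth_mono nth_eq_iff_index_eq)
    then show "z \<in> {z \<in> set ys. z < ys ! j}" using i assms by auto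
  qed
  moreover have "inj_on ((!) ys) {..<j}"
    using assms by (intro inj_onI) (auto simp: nth_eq_iff_index_eq)
  ultimately show ?thesis by (simp add: card_image)
qed

text \<open>The estimates below use the fractile only through this description: \<open>x\<close> and
  \<open>y\<close> are adjacent in the sorted order, and b (card S - 1) splits into an integer part,
  the rank of \<open>x\<close>, and a fractional part \<tau>.\<close>

lemma fractile_interpolation:
  fixes p :: "'b \<Rightarrow> real"
  assumes "finite S" "2 \<le> card S" "inj_on p S" "0 \<le> b" "b < 1"
  obtains x y \<tau> where "x \<in> S" "y \<in> S" "p x < p y" "\<And>z. z \<in> S \<Longrightarrow> p z \<le> p x \<or> p y \<le> p z"
    "0 \<le> \<tau>" "\<tau> < 1" "fractile b (image_mset p (mset_set S)) = p x + \<tau> * (p y - p x)"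
    "b * (real (card S) - 1) = real (card {z \<in> S. p z < p x}) + \<tau>"
proof -
  define ys where "ys = sorted_list_of_set (p ` S)"
  define h where "h = b * (real (card S) - 1)"
  define j where "j = nat \<lfloor>h\<rfloor>"
  have len: "length ys = card S" using assms by (simp add: ys_def card_image)
  have set: "set ys = p ` S" using assms by (simp add: ys_def)
  have srt: "sorted ys" "distinct ys" by (auto simp: ys_def)
  have h0: "0 \<le> h" using assms by (simp add: h_def)
  have h1: "h < real (card S) - 1" using assms unfolding h_def by simp
  have j: "real j \<le> h" "h < real j + 1" using h0 unfolding j_def by linarith+
  have jS: "Suc j < length ys" using j h1 len by linarith
  have mem: "ys ! j \<in> p ` S" "ys ! Suc j \<in> p ` S"
    unfolding set[symmetric] using jS by (simp_all del: set_sorted_list_of_set)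
  from mem(1) obtain x where x: "ys ! j = p x" "x \<in> S" by (rule imageE)
  from mem(2) obtain y where y: "ys ! Suc j = p y" "y \<in> S" by (rule imageE)
  have lt: "ys ! j < ys ! Suc j"
  proof -
    have "ys ! j \<le> ys ! Suc j" using srt(1) jS by (intro sorted_nth_mono) auto
    moreover have "ys ! j \<noteq> ys ! Suc j" using srt(2) jS by (subst nth_eq_iff_index_eq) auto
    ultimately show ?thesis by simp
  qed
  have gap: "p z \<le> p x \<or> p y \<le> p z" if "z \<in> S" for z
  proof -
    have "p z \<in> set ys" unfolding set using that by (rule imageI)
    then obtain i where i: "i < length ys" "ys ! i = p z" unfolding in_set_conv_nth by auto
    show ?thesis
    proof (cases "i \<le> j")
      case True
      then have "ys ! i \<le> ys ! j" using srt(1) jS by (intro sorted_nth_mono) auto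
      then show ?thesis using i x by simp
    next
      case False
      then have "ys ! Suc j \<le> ys ! i" using srt(1) i(1) by (intro sorted_nth_mono) auto
      then show ?thesis using i y by simp
    qed
  qed
  have "real (card S - 1) = real (card S) - 1" using assms by simp
  moreover have "sorted_list_of_multiset (image_mset p (mset_set S)) = ys"
    using assms by (simp add: image_mset_mset_set ys_def)
  ultimately have v: "fractile b (image_mset p (mset_set S)) = p x + (h - real j) * (p y - p x)"
    by (simp add: fractile_def Let_def h_def[symmetric] j_def[symmetric] x y)
  have "card {z \<in> S. p z < p x} = card (p ` {z \<in> S. p z < p x})"
    using assms(3) by (intro card_image[symmetric]) (auto simp: inj_on_def)
  also have "p ` {z \<in> S. p z < p x} = {z \<in> set ys. z < ys ! j}"
    using set x by auto
  also have "card \<dots> = j" using srt jS by (intro strict_sorted_below_nth) auto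
  finally have rank: "card {z \<in> S. p z < p x} = j" .
  show ?thesis
  proof (rule that[of x y "h - real j"])
    show "b * (real (card S) - 1) = real (card {z \<in> S. p z < p x}) + (h - real j)"
      unfolding rank by (simp add: h_def)
    show "p x < p y" using lt x y by simp
    show "p z \<le> p x \<or> p y \<le> p z" if "z \<in> S" for z using gap that .
  qed (use x y j v in simp_all)
qed

text \<open>The left part has j points if \<tau> = 0 and j + 1 otherwise, where 4 (j + \<tau>) lies
  strictly between card S - 1 and 3 (card S - 1). The unit subtracted from card S is what rounding
  to integers costs.\<close>

lemma fractile_split_card:
  fixes p :: "'b \<Rightarrow> real"
  assumes "finite S" "2 \<le> card S" "inj_on p S" "1/4 < b" "b < 3/4"
  defines "v \<equiv> fractile b (image_mset p (mset_set S))"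
  shows "4 * card {z \<in> S. p z < v} \<le> 3 * card S" "4 * card {z \<in> S. \<not> p z < v} \<le> 3 * card S"
proof -
  obtain x y \<tau> where *: "x \<in> S" "y \<in> S" "p x < p y" "\<And>z. z \<in> S \<Longrightarrow> p z \<le> p x \<or> p y \<le> p z"
    "0 \<le> \<tau>" "\<tau> < 1" "v = p x + \<tau> * (p y - p x)"
    "b * (real (card S) - 1) = real (card {z \<in> S. p z < p x}) + \<tau>"
    unfolding v_def by (rule fractile_interpolation[OF assms(1-3), of b]) (use assms in auto)
  define j where "j = card {z \<in> S. p z < p x}"
  have bj: "b * (real (card S) - 1) = real j + \<tau>" using * j_def by simp
  have "b * (real (card S) - 1) < 3/4 * (real (card S) - 1)"
    using assms by (intro mult_strict_right_mono) auto
  moreover have "1/4 * (real (card S) - 1) < b * (real (card S) - 1)"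
    using assms by (intro mult_strict_right_mono) auto
  ultimately have b1: "4 * (real j + \<tau>) < 3 * real (card S) - 3" "real (card S) - 1 < 4 * (real j + \<tau>)"
    using bj by auto
  have split: "card {z \<in> S. p z < v} + card {z \<in> S. \<not> p z < v} = card S"
  proof -
    have "card S = card ({z \<in> S. p z < v} \<union> {z \<in> S. \<not> p z < v})" by (rule arg_cong[of _ _ card]) auto
    also have "\<dots> = card {z \<in> S. p z < v} + card {z \<in> S. \<not> p z < v}"
      using assms by (intro card_Un_disjoint) auto
    finally show ?thesis by simp
  qed
  show "4 * card {z \<in> S. p z < v} \<le> 3 * card S" "4 * card {z \<in> S. \<not> p z < v} \<le> 3 * card S"
  proof -
    consider "\<tau> = 0" | "\<tau> > 0" using * by linarith
    then have "4 * card {z \<in> S. p z < v} \<le> 3 * card S \<and> 4 * card {z \<in> S. \<not> p z < v} \<le> 3 * card S"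
    proof cases
      case 1
      \<comment> \<open>Here \<open>v\<close> equals \<open>p x\<close>, and the strict comparison
        sends \<open>x\<close> itself to the right.\<close>
      then have below: "card {z \<in> S. p z < v} = j" using * by (simp add: j_def)
      have "real (4 * j) < real (3 * card S)" "real (card S) < real (4 * j + 1)" using b1 1 by simp_all
      then have "4 * j < 3 * card S" "card S < 4 * j + 1" unfolding of_nat_less_iff by auto
      then show ?thesis using split unfolding below by auto
    next
      case 2
      have "0 < \<tau> * (p y - p x)" "0 < (1 - \<tau>) * (p y - p x)"
        using * 2 by (auto intro!: mult_pos_pos)
      then have "p x < v" "v \<le> p y" unfolding *(7) by (simp_all add: algebra_simps)
      moreover have "z = x" if "z \<in> S" "p z = p x" for z
        using that *(1) assms(3) by (auto dest: inj_onD)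
      ultimately have "{z \<in> S. p z < v} = insert x {z \<in> S. p z < p x}"
        using *(1,4) by fastforce
      then have below: "card {z \<in> S. p z < v} = Suc j" using assms by (simp add: j_def)
      have "real (4 * j + 3) < real (3 * card S)" "real (card S) < real (4 * j + 5)"
        using b1 *(5,6) 2 by simp_all
      then have "4 * j + 3 < 3 * card S" "card S < 4 * j + 5" unfolding of_nat_less_iff by auto
      then show ?thesis using split unfolding below by auto
    qed
    then show "4 * card {z \<in> S. p z < v} \<le> 3 * card S" "4 * card {z \<in> S. \<not> p z < v} \<le> 3 * card S" by auto
  qed
qed

locale projected_points =
  fixes S :: "'b set" and p :: "'b \<Rightarrow> real"
  assumes finite_S: "finite S" and card_S: "2 \<le> card S" and inj_p: "inj_on p S"
begin

abbreviation split :: "real \<Rightarrow> real" where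
  "split b \<equiv> fractile b (image_mset p (mset_set S))"

text \<open>The fractional rank of the split. It is linear in \<open>b\<close>, so positions in a
  range of length d come from fractions in a range of length d / (card S - 1).\<close>

definition position :: "real \<Rightarrow> real" where
  "position b = b * (real (card S) - 1)"

text \<open>Since \<tau> < 1, the split stays strictly below the upper data point \<open>p w\<close>
  of its gap, so \<open>x\<close> lies at or below the lower one.\<close>

lemma position_ge_rank:
  assumes "0 \<le> b" "b < 1" "x \<in> S" "p x \<le> split b"
  shows "real (card {z \<in> S. p z < p x}) \<le> position b"
proof -
  obtain u w \<tau> where *: "u \<in> S" "w \<in> S" "p u < p w" "\<And>z. z \<in> S \<Longrightarrow> p z \<le> p u \<or> p w \<le> p z"
    "0 \<le> \<tau>" "\<tau> < 1" "split b = p u + \<tau> * (p w - p u)"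
    "position b = real (card {z \<in> S. p z < p u}) + \<tau>"
    unfolding position_def
    by (rule fractile_interpolation[OF finite_S card_S inj_p, of b]) (use assms in auto)
  have "0 < (1 - \<tau>) * (p w - p u)" using * by (intro mult_pos_pos) auto
  then have "split b < p w" using *(7) by (simp add: algebra_simps)
  then have "p x \<le> p u" using *(4)[of x] assms by auto
  then have "card {z \<in> S. p z < p x} \<le> card {z \<in> S. p z < p u}"
    using finite_S by (intro card_mono) auto
  then show ?thesis using * by linarith
qed

lemma position_le_rank:
  assumes "0 \<le> b" "b < 1" "x \<in> S" "split b \<le> p x"
  shows "position b \<le> real (card {z \<in> S. p z < p x})"
proof -
  obtain u w \<tau> where *: "u \<in> S" "w \<in> S" "p u < p w" "\<And>z. z \<in> S \<Longrightarrow> p z \<le> p u \<or> p w \<le> p z"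
    "0 \<le> \<tau>" "\<tau> < 1" "split b = p u + \<tau> * (p w - p u)"
    "position b = real (card {z \<in> S. p z < p u}) + \<tau>"
    unfolding position_def
    by (rule fractile_interpolation[OF finite_S card_S inj_p, of b]) (use assms in auto)
  show ?thesis
  proof (cases "\<tau> = 0")
    case True
    then have "card {z \<in> S. p z < p u} \<le> card {z \<in> S. p z < p x}"
      using finite_S assms * by (intro card_mono) auto
    then show ?thesis using * True by linarith
  next
    case False
    then have "p u < p x" using * assms by (smt (verit) mult_pos_pos)
    then have "insert u {z \<in> S. p z < p u} \<subseteq> {z \<in> S. p z < p x}" using * by auto
    then have "card (insert u {z \<in> S. p z < p u}) \<le> card {z \<in> S. p z < p x}"
      using finite_S by (intro card_mono) auto
    then show ?thesis using * finite_S by (simp add: card_insert_if)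
  qed
qed

text \<open>If \<open>y\<close> is the data point next to \<open>t\<close> on the side away from \<open>x\<close>, the missing fraction of the
  gap between them is at most the fraction of the larger gap from \<open>y\<close> to \<open>x\<close>.\<close>

lemma position_ge_gap:
  assumes "0 \<le> b" "b < 1" "t \<le> split b" "x \<in> S" "t < p x"
  obtains "real (card {z \<in> S. p z \<le> t}) \<le> position b"
  | y where "y \<in> S" "p y \<le> t" "real (card {z \<in> S. p z \<le> t}) - (p x - t) / (p x - p y) \<le> position b"
proof -
  obtain u w \<tau> where *: "u \<in> S" "w \<in> S" "p u < p w" "\<And>z. z \<in> S \<Longrightarrow> p z \<le> p u \<or> p w \<le> p z"
    "0 \<le> \<tau>" "\<tau> < 1" "split b = p u + \<tau> * (p w - p u)"
    "position b = real (card {z \<in> S. p z < p u}) + \<tau>"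
    unfolding position_def
    by (rule fractile_interpolation[OF finite_S card_S inj_p, of b]) (use assms in auto)
  show ?thesis
  proof (cases "t < p u")
    case True
    then have "card {z \<in> S. p z \<le> t} \<le> card {z \<in> S. p z < p u}"
      using finite_S by (intro card_mono) auto
    then show ?thesis using * that(1) by linarith
  next
    case False
    have "0 < (1 - \<tau>) * (p w - p u)" using * by (intro mult_pos_pos) auto
    then have "split b < p w" using *(7) by (simp add: algebra_simps)
    then have tw: "t < p w" using assms by simp
    have "{z \<in> S. p z \<le> t} \<subseteq> insert u {z \<in> S. p z < p u}"
      using *(1) *(4) tw inj_p by (force simp: inj_on_def)
    then have "card {z \<in> S. p z \<le> t} \<le> card (insert u {z \<in> S. p z < p u})"
      using finite_S by (intro card_mono) auto
    also have "\<dots> = Suc (card {z \<in> S. p z < p u})" using finite_S by simp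
    finally have c: "real (card {z \<in> S. p z \<le> t}) \<le> real (card {z \<in> S. p z < p u}) + 1" by simp
    have wx: "p w \<le> p x" using *(4)[of x] assms False by auto
    have "(t - p u) / (p w - p u) \<le> \<tau>" using * assms by (simp add: divide_le_eq)
    moreover have "(t - p u) / (p w - p u) = 1 - (p w - t) / (p w - p u)"
      using * by (simp add: field_simps)
    moreover have "(p w - t) / (p w - p u) \<le> (p x - t) / (p x - p u)"
    proof -
      have "(p x - p w) * (t - p u) \<ge> 0" using wx False by (intro mult_nonneg_nonneg) auto
      then show ?thesis using * wx by (simp add: divide_simps) (simp add: algebra_simps)
    qed
    ultimately show ?thesis using that(2)[of u] * False c by simp
  qed
qed

text \<open>Mirror image of \<open>position_ge_gap\<close>. The shift by 1 arises because the last
  point before \<open>t\<close> has a rank one less than the number of points before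
  \<open>t\<close>.\<close>

lemma position_le_gap:
  assumes "0 \<le> b" "b < 1" "split b \<le> t" "x \<in> S" "p x < t"
  obtains "position b \<le> real (card {z \<in> S. p z < t}) - 1"
  | y where "y \<in> S" "t \<le> p y" "position b \<le> real (card {z \<in> S. p z < t}) - 1 + (t - p x) / (p y - p x)"
proof -
  obtain u w \<tau> where *: "u \<in> S" "w \<in> S" "p u < p w" "\<And>z. z \<in> S \<Longrightarrow> p z \<le> p u \<or> p w \<le> p z"
    "0 \<le> \<tau>" "\<tau> < 1" "split b = p u + \<tau> * (p w - p u)"
    "position b = real (card {z \<in> S. p z < p u}) + \<tau>"
    unfolding position_def
    by (rule fractile_interpolation[OF finite_S card_S inj_p, of b]) (use assms in auto)
  have ut: "p u \<le> t" using * assms mult_nonneg_nonneg[of \<tau> "p w - p u"] by linarith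
  consider "p w < t" | "p u = t" | "p u < t" "t \<le> p w" using ut by linarith
  then show ?thesis
  proof cases
    case 1
    have "insert w (insert u {z \<in> S. p z < p u}) \<subseteq> {z \<in> S. p z < t}" using * 1 by auto
    then have "card (insert w (insert u {z \<in> S. p z < p u})) \<le> card {z \<in> S. p z < t}"
      using finite_S by (intro card_mono) auto
    moreover have "w \<noteq> u" using * by auto
    ultimately have "real (card {z \<in> S. p z < p u}) + 2 \<le> real (card {z \<in> S. p z < t})"
      using * finite_S by (simp add: card_insert_if)
    then show ?thesis using * that(1) by linarith
  next
    case 2
    then have "\<tau> * (p w - p u) \<le> 0" using * assms by linarith
    then have "\<tau> = 0" using * by (simp add: mult_le_0_iff)
    then show ?thesis using * 2 assms that(2)[of u] by simp
  next
    case 3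
    have "insert u {z \<in> S. p z < p u} \<subseteq> {z \<in> S. p z < t}" using * 3 by auto
    then have "card (insert u {z \<in> S. p z < p u}) \<le> card {z \<in> S. p z < t}"
      using finite_S by (intro card_mono) auto
    then have c: "real (card {z \<in> S. p z < p u}) + 1 \<le> real (card {z \<in> S. p z < t})"
      using * finite_S by (simp add: card_insert_if)
    have xu: "p x \<le> p u" using *(4)[of x] assms 3 by auto
    have "\<tau> \<le> (t - p u) / (p w - p u)" using * assms by (simp add: le_divide_eq)
    moreover have "(t - p u) / (p w - p u) \<le> (t - p x) / (p w - p x)"
    proof -
      have "(p u - p x) * (p w - t) \<ge> 0" using xu 3 by (intro mult_nonneg_nonneg) auto
      then show ?thesis using * xu by (simp add: divide_simps) (simp add: algebra_simps)
    qed
    ultimately show ?thesis using that(2)[of w] * 3 c by linarith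
  qed
qed

definition separates :: "'b set \<Rightarrow> real \<Rightarrow> real \<Rightarrow> bool" where
  "separates N t b \<longleftrightarrow> (\<exists>x\<in>N. (p x < split b) \<noteq> (t < split b))"

definition between :: "real \<Rightarrow> 'b \<Rightarrow> 'b \<Rightarrow> bool" where
  "between t x z \<longleftrightarrow> t < p z \<and> p z < p x \<or> p x < p z \<and> p z < t"

text \<open>Clamping lets one formula serve all places of \<open>z\<close>: it gives 1 if
  \<open>z\<close> projects between \<open>t\<close> and \<open>x\<close>, the fraction if
  \<open>z\<close> lies beyond \<open>t\<close>, and 0 if \<open>z\<close> lies on the far side of
  \<open>x\<close>.\<close>

definition overlap :: "real \<Rightarrow> 'b \<Rightarrow> 'b \<Rightarrow> real" where
  "overlap t x z = max 0 (min 1 ((t - p x) / (p z - p x)))"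

lemma overlap_nonneg: "0 \<le> overlap t x z" and overlap_le_1: "overlap t x z \<le> 1"
  by (auto simp: overlap_def)

lemma overlap_between: "between t x z \<Longrightarrow> overlap t x z = 1"
  by (auto simp: between_def overlap_def le_divide_eq)

text \<open>Every separating split lies in the convex hull of \<open>t\<close> and the projections
  of \<open>N\<close>, so the spread of positions is controlled by the data points in this hull.
  Such a point outside \<open>N\<close> lies between \<open>t\<close> and some element of
  \<open>N\<close> and has weight at least 1. If \<open>t\<close> is an end of the hull, the gap
  that contains \<open>t\<close> is charged to the overlap of the next data point with
  \<open>x0\<close>.\<close>

lemma separation_length:
  assumes N: "N \<subseteq> S" and x0: "x0 \<in> N"
    and t: "\<And>z. z \<in> S - N \<Longrightarrow> p z \<noteq> t"
    and b: "0 \<le> b1" "b1 < 1" "0 \<le> b2" "b2 < 1"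
    and sep: "separates N t b1" "separates N t b2"
  shows "position b2 - position b1 \<le> real (card N - 1) +
    (\<Sum>z\<in>S - N. (\<Sum>x\<in>N - {x0}. of_bool (between t x z)) + overlap t x0 z)"
proof -
  let ?Z = "\<lambda>a b. {z \<in> S - N. a < p z \<and> p z < b}" and ?C = "\<lambda>a b. {z \<in> S. a \<le> p z \<and> p z < b}"
  define w where "w z = (\<Sum>x\<in>N - {x0}. of_bool (between t x z)) + overlap t x0 z" for z
  have finN: "finite N" using N finite_S finite_subset by blast
  have w0: "0 \<le> w z" for z
    using overlap_nonneg[of t x0 z] by (auto simp: w_def intro!: add_nonneg_nonneg sum_nonneg)
  have w_overlap: "overlap t x0 z \<le> w z" for z
    by (auto simp: w_def intro!: sum_nonneg)
  have w1: "1 \<le> w z" if "x \<in> N" "between t x z" for x z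
  proof (cases "x = x0")
    case True
    then show ?thesis using w_overlap[of z] overlap_between that by simp
  next
    case False
    have "of_bool (between t x z) \<le> (\<Sum>x\<in>N - {x0}. of_bool (between t x z) :: real)"
      using that False finN by (intro member_le_sum) auto
    then show ?thesis using that overlap_nonneg[of t x0 z] by (simp add: w_def)
  qed
  have card_le_sum: "real (card B) \<le> (\<Sum>z\<in>B. w z)" if "\<And>z. z \<in> B \<Longrightarrow> \<exists>x\<in>N. between t x z" for B
  proof -
    have "real (card B) = (\<Sum>z\<in>B. 1)" by simp
    also have "\<dots> \<le> (\<Sum>z\<in>B. w z)" using that w1 by (intro sum_mono) blast
    finally show ?thesis .
  qed
  have sum_le: "(\<Sum>z\<in>B. w z) \<le> (\<Sum>z\<in>S - N. w z)" if "B \<subseteq> S - N" for B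
    using that finite_S w0 by (intro sum_mono2) auto
  define P where "P = insert t (p ` N)"
  have P: "finite P" "P \<noteq> {}" using finN by (auto simp: P_def)
  define lo hi where "lo = Min P" and "hi = Max P"
  have lohi: "lo \<in> P" "hi \<in> P" "\<And>c. c \<in> P \<Longrightarrow> lo \<le> c \<and> c \<le> hi"
    using P by (auto simp: lo_def hi_def)
  have sep': "lo \<le> split b" "split b \<le> hi" "lo < hi" if sb: "separates N t b" for b
  proof -
    obtain x where "x \<in> N" "(p x < split b) \<noteq> (t < split b)"
      using sb unfolding separates_def by blast
    moreover have "lo \<le> p x" "p x \<le> hi" "lo \<le> t" "t \<le> hi"
      using lohi(3) \<open>x \<in> N\<close> by (auto simp: P_def)
    ultimately show "lo \<le> split b" "split b \<le> hi" "lo < hi" by linarith+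
  qed
  have cardN: "real (card N - 1) = real (card N) - 1"
  proof -
    have "card N > 0" using x0 finN by (auto simp: card_gt_0_iff)
    then show ?thesis by linarith
  qed
  have hull: "real (card (?C lo hi)) \<le> real (card N) - 1 + (\<Sum>z\<in>(?Z lo hi). w z)"
    if hi: "x \<in> N" "p x = hi" and lo: "\<And>z. z \<in> S - N \<Longrightarrow> p z \<noteq> lo" for x
  proof -
    \<comment> \<open>The half-open interval omits the end \<open>x\<close>, which turns card N into
      card N - 1.\<close>
    have "(?C lo hi) \<subseteq> (N - {x}) \<union> (?Z lo hi)"
      using hi lo by force
    then have "card (?C lo hi) \<le> card ((N - {x}) \<union> (?Z lo hi))"
      using finN finite_S by (intro card_mono) auto
    also have "\<dots> \<le> card (N - {x}) + card (?Z lo hi)"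
      by (rule card_Un_le)
    also have "card (N - {x}) = card N - 1" using hi by simp
    finally have "real (card (?C lo hi)) \<le> real (card N - 1) + real (card (?Z lo hi))"
      by linarith
    moreover have "real (card (?Z lo hi)) \<le> (\<Sum>z\<in>(?Z lo hi). w z)"
    proof (rule card_le_sum)
      fix z assume z: "z \<in> (?Z lo hi)"
      then have "p z \<noteq> t" using t by auto
      then consider "t < p z" | "p z < t" by linarith
      then show "\<exists>x\<in>N. between t x z"
      proof cases
        case 1
        then show ?thesis using hi z by (auto simp: between_def)
      next
        case 2
        then have "lo \<noteq> t" using z by auto
        then obtain x' where "x' \<in> N" "p x' = lo" using lohi(1) by (auto simp: P_def)
        then show ?thesis using 2 z by (auto simp: between_def)
      qed
    qed
    ultimately show ?thesis using cardN by linarith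
  qed
  have rank_diff: "real (card {z \<in> S. p z < c'}) - real (card {z \<in> S. p z < c}) = real (card (?C c c'))"
    if "c \<le> c'" for c c'
  proof -
    have "card {z \<in> S. p z < c'} = card ({z \<in> S. p z < c} \<union> (?C c c'))"
      using that by (intro arg_cong[of _ _ card]) auto
    also have "\<dots> = card {z \<in> S. p z < c} + card (?C c c')"
      using finite_S by (intro card_Un_disjoint) auto
    finally show ?thesis by simp
  qed
  note lh = sep'(3)[OF sep(1)]
  \<comment> \<open>If \<open>t\<close> is an end of the hull, there need not be a data point at
    that end, and the gap lemmas replace the rank lemmas there.\<close>
  consider (both) x x' where "x \<in> N" "x' \<in> N" "p x = lo" "p x' = hi"
    | (left) "lo = t" "t \<notin> p ` N" | (right) "hi = t" "t \<notin> p ` N"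
  proof (cases "t \<in> p ` N")
    case True
    then have "lo \<in> p ` N" "hi \<in> p ` N" using lohi(1,2) by (auto simp: P_def)
    then show ?thesis using both by blast
  next
    case False
    show ?thesis
    proof (cases "lo = t \<or> hi = t")
      case True
      then show ?thesis using left right False by blast
    next
      case False
      then have "lo \<in> p ` N" "hi \<in> p ` N" using lohi(1,2) by (auto simp: P_def)
      then show ?thesis using both by blast
    qed
  qed
  then have "position b2 - position b1 \<le> real (card N) - 1 + (\<Sum>z\<in>S - N. w z)"
  proof cases
    case both
    have "real (card {z \<in> S. p z < lo}) \<le> position b1"
      using position_ge_rank[of b1 x] b both N sep'(1)[OF sep(1)] by auto
    moreover have "position b2 \<le> real (card {z \<in> S. p z < hi})"
      using position_le_rank[of b2 x'] b both N sep'(2)[OF sep(2)] by auto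
    moreover have "real (card (?C lo hi)) \<le> real (card N) - 1 + (\<Sum>z\<in>(?Z lo hi). w z)"
      using both inj_p N by (intro hull) (auto simp: inj_on_def)
    moreover have "(\<Sum>z\<in>(?Z lo hi). w z) \<le> (\<Sum>z\<in>S - N. w z)"
      by (rule sum_le) auto
    ultimately show ?thesis using rank_diff[of lo hi] lh by linarith
  next
    case left
    then obtain x' where x': "x' \<in> N" "p x' = hi" using lohi(2) lh by (auto simp: P_def)
    have above: "t < p x" if "x \<in> N" for x
      using lohi(3)[of "p x"] that left by (auto simp: P_def less_le)
    have tS: "p z \<noteq> t" if "z \<in> S" for z using t left that by (cases "z \<in> N") auto
    have 1: "{z \<in> S. p z \<le> t} = {z \<in> S. p z < t}" using tS by force
    have 2: "position b2 \<le> real (card {z \<in> S. p z < hi})"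
      using position_le_rank[of b2 x'] b x' N sep'(2)[OF sep(2)] by auto
    have 3: "real (card {z \<in> S. p z < hi}) - real (card {z \<in> S. p z < t}) \<le> real (card N) - 1 + (\<Sum>z\<in>(?Z t hi). w z)"
      using hull[OF x'] rank_diff[of t hi] lh left t by simp
    have x0S: "x0 \<in> S" using x0 N by auto
    have tb: "t \<le> split b1" using sep'(1)[OF sep(1)] left by simp
    show ?thesis
    proof (rule position_ge_gap[OF b(1,2) tb x0S above[OF x0]])
      assume "real (card {z \<in> S. p z \<le> t}) \<le> position b1"
      moreover have "(\<Sum>z\<in>(?Z t hi). w z) \<le> (\<Sum>z\<in>S - N. w z)"
        by (rule sum_le) auto
      ultimately show ?thesis using 1 2 3 by simp
    next
      fix y assume y: "y \<in> S" "p y \<le> t" "real (card {z \<in> S. p z \<le> t}) - (p x0 - t) / (p x0 - p y) \<le> position b1"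
      have yN: "y \<notin> N" using above[of y] y by auto
      have "(p x0 - t) / (p x0 - p y) = (t - p x0) / (p y - p x0)"
        by (metis minus_diff_eq minus_divide_divide)
      moreover have "(p x0 - t) / (p x0 - p y) \<le> 1" "0 \<le> (p x0 - t) / (p x0 - p y)"
        using y above[OF x0] by (auto simp: divide_le_eq)
      \<comment> \<open>The point \<open>y\<close> does not lie strictly inside the hull, so its
        weight has not been spent by \<open>hull\<close> and can pay for the gap.\<close>
      ultimately have "(p x0 - t) / (p x0 - p y) \<le> w y"
        using w_overlap[of y] by (simp add: overlap_def)
      moreover have "w y + (\<Sum>z\<in>(?Z t hi). w z) = (\<Sum>z\<in>insert y (?Z t hi). w z)"
        using finite_S y by (subst sum.insert) auto
      moreover have "(\<Sum>z\<in>insert y (?Z t hi). w z) \<le> (\<Sum>z\<in>S - N. w z)"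
        by (rule sum_le) (use y yN in auto)
      ultimately show ?thesis using 1 2 3 y(3) by simp
    qed
  next
    case right
    then obtain x' where x': "x' \<in> N" "p x' = lo" using lohi(1) lh by (auto simp: P_def)
    have below: "p x < t" if "x \<in> N" for x
      using lohi(3)[of "p x"] that right by (auto simp: P_def less_le)
    have 2: "real (card {z \<in> S. p z < lo}) \<le> position b1"
      using position_ge_rank[of b1 x'] b x' N sep'(1)[OF sep(1)] by auto
    \<comment> \<open>All of \<open>N\<close> is counted on this side; the missing unit comes from
      \<open>position_le_gap\<close>.\<close>
    have 3: "real (card (?C lo t)) \<le> real (card N) + (\<Sum>z\<in>(?Z lo t). w z)"
    proof -
      have "p z \<noteq> lo" if "z \<in> S - N" for z using that x' inj_p N by (auto simp: inj_on_def)
      then have "(?C lo t) \<subseteq> N \<union> (?Z lo t)"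
        by force
      then have "card (?C lo t) \<le> card (N \<union> (?Z lo t))"
        using finN finite_S by (intro card_mono) auto
      also have "\<dots> \<le> card N + card (?Z lo t)" by (rule card_Un_le)
      finally have "real (card (?C lo t)) \<le> real (card N) + real (card (?Z lo t))"
        by linarith
      moreover have "real (card (?Z lo t)) \<le> (\<Sum>z\<in>(?Z lo t). w z)"
        using x' by (intro card_le_sum) (auto simp: between_def)
      ultimately show ?thesis by linarith
    qed
    have x0S: "x0 \<in> S" using x0 N by auto
    have tb: "split b2 \<le> t" using sep'(2)[OF sep(2)] right by simp
    show ?thesis
    proof (rule position_le_gap[OF b(3,4) tb x0S below[OF x0]])
      assume "position b2 \<le> real (card {z \<in> S. p z < t}) - 1"
      moreover have "(\<Sum>z\<in>(?Z lo t). w z) \<le> (\<Sum>z\<in>S - N. w z)"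
        by (rule sum_le) auto
      ultimately show ?thesis using 2 3 rank_diff[of lo t] lh right by simp
    next
      fix y assume y: "y \<in> S" "t \<le> p y" "position b2 \<le> real (card {z \<in> S. p z < t}) - 1 + (t - p x0) / (p y - p x0)"
      have yN: "y \<notin> N" using below[of y] y by auto
      have "(t - p x0) / (p y - p x0) \<le> 1" "0 \<le> (t - p x0) / (p y - p x0)"
        using y below[OF x0] by (auto simp: divide_le_eq)
      then have "(t - p x0) / (p y - p x0) \<le> w y"
        using w_overlap[of y] by (simp add: overlap_def)
      moreover have "w y + (\<Sum>z\<in>(?Z lo t). w z) = (\<Sum>z\<in>insert y (?Z lo t). w z)"
        using finite_S y by (subst sum.insert) auto
      moreover have "(\<Sum>z\<in>insert y (?Z lo t). w z) \<le> (\<Sum>z\<in>S - N. w z)"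
        by (rule sum_le) (use y yN in auto)
      ultimately show ?thesis using 2 3 y(3) rank_diff[of lo t] lh right by simp
    qed
  qed
  then show ?thesis using cardN by (simp add: w_def)
qed

text \<open>With two points the position is \<open>b\<close> itself, so a one-sided bound on
  \<open>b\<close> replaces the length of an interval. Which side applies depends only on the
  projections, not on \<open>b\<close>. Together with the range [1/4, 3/4] of fractions this leaves
  a width of at most the overlap minus 1/4, if that is positive.\<close>

lemma separation_pair:
  assumes S: "S = {x, z}" "x \<noteq> z" and t: "p z \<noteq> t" "p x \<noteq> t"
  shows "(\<forall>b. 0 < b \<longrightarrow> b < 1 \<longrightarrow> separates {x} t b \<longrightarrow> 1 - overlap t x z \<le> b) \<or>
    (\<forall>b. 0 < b \<longrightarrow> b < 1 \<longrightarrow> separates {x} t b \<longrightarrow> b \<le> overlap t x z)"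
proof -
  have "card S = 2" using S by simp
  then have pos: "position b = b" for b by (simp add: position_def)
  have xS: "x \<in> S" "z \<in> S" using S by auto
  have ne: "p x \<noteq> p z" using inj_p xS S(2) by (auto simp: inj_on_def)
  consider "t < p x" | "p x < t" using t by linarith
  then show ?thesis
  proof cases
    case 1
    have "1 - overlap t x z \<le> b" if b: "0 < b" "b < 1" "separates {x} t b" for b
    proof -
      have v: "t \<le> split b" "split b \<le> p x" using b 1 by (auto simp: separates_def)
      have b0: "0 \<le> b" using b by simp
      consider "p x < p z" | "t < p z" "p z < p x" | "p z < t" using ne t by linarith
      then show ?thesis
      proof cases
        case 1
        then have "{y \<in> S. p y < p x} = {}" using S by auto
        then have "card {y \<in> S. p y < p x} = 0" by (metis card.empty)
        then show ?thesis using position_le_rank[OF b0 b(2) xS(1) v(2)] pos b by simp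
      next
        case 2
        then have "between t x z" by (simp add: between_def)
        then show ?thesis using b overlap_between by simp
      next
        case 3
        have c: "{y \<in> S. p y \<le> t} = {z}" using S 3 1 by auto
        show ?thesis
        proof (rule position_ge_gap[OF b0 b(2) v(1) xS(1) 1])
          assume "real (card {z \<in> S. p z \<le> t}) \<le> position b"
          then show ?thesis using c pos overlap_nonneg[of t x z] by simp
        next
          fix y assume y: "y \<in> S" "p y \<le> t" "real (card {z \<in> S. p z \<le> t}) - (p x - t) / (p x - p y) \<le> position b"
          have yz: "y = z" using y c by auto
          have "(p x - t) / (p x - p z) = (t - p x) / (p z - p x)"
            by (metis minus_diff_eq minus_divide_divide)
          moreover have "(p x - t) / (p x - p z) \<le> 1" "0 \<le> (p x - t) / (p x - p z)"
            using 3 1 by (auto simp: divide_le_eq)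
          ultimately show ?thesis using y c pos yz by (simp add: overlap_def)
        qed
      qed
    qed
    then show ?thesis by blast
  next
    case 2
    have "b \<le> overlap t x z" if b: "0 < b" "b < 1" "separates {x} t b" for b
    proof -
      have v: "p x \<le> split b" "split b \<le> t" using b 2 by (auto simp: separates_def)
      have b0: "0 \<le> b" using b by simp
      consider "p z < p x" | "p x < p z" "p z < t" | "t < p z" using ne t by linarith
      then show ?thesis
      proof cases
        case 1
        then have "{y \<in> S. p y < p x} = {z}" using S by auto
        then have "card {y \<in> S. p y < p x} = 1" by (metis card_1_singleton_iff One_nat_def)
        then show ?thesis using position_ge_rank[OF b0 b(2) xS(1) v(1)] pos b by simp
      next
        case 2
        then have "between t x z" by (simp add: between_def)
        then show ?thesis using b overlap_between by simp
      next
        case 3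
        have c: "{y \<in> S. p y < t} = {x}" using S 3 2 by auto
        show ?thesis
        proof (rule position_le_gap[OF b0 b(2) v(2) xS(1) 2])
          assume "position b \<le> real (card {z \<in> S. p z < t}) - 1"
          then show ?thesis using c pos overlap_nonneg[of t x z] by simp
        next
          fix y assume y: "y \<in> S" "t \<le> p y" "position b \<le> real (card {z \<in> S. p z < t}) - 1 + (t - p x) / (p y - p x)"
          have "y \<noteq> x" using y 2 by auto
          then have yz: "y = z" using y S by auto
          have "(t - p x) / (p z - p x) \<le> 1" "0 \<le> (t - p x) / (p z - p x)"
            using 3 2 by (auto simp: divide_le_eq)
          then show ?thesis using y c pos yz by (simp add: overlap_def)
        qed
      qed
    qed
    then show ?thesis by blast
  qed
qed

end

subsection \<open>Averages over directions\<close>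

text \<open>A set of diameter at most \<open>l\<close> fits into an interval of that length starting
  at its infimum, and the density is 2. The endpoints 1/4 and 3/4 are discarded as a null set
  because the balance of a split is established for interior fractions.\<close>

lemma emeasure_uniform_width:
  assumes "D \<in> sets borel" "0 \<le> l" "\<And>b c. b \<in> D \<Longrightarrow> c \<in> D \<Longrightarrow> 1/4 < b \<Longrightarrow> b < 3/4 \<Longrightarrow> 1/4 < c \<Longrightarrow> c < 3/4 \<Longrightarrow> c - b \<le> l"
  shows "emeasure (uniform_measure lborel {1/4..3/4::real}) D \<le> ennreal (2 * l)"
proof -
  let ?D = "D \<inter> {1/4<..<3/4}"
  have D: "emeasure lborel ?D \<le> ennreal l"
  proof (cases "?D = {}")
    case False
    then obtain d where d: "d \<in> ?D" by blast
    have bdd: "bdd_below ?D" by (auto simp: bdd_below_def intro: exI[of _ "1/4"])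
    have "?D \<subseteq> {Inf ?D..Inf ?D + l}"
    proof
      fix c assume c: "c \<in> ?D"
      have "c - l \<le> b" if "b \<in> ?D" for b using assms(3)[of b c] that c by force
      then have "c - l \<le> Inf ?D" using False by (intro cInf_greatest) auto
      moreover have "Inf ?D \<le> c" using c bdd by (intro cInf_lower) auto
      ultimately show "c \<in> {Inf ?D..Inf ?D + l}" by auto
    qed
    then have "emeasure lborel ?D \<le> emeasure lborel {Inf ?D..Inf ?D + l}"
      by (intro emeasure_mono) auto
    then show ?thesis using assms(2) by simp
  qed (use assms in auto)
  have "emeasure lborel ({1/4..3/4} \<inter> D) \<le> emeasure lborel (?D \<union> {1/4} \<union> {3/4})"
    using assms(1) by (intro emeasure_mono) force+
  also have "\<dots> \<le> emeasure lborel (?D \<union> {1/4}) + emeasure lborel {3/4::real}"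
    using assms(1) by (intro emeasure_subadditive) auto
  also have "\<dots> = emeasure lborel (?D \<union> {1/4})" by simp
  also have "\<dots> \<le> emeasure lborel ?D + emeasure lborel {1/4::real}"
    using assms(1) by (intro emeasure_subadditive) auto
  also have "\<dots> \<le> ennreal l" using D by simp
  finally have "emeasure lborel ({1/4..3/4} \<inter> D) / emeasure lborel {1/4..3/4::real} \<le> ennreal l / emeasure lborel {1/4..3/4::real}"
    by (rule divide_right_mono_ennreal)
  also have "\<dots> = ennreal l / ennreal (1/2)" by simp
  also have "\<dots> = ennreal (2 * l)" using assms by (subst divide_ennreal) (auto simp: mult.commute)
  finally show ?thesis
    using assms(1) by (subst emeasure_uniform_measure) auto
qed

section \<open>Rotation invariance of Lebesgue measure and reduction to a plane\<close>

lemma emeasure_lborel_vimage_translation: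
  fixes A :: "'a::euclidean_space set"
  assumes "A \<in> sets borel"
  shows "emeasure lborel {z. w + z \<in> A} = emeasure lborel A"
proof -
  have "emeasure lborel A = emeasure (distr lborel borel ((+) w)) A"
    by (simp add: lborel_distr_plus)
  also have "\<dots> = emeasure lborel ((+) w -` A \<inter> space lborel)"
    using assms by (intro emeasure_distr) auto
  also have "(+) w -` A \<inter> space lborel = {z. w + z \<in> A}" by auto
  finally show ?thesis by simp
qed

text \<open>Both measures are computed from the convolution of the indicators of \<open>A\<close> and the unit ball,
  which avoids a uniqueness theorem for Haar measure.\<close>

lemma emeasure_lborel_vimage_orthogonal:
  fixes f :: "'a::euclidean_space \<Rightarrow> 'a"
  assumes f: "orthogonal_transformation f" and B: "B \<in> sets borel"
  shows "emeasure lborel (f -` B) = emeasure lborel B"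
proof -
  have lin: "linear f" and norm: "\<And>x. norm (f x) = norm x"
    using f by (auto simp: orthogonal_transformation)
  have [measurable]: "f \<in> borel_measurable borel"
    using lin by (intro borel_measurable_continuous_onI linear_continuous_on linear_conv_bounded_linear[THEN iffD1])
  note [measurable] = B
  have surj: "\<exists>w. f w = x" for x
    using orthogonal_transformation_surj[OF f] by (metis surjD)
  let ?A = "ball 0 1 :: 'a set"
  have [measurable]: "?A \<in> sets borel" by simp
  \<comment> \<open>Integrating over z, with x written as f w, gives the measure of the preimage of
    \<open>B\<close>. Integrating over x, after a shift by f z, gives the measure of
    \<open>B\<close>, because \<open>f\<close> preserves the unit ball.\<close>
  let ?g = "\<lambda>x z. indicator ?A x * indicator B (x + f z) :: ennreal"
  have fB: "f -` B \<in> sets borel" using measurable_sets_borel[OF \<open>f \<in> borel_measurable borel\<close> B] .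
  have 1: "(\<integral>\<^sup>+z. ?g x z \<partial>lborel) = indicator ?A x * emeasure lborel (f -` B)" for x
  proof -
    obtain w where w: "f w = x" using surj by blast
    have "(\<integral>\<^sup>+z. ?g x z \<partial>lborel) = indicator ?A x * (\<integral>\<^sup>+z. indicator B (x + f z) \<partial>lborel)"
      by (subst nn_integral_cmult) auto
    also have "(\<integral>\<^sup>+z. indicator B (x + f z) \<partial>lborel) = (\<integral>\<^sup>+z. indicator {z. w + z \<in> f -` B} z \<partial>lborel)"
      by (intro nn_integral_cong) (auto simp: indicator_def linear_add[OF lin] w)
    also have "\<dots> = emeasure lborel {z. w + z \<in> f -` B}"
      by (rule nn_integral_indicator) measurable
    also have "\<dots> = emeasure lborel (f -` B)" using fB by (rule emeasure_lborel_vimage_translation)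
    finally show ?thesis .
  qed
  have 2: "(\<integral>\<^sup>+x. ?g x z \<partial>lborel) = (\<integral>\<^sup>+x. indicator ?A (x - f z) * indicator B x \<partial>lborel)" for z
  proof -
    have m: "(\<lambda>x. indicator ?A (x - f z) * indicator B x :: ennreal) \<in> borel_measurable borel"
      by measurable
    have "(\<integral>\<^sup>+x. indicator ?A (x - f z) * indicator B x \<partial>lborel)
      = (\<integral>\<^sup>+x. indicator ?A (x - f z) * indicator B x \<partial>distr lborel borel ((+) (f z)))"
      by (simp add: lborel_distr_plus)
    also have "\<dots> = (\<integral>\<^sup>+x. indicator ?A ((f z + x) - f z) * indicator B (f z + x) \<partial>lborel)"
      by (rule nn_integral_distr) (use m in simp_all)
    finally show ?thesis by (simp add: add.commute)
  qed
  have 3: "(\<integral>\<^sup>+z. indicator ?A (x - f z) * indicator B x \<partial>lborel) = emeasure lborel ?A * indicator B x" for x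
  proof -
    obtain w where w: "f w = x" using surj by blast
    have "(\<integral>\<^sup>+z. indicator ?A (x - f z) * indicator B x \<partial>lborel) = (\<integral>\<^sup>+z. indicator ?A (x - f z) \<partial>lborel) * indicator B x"
      by (subst nn_integral_multc) auto
    also have "(\<integral>\<^sup>+z. indicator ?A (x - f z) \<partial>lborel) = (\<integral>\<^sup>+z. indicator (ball w 1) z \<partial>lborel)"
      by (intro nn_integral_cong) (simp add: indicator_def dist_norm linear_diff[OF lin, symmetric] norm w[symmetric])
    also have "\<dots> = emeasure lborel (ball w 1)" by simp
    also have "\<dots> = emeasure lborel {z. - w + z \<in> ?A}"
      by (rule arg_cong[of _ _ "emeasure lborel"]) (auto simp: dist_norm norm_minus_commute)
    also have "\<dots> = emeasure lborel ?A" by (rule emeasure_lborel_vimage_translation) simp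
    finally show ?thesis .
  qed
  have "emeasure lborel ?A * emeasure lborel (f -` B) = (\<integral>\<^sup>+x. \<integral>\<^sup>+z. ?g x z \<partial>lborel \<partial>lborel)"
    unfolding 1 by (simp add: nn_integral_multc)
  also have "\<dots> = (\<integral>\<^sup>+z. \<integral>\<^sup>+x. ?g x z \<partial>lborel \<partial>lborel)"
    by (rule lborel_pair.Fubini'[symmetric]) measurable
  also have "\<dots> = (\<integral>\<^sup>+z. \<integral>\<^sup>+x. indicator ?A (x - f z) * indicator B x \<partial>lborel \<partial>lborel)"
    unfolding 2 ..
  also have "\<dots> = (\<integral>\<^sup>+x. \<integral>\<^sup>+z. indicator ?A (x - f z) * indicator B x \<partial>lborel \<partial>lborel)"
    by (rule lborel_pair.Fubini') measurable
  also have "\<dots> = emeasure lborel ?A * emeasure lborel B"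
    unfolding 3 using B by (simp add: nn_integral_cmult)
  finally have "emeasure lborel ?A * emeasure lborel (f -` B) = emeasure lborel ?A * emeasure lborel B" .
  moreover have "emeasure lborel ?A \<noteq> 0" "emeasure lborel ?A \<noteq> \<infinity>"
    using emeasure_lborel_ball_finite[of "0::'a" 1] content_ball_pos[of 1 "0::'a"]
    by (auto simp: measure_def)
  ultimately show ?thesis by (simp add: ennreal_mult_cancel_left)
qed

lemma distr_lborel_orthogonal:
  fixes f :: "'a::euclidean_space \<Rightarrow> 'a"
  assumes f: "orthogonal_transformation f"
  shows "distr lborel borel f = lborel"
proof (rule measure_eqI)
  fix B assume "B \<in> sets (distr lborel borel f)"
  then have B: "B \<in> sets borel" by simp
  have "linear f" using f by (auto simp: orthogonal_transformation)
  then have "f \<in> borel_measurable borel"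
    by (intro borel_measurable_continuous_onI linear_continuous_on linear_conv_bounded_linear[THEN iffD1])
  then show "emeasure (distr lborel borel f) B = emeasure lborel B"
    using emeasure_lborel_vimage_orthogonal[OF f B] B by (simp add: emeasure_distr)
qed simp

text \<open>A rotation of the plane of \<open>e\<close> and \<open>f\<close> that fixes the
  orthogonal complement. The angle is counted from \<open>f\<close> towards \<open>e\<close>, so
  that the coordinate along \<open>e\<close> is a sine.\<close>

definition plane_rotation :: "'a::euclidean_space \<Rightarrow> 'a \<Rightarrow> real \<Rightarrow> 'a \<Rightarrow> 'a" where
  "plane_rotation e f \<omega> z = z + ((cos \<omega> - 1) * (z \<bullet> e) + sin \<omega> * (z \<bullet> f)) *\<^sub>R e
     + ((cos \<omega> - 1) * (z \<bullet> f) - sin \<omega> * (z \<bullet> e)) *\<^sub>R f"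

lemma plane_rotation_inner:
  assumes "e \<bullet> e = 1" "f \<bullet> f = 1" "e \<bullet> f = 0"
  shows "plane_rotation e f \<omega> z \<bullet> e = cos \<omega> * (z \<bullet> e) + sin \<omega> * (z \<bullet> f)"
    "plane_rotation e f \<omega> z \<bullet> f = cos \<omega> * (z \<bullet> f) - sin \<omega> * (z \<bullet> e)"
  using assms by (simp_all add: plane_rotation_def inner_add_left inner_commute[of f e] algebra_simps)

lemma orthogonal_plane_rotation:
  assumes "e \<bullet> e = 1" "f \<bullet> f = 1" "e \<bullet> f = 0"
  shows "orthogonal_transformation (plane_rotation e f \<omega>)"
proof -
  have "linear (plane_rotation e f \<omega>)"
    by (rule linearI) (simp_all add: plane_rotation_def inner_add_left algebra_simps)
  moreover have "norm (plane_rotation e f \<omega> z) = norm z" for z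
  proof -
    define a b s c where "a = z \<bullet> e" and "b = z \<bullet> f" and "s = sin \<omega>" and "c = cos \<omega>"
    have sc: "s\<^sup>2 + c\<^sup>2 = 1" by (simp add: s_def c_def)
    let ?P = "(c - 1) * a + s * b" and ?Q = "(c - 1) * b - s * a"
    have 1: "plane_rotation e f \<omega> z \<bullet> plane_rotation e f \<omega> z = z \<bullet> z + 2 * (?P * a + ?Q * b) + ?P\<^sup>2 + ?Q\<^sup>2"
      using assms unfolding plane_rotation_def a_def b_def s_def c_def
      by (simp add: inner_add_left inner_add_right inner_commute[of f e] inner_commute[of e z] inner_commute[of f z]
          power2_eq_square algebra_simps)
    have 2: "2 * (?P * a + ?Q * b) + ?P\<^sup>2 + ?Q\<^sup>2 = (s\<^sup>2 + c\<^sup>2 - 1) * (a\<^sup>2 + b\<^sup>2)"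
      by (simp add: power2_eq_square algebra_simps)
    have "plane_rotation e f \<omega> z \<bullet> plane_rotation e f \<omega> z = z \<bullet> z" using 1 2 sc by simp
    then show ?thesis by (simp add: norm_eq)
  qed
  ultimately show ?thesis by (simp add: orthogonal_transformation)
qed

lemma nn_integral_half_turn_shift:
  fixes h :: "real \<Rightarrow> ennreal"
  assumes [measurable]: "h \<in> borel_measurable borel" and per: "\<And>x. h (x + pi) = h x"
    and \<alpha>: "0 \<le> \<alpha>" "\<alpha> \<le> pi"
  shows "(\<integral>\<^sup>+x\<in>{\<alpha>..\<alpha> + pi}. h x \<partial>lborel) = (\<integral>\<^sup>+x\<in>{0..pi}. h x \<partial>lborel)"
proof -
  have "(\<integral>\<^sup>+x\<in>{\<alpha>..\<alpha> + pi}. h x \<partial>lborel) = (\<integral>\<^sup>+x. h x * indicator {\<alpha>..pi} x + h x * indicator {pi<..\<alpha> + pi} x \<partial>lborel)"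
    using \<alpha> by (intro nn_integral_cong) (auto split: split_indicator)
  also have "\<dots> = (\<integral>\<^sup>+x. h x * indicator {\<alpha>..pi} x \<partial>lborel) + (\<integral>\<^sup>+x. h x * indicator {pi<..\<alpha> + pi} x \<partial>lborel)"
    by (rule nn_integral_add) auto
  also have "(\<integral>\<^sup>+x. h x * indicator {pi<..\<alpha> + pi} x \<partial>lborel) = (\<integral>\<^sup>+x. h (pi + 1 * x) * indicator {pi<..\<alpha> + pi} (pi + 1 * x) \<partial>lborel)"
    by (subst nn_integral_real_affine[where c = 1 and t = pi]) auto
  also have "\<dots> = (\<integral>\<^sup>+x. h x * indicator {0<..\<alpha>} x \<partial>lborel)"
    by (intro nn_integral_cong) (auto simp: per add.commute[of pi] split: split_indicator)
  also have "\<dots> = (\<integral>\<^sup>+x. h x * indicator {0..<\<alpha>} x \<partial>lborel)"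
  proof (rule nn_integral_cong_AE)
    have "AE x in lborel. x \<noteq> 0 \<and> x \<noteq> \<alpha>" using AE_lborel_singleton[of 0] AE_lborel_singleton[of \<alpha>] by eventually_elim auto
    then show "AE x in lborel. h x * indicator {0<..\<alpha>} x = h x * indicator {0..<\<alpha>} x"
      by eventually_elim (auto split: split_indicator)
  qed
  also have "(\<integral>\<^sup>+x. h x * indicator {\<alpha>..pi} x \<partial>lborel) + (\<integral>\<^sup>+x. h x * indicator {0..<\<alpha>} x \<partial>lborel)
    = (\<integral>\<^sup>+x. h x * indicator {\<alpha>..pi} x + h x * indicator {0..<\<alpha>} x \<partial>lborel)"
    by (rule nn_integral_add[symmetric]) auto
  also have "\<dots> = (\<integral>\<^sup>+x\<in>{0..pi}. h x \<partial>lborel)"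
    using \<alpha> by (intro nn_integral_cong) (auto split: split_indicator)
  finally show ?thesis .
qed

text \<open>A function that is constant on open rays does not see the normalization by
  \<open>sgn\<close>, so the sphere can be replaced by the ball with Lebesgue measure.\<close>

lemma nn_integral_sphere_uniform:
  fixes h :: "'a::euclidean_space \<Rightarrow> ennreal"
  assumes [measurable]: "h \<in> borel_measurable borel" and hom: "\<And>c z. c > 0 \<Longrightarrow> h (c *\<^sub>R z) = h z"
  shows "(\<integral>\<^sup>+U. h U \<partial>sphere_uniform) = (\<integral>\<^sup>+z\<in>ball 0 1. h z \<partial>lborel) / emeasure lborel (ball (0::'a) 1)"
proof -
  have sgn: "h (sgn z) = h z" for z
    by (cases "z = 0") (simp_all add: sgn_div_norm hom)
  have "(\<integral>\<^sup>+U. h U \<partial>sphere_uniform) = (\<integral>\<^sup>+z. h (sgn z) \<partial>uniform_measure lborel (ball 0 1))"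
    unfolding sphere_uniform_def by (rule nn_integral_distr) auto
  also have "\<dots> = (\<integral>\<^sup>+z\<in>ball 0 1. h z \<partial>lborel) / emeasure lborel (ball (0::'a) 1)"
    unfolding sgn by (rule nn_integral_uniform_measure) auto
  finally show ?thesis .
qed

lemma AE_lborel_inner_neq_0:
  fixes u :: "'a::euclidean_space"
  assumes "u \<noteq> 0"
  shows "AE z in lborel. z \<bullet> u \<noteq> 0"
proof -
  have "negligible {z. u \<bullet> z = 0}" using assms by (intro negligible_hyperplane) auto
  then have "{z. u \<bullet> z = 0} \<in> null_sets lebesgue" by (simp add: negligible_iff_null_sets)
  then have "{z. u \<bullet> z = 0} \<in> null_sets lborel"
    by (auto simp: null_sets_def emeasure_completion)
  then show ?thesis by (rule AE_I') (auto simp: inner_commute)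
qed

text \<open>Rotations of the plane leave the integral over the ball unchanged. Averaging over them
  and exchanging the integrals produces, for almost every z, an integral over angles that does not
  depend on z. Invariance under negative factors makes the integrand \<pi>-periodic, so half a turn
  suffices and its window can be shifted by \<phi>.\<close>

lemma nn_integral_sphere_uniform_plane:
  fixes e f :: "'a::euclidean_space" and g :: "real \<Rightarrow> real \<Rightarrow> ennreal"
  assumes ef: "e \<bullet> e = 1" "f \<bullet> f = 1" "e \<bullet> f = 0"
    and g: "(\<lambda>(x, y). g x y) \<in> borel_measurable (borel \<Otimes>\<^sub>M borel)"
    and hom: "\<And>c x y. c \<noteq> 0 \<Longrightarrow> g (c * x) (c * y) = g x y"
    and \<phi>: "0 \<le> \<phi>" "\<phi> \<le> pi"
  shows "ennreal pi * (\<integral>\<^sup>+U. g (U \<bullet> e) (U \<bullet> f) \<partial>sphere_uniform)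
    = (\<integral>\<^sup>+\<xi>\<in>{- \<phi>..pi - \<phi>}. g (sin \<xi>) (cos \<xi>) \<partial>lborel)"
proof -
  have [measurable]: "ball (0::'a) 1 \<in> sets borel" by simp
  have gm: "(\<lambda>x. g (a x) (b x)) \<in> borel_measurable M"
    if "a \<in> borel_measurable M" "b \<in> borel_measurable M" for a b and M :: "'z measure"
    using measurable_compose[OF measurable_Pair[OF that] g] by simp
  let ?h = "\<lambda>x. g (sin x) (cos x)"
  let ?V = "emeasure lborel (ball (0::'a) 1)"
  define J where "J = (\<integral>\<^sup>+x\<in>{0..pi}. ?h x \<partial>lborel)"
  have hm [measurable]: "?h \<in> borel_measurable borel" by (rule gm) auto
  have per: "?h (x + pi) = ?h x" for x
    using hom[of "-1" "sin x" "cos x"] by simp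
  have V: "?V \<noteq> 0" "?V \<noteq> \<infinity>"
    using emeasure_lborel_ball_finite[of "0::'a" 1] content_ball_pos[of 1 "0::'a"]
    by (auto simp: measure_def)
  define G where "G z = g (z \<bullet> e) (z \<bullet> f)" for z
  have Gm [measurable]: "G \<in> borel_measurable borel" unfolding G_def by (rule gm) auto
  have rot: "(\<integral>\<^sup>+z\<in>ball 0 1. G (plane_rotation e f \<omega> z) \<partial>lborel) = (\<integral>\<^sup>+z\<in>ball 0 1. G z \<partial>lborel)" for \<omega>
  proof -
    let ?R = "plane_rotation e f \<omega>"
    have ot: "orthogonal_transformation ?R" by (rule orthogonal_plane_rotation[OF ef])
    have [measurable]: "ball (0::'a) 1 \<in> sets borel" by simp
    have m: "(\<lambda>z. G z * indicator (ball 0 1) z) \<in> borel_measurable borel" by measurable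
    have Rm: "?R \<in> borel_measurable borel" unfolding plane_rotation_def by measurable
    have "(\<integral>\<^sup>+z\<in>ball 0 1. G z \<partial>lborel) = (\<integral>\<^sup>+z. G z * indicator (ball 0 1) z \<partial>distr lborel borel ?R)"
      by (simp add: distr_lborel_orthogonal[OF ot])
    also have "\<dots> = (\<integral>\<^sup>+z. G (?R z) * indicator (ball 0 1) (?R z) \<partial>lborel)"
      using Rm m by (intro nn_integral_distr) simp_all
    also have "\<dots> = (\<integral>\<^sup>+z\<in>ball 0 1. G (?R z) \<partial>lborel)"
      using ot by (intro nn_integral_cong) (auto simp: indicator_def orthogonal_transformation)
    finally show ?thesis by simp
  qed
  have polar: "(\<integral>\<^sup>+\<omega>\<in>{0..pi}. G (plane_rotation e f \<omega> z) \<partial>lborel) = J" if "z \<bullet> e \<noteq> 0" for z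
  proof -
    \<comment> \<open>The sign of the radius brings the polar angle into [0, \<pi>]; by
      \<open>hom\<close> the integrand ignores a negative radius.\<close>
    define r where "r = sgn (z \<bullet> e) * sqrt ((z \<bullet> e)\<^sup>2 + (z \<bullet> f)\<^sup>2)"
    have pos: "(z \<bullet> e)\<^sup>2 + (z \<bullet> f)\<^sup>2 > 0" using that by (simp add: sum_power2_gt_zero_iff)
    have r: "r \<noteq> 0" using that pos by (auto simp: r_def sgn_zero_iff)
    have r2: "r\<^sup>2 = (z \<bullet> e)\<^sup>2 + (z \<bullet> f)\<^sup>2"
      using that pos by (auto simp: r_def power_mult_distrib sgn_if)
    have "(z \<bullet> f / r)\<^sup>2 + (z \<bullet> e / r)\<^sup>2 = 1"
      using that by (simp add: power_divide r2 add_divide_distrib[symmetric] add.commute)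
    moreover have "0 \<le> z \<bullet> e / r"
      using that pos by (auto simp: r_def sgn_if divide_simps)
    ultimately obtain \<alpha> where \<alpha>: "0 \<le> \<alpha>" "\<alpha> \<le> pi" "z \<bullet> f / r = cos \<alpha>" "z \<bullet> e / r = sin \<alpha>"
      using sincos_total_pi by blast
    have ze: "z \<bullet> e = r * sin \<alpha>" "z \<bullet> f = r * cos \<alpha>" using \<alpha> r by (auto simp: field_simps)
    have "G (plane_rotation e f \<omega> z) = ?h (\<alpha> + \<omega>)" for \<omega>
    proof -
      have "plane_rotation e f \<omega> z \<bullet> e = r * sin (\<alpha> + \<omega>)" "plane_rotation e f \<omega> z \<bullet> f = r * cos (\<alpha> + \<omega>)"
        by (simp_all add: plane_rotation_inner[OF ef] ze sin_add cos_add algebra_simps)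
      then show ?thesis using hom[OF r] by (simp add: G_def)
    qed
    then have "(\<integral>\<^sup>+\<omega>\<in>{0..pi}. G (plane_rotation e f \<omega> z) \<partial>lborel) = (\<integral>\<^sup>+\<omega>. ?h (\<alpha> + 1 * \<omega>) * indicator {\<alpha>..\<alpha> + pi} (\<alpha> + 1 * \<omega>) \<partial>lborel)"
      by (intro nn_integral_cong) (auto split: split_indicator)
    also have "\<dots> = (\<integral>\<^sup>+\<omega>\<in>{\<alpha>..\<alpha> + pi}. ?h \<omega> \<partial>lborel)"
      by (subst nn_integral_real_affine[where c = 1 and t = \<alpha>, of "\<lambda>x. ?h x * indicator {\<alpha>..\<alpha> + pi} x"]) auto
    also have "\<dots> = J" unfolding J_def by (rule nn_integral_half_turn_shift[OF hm per \<alpha>(1,2)])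
    finally show ?thesis .
  qed
  have e0: "e \<noteq> 0" using ef by auto
  have Rm2: "(\<lambda>(z, \<omega>). plane_rotation e f \<omega> z) \<in> borel_measurable (borel \<Otimes>\<^sub>M borel)"
    unfolding plane_rotation_def split_beta by measurable
  have m2: "(\<lambda>(z, \<omega>). G (plane_rotation e f \<omega> z) * indicator {0..pi} \<omega> * indicator (ball 0 1) z) \<in> borel_measurable (lborel \<Otimes>\<^sub>M lborel)"
    using measurable_compose[OF Rm2 Gm] unfolding split_beta by measurable
  have "ennreal pi * (\<integral>\<^sup>+z\<in>ball 0 1. G z \<partial>lborel) = (\<integral>\<^sup>+\<omega>. (\<integral>\<^sup>+z\<in>ball 0 1. G z \<partial>lborel) * indicator {0..pi} \<omega> \<partial>lborel)"
    by (subst nn_integral_cmult_indicator) (auto simp: mult.commute)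
  also have "\<dots> = (\<integral>\<^sup>+\<omega>. \<integral>\<^sup>+z. G (plane_rotation e f \<omega> z) * indicator {0..pi} \<omega> * indicator (ball 0 1) z \<partial>lborel \<partial>lborel)"
  proof (rule nn_integral_cong)
    fix \<omega> :: real
    have "(\<lambda>z. plane_rotation e f \<omega> z) \<in> borel_measurable borel" unfolding plane_rotation_def by measurable
    then have [measurable]: "(\<lambda>z. G (plane_rotation e f \<omega> z)) \<in> borel_measurable borel" by measurable
    have "(\<integral>\<^sup>+z. G (plane_rotation e f \<omega> z) * indicator {0..pi} \<omega> * indicator (ball 0 1) z \<partial>lborel)
      = (\<integral>\<^sup>+z. G (plane_rotation e f \<omega> z) * indicator (ball 0 1) z * indicator {0..pi} \<omega> \<partial>lborel)"
      by (simp add: mult_ac)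
    also have "\<dots> = (\<integral>\<^sup>+z. G (plane_rotation e f \<omega> z) * indicator (ball 0 1) z \<partial>lborel) * indicator {0..pi} \<omega>"
      by (rule nn_integral_multc) auto
    finally show "(\<integral>\<^sup>+z\<in>ball 0 1. G z \<partial>lborel) * indicator {0..pi} \<omega> =
      (\<integral>\<^sup>+z. G (plane_rotation e f \<omega> z) * indicator {0..pi} \<omega> * indicator (ball 0 1) z \<partial>lborel)"
      unfolding rot by simp
  qed
  also have "\<dots> = (\<integral>\<^sup>+z. \<integral>\<^sup>+\<omega>. G (plane_rotation e f \<omega> z) * indicator {0..pi} \<omega> * indicator (ball 0 1) z \<partial>lborel \<partial>lborel)"
    by (rule lborel_pair.Fubini'[OF m2])
  also have "\<dots> = (\<integral>\<^sup>+z. J * indicator (ball (0::'a) 1) z \<partial>lborel)"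
  proof (rule nn_integral_cong_AE)
    show "AE z in lborel. (\<integral>\<^sup>+\<omega>. G (plane_rotation e f \<omega> z) * indicator {0..pi} \<omega> * indicator (ball 0 1) z \<partial>lborel) = J * indicator (ball 0 1) z"
      using AE_lborel_inner_neq_0[OF e0]
    proof eventually_elim
      case (elim z)
      have "(\<lambda>\<omega>. plane_rotation e f \<omega> z) \<in> borel_measurable borel" unfolding plane_rotation_def by measurable
      then have [measurable]: "(\<lambda>\<omega>. G (plane_rotation e f \<omega> z)) \<in> borel_measurable borel" by measurable
      show ?case unfolding polar[OF elim, symmetric] by (rule nn_integral_multc) auto
    qed
  qed
  also have "\<dots> = J * ?V" by (rule nn_integral_cmult_indicator) auto
  finally have main: "ennreal pi * (\<integral>\<^sup>+z\<in>ball 0 1. G z \<partial>lborel) = J * ?V" .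
  have "ennreal pi * (\<integral>\<^sup>+U. G U \<partial>sphere_uniform) = ennreal pi * ((\<integral>\<^sup>+z\<in>ball 0 1. G z \<partial>lborel) / ?V)"
    by (subst nn_integral_sphere_uniform) (auto simp: G_def hom)
  also have "\<dots> = J * ?V / ?V" by (simp add: main[symmetric] ennreal_times_divide)
  also have "\<dots> = J" using V by (simp add: ennreal_mult_divide_eq)
  \<comment> \<open>The shift lemma needs a start in [0, \<pi>], hence the detour over \<pi> -
    \<phi> followed by a translation by \<pi>.\<close>
  also have "J = (\<integral>\<^sup>+\<xi>\<in>{pi - \<phi>..pi - \<phi> + pi}. ?h \<xi> \<partial>lborel)"
    unfolding J_def using \<phi> by (intro nn_integral_half_turn_shift[symmetric] hm per) auto
  also have "\<dots> = (\<integral>\<^sup>+\<xi>. ?h (pi + 1 * \<xi>) * indicator {pi - \<phi>..pi - \<phi> + pi} (pi + 1 * \<xi>) \<partial>lborel)"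
    by (subst nn_integral_real_affine[where c = 1 and t = pi]) auto
  also have "\<dots> = (\<integral>\<^sup>+\<xi>\<in>{- \<phi>..pi - \<phi>}. ?h \<xi> \<partial>lborel)"
    using per by (intro nn_integral_cong) (auto simp: add.commute[of pi] split: split_indicator)
  finally show ?thesis by (simp add: G_def)
qed

subsection \<open>The expected overlap\<close>

lemma jordan_sin:
  assumes "0 \<le> x" "x \<le> pi / 2"
  shows "2 / pi * x \<le> sin x"
proof -
  have "convex_on {0..pi/2} (\<lambda>x. - sin x)"
  proof (rule f''_ge0_imp_convex)
    show "DERIV (\<lambda>x. - sin x) x :> - cos x" for x :: real by (auto intro!: derivative_eq_intros)
    show "DERIV (\<lambda>x. - cos x) x :> sin x" for x :: real by (auto intro!: derivative_eq_intros)
    show "0 \<le> sin x" if "x \<in> {0..pi/2}" for x :: real using that by (intro sin_ge_zero) auto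
  qed auto
  then have "- sin ((1 - 2 / pi * x) *\<^sub>R 0 + (2 / pi * x) *\<^sub>R (pi / 2)) \<le> (1 - 2 / pi * x) * - sin 0 + (2 / pi * x) * - sin (pi / 2)"
    using assms by (intro convex_onD) (auto simp: divide_le_eq)
  then show ?thesis using assms by simp
qed

text \<open>The right side equals 2 artanh ((1 - a) / (1 + a)), and the left side is the first term
  of its series.\<close>

lemma ln_inverse_ge:
  assumes "0 < a" "a \<le> 1"
  shows "2 * (1 - a) / (1 + a) \<le> - ln (a::real)"
proof -
  let ?f = "\<lambda>a::real. - ln a - 2 * (1 - a) / (1 + a)"
  have "?f 1 \<le> ?f a"
  proof (rule DERIV_nonpos_imp_nonincreasing[OF assms(2)])
    fix x :: real assume x: "a \<le> x" "x \<le> 1"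
    then have x0: "0 < x" using assms by simp
    have "DERIV ?f x :> - (1 / x) - ((- 2) * (1 + x) - 2 * (1 - x)) / ((1 + x) * (1 + x))"
      using x0 by (auto intro!: derivative_eq_intros)
    moreover have "- (1 / x) - ((- 2) * (1 + x) - 2 * (1 - x)) / ((1 + x) * (1 + x)) = - ((1 - x)\<^sup>2 / (x * (1 + x)\<^sup>2))"
      using x0 by (simp add: divide_simps power2_eq_square) (simp add: algebra_simps)
    moreover have "0 \<le> (1 - x)\<^sup>2 / (x * (1 + x)\<^sup>2)" using x0 by simp
    ultimately show "\<exists>y. DERIV ?f x :> y \<and> y \<le> 0"
      by (intro exI[of _ "- ((1 - x)\<^sup>2 / (x * (1 + x)\<^sup>2))"]) simp
  qed
  then show ?thesis by simp
qed

text \<open>These inequalities make a cubic in \<open>a\<close> nonpositive on [0, 1] in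
  \<open>mean_overlap_obtuse\<close>, where \<phi> is \<pi> minus the obtuse angle. They bound its
  value at 0, the value at 1 of its linear part, and its value at 1.\<close>

lemma acute_angle_bounds:
  assumes "0 \<le> \<phi>" "\<phi> \<le> pi / 2"
  defines "s \<equiv> sin \<phi>" and "c \<equiv> cos \<phi>" and "\<gamma> \<equiv> pi - \<phi>"
  shows "3 * s + c * \<gamma> \<le> 4" "2 * s + 2 * s * c + (1 + 2 * c) * \<gamma> \<le> 4 + 8 * c" "\<gamma> + 2 * s \<le> 4"
proof -
  have s: "0 \<le> s" "s \<le> 1" and c: "0 \<le> c" "c \<le> 1" and sc: "s\<^sup>2 + c\<^sup>2 = 1"
    using assms by (auto simp: s_def c_def sin_ge_zero cos_ge_zero)
  have \<gamma>1: "\<gamma> \<le> pi - s" using assms sin_x_le_x[of \<phi>] by (simp add: \<gamma>_def s_def)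
  have "2 / pi * (pi / 2 - \<phi>) \<le> sin (pi / 2 - \<phi>)" using assms by (intro jordan_sin) auto
  then have "pi / 2 - \<phi> \<le> pi / 2 * c" by (simp add: c_def sin_cos_eq[symmetric] cos_sin_eq field_simps)
  then have \<gamma>2: "\<gamma> \<le> pi / 2 * (1 + c)" by (simp add: \<gamma>_def algebra_simps)
  have pi: "3 < pi" "pi < 3.1416" using pi_approx by auto
  show "3 * s + c * \<gamma> \<le> 4"
  proof -
    \<comment> \<open>The product of sine and cosine is (p^2 - 1) / 2. The bound 1.41422 is just
      above the square root of 2, and the resulting quadratic in p increases up to 3.1416.\<close>
    define p where "p = s + c"
    have p2: "p\<^sup>2 = 1 + 2 * s * c" using sc by (simp add: p_def power2_eq_square algebra_simps)
    have "2 * s * c \<le> 1" using sum_squares_bound[of s c] sc by simp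
    then have "p\<^sup>2 \<le> 1.41422\<^sup>2" using p2 by (simp add: power2_eq_square)
    then have ple: "p \<le> 1.41422" by (rule power2_le_imp_le) simp
    have "3 * s + c * \<gamma> \<le> 3 * s + c * (pi - s)" using \<gamma>1 c by (simp add: mult_left_mono)
    also have "\<dots> \<le> 3.1416 * s + 3.1416 * c - s * c"
    proof -
      have "c * pi \<le> c * 3.1416" using pi c by (intro mult_left_mono) auto
      then show ?thesis using s by (simp add: algebra_simps)
    qed
    also have "\<dots> = 3.1416 * p - (p\<^sup>2 - 1) / 2" using p2 by (simp add: p_def algebra_simps)
    also have "\<dots> \<le> 4"
    proof -
      have "3.1416 * p - (p\<^sup>2 - 1) / 2 = 3.1416 * q - (q\<^sup>2 - 1) / 2 - (q - p) * (3.1416 - (q + p) / 2)" for q :: real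
        by (simp add: power2_eq_square algebra_simps add_divide_distrib diff_divide_distrib)
      from this[of "1.41422"] have "3.1416 * p - (p\<^sup>2 - 1) / 2 \<le> 3.1416 * 1.41422 - (1.41422\<^sup>2 - 1) / 2"
        using mult_nonneg_nonneg[of "1.41422 - p" "3.1416 - (1.41422 + p) / 2"] ple by simp
      also have "\<dots> \<le> 4" by (simp add: power2_eq_square)
      finally show ?thesis .
    qed
    finally show ?thesis .
  qed
  show "2 * s + 2 * s * c + (1 + 2 * c) * \<gamma> \<le> 4 + 8 * c"
  proof -
    have 1: "(1 - c\<^sup>2 / 2)\<^sup>2 = 1 - c\<^sup>2 + (c\<^sup>2)\<^sup>2 / 4" by (simp add: power2_eq_square field_simps)
    have 2: "s\<^sup>2 = 1 - c\<^sup>2" using sc by simp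
    have 3: "c\<^sup>2 \<le> 1" using c by (simp add: power_le_one)
    have "s \<le> 1 - c\<^sup>2 / 2"
    proof (rule power2_le_imp_le)
      show "s\<^sup>2 \<le> (1 - c\<^sup>2 / 2)\<^sup>2" unfolding 1 2 by simp
      show "0 \<le> 1 - c\<^sup>2 / 2" using 3 by simp
    qed
    then have le1: "s * (2 + 2 * c) \<le> (1 - c\<^sup>2 / 2) * (2 + 2 * c)" using c by (intro mult_right_mono) auto
    have le2: "(1 + 2 * c) * \<gamma> \<le> (1 + 2 * c) * (3.1416 / 2 * (1 + c))"
    proof -
      have "pi / 2 * (1 + c) \<le> 3.1416 / 2 * (1 + c)" using pi c by (intro mult_right_mono) auto
      then show ?thesis using \<gamma>2 c by (intro mult_left_mono) auto
    qed
    have le3: "(1 - c\<^sup>2 / 2) * (2 + 2 * c) + (1 + 2 * c) * (3.1416 / 2 * (1 + c)) \<le> 4 + 8 * c"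
    proof -
      \<comment> \<open>The cubic in c is rewritten as a sum of visibly nonpositive terms; the
        coefficients result from 3.1416 in place of \<pi>.\<close>
      have "(1 - c\<^sup>2 / 2) * (2 + 2 * c) + (1 + 2 * c) * (3.1416 / 2 * (1 + c)) - (4 + 8 * c)
        = - (c * (1 - c)\<^sup>2) - 1416 / 10000 * (c * (1 - c)) - 1460 / 10000 * c - 4292 / 10000"
        by (simp add: power2_eq_square field_simps)
      moreover have "0 \<le> c * (1 - c)\<^sup>2" "0 \<le> c * (1 - c)" using c by auto
      moreover have "u \<le> v" if "u - v = - x - 1416 / 10000 * y - 1460 / 10000 * c - 4292 / 10000" "0 \<le> x" "0 \<le> y" for u v x y
        using that c by linarith
      ultimately show ?thesis by blast
    qed
    have "s * (2 + 2 * c) + (1 + 2 * c) * \<gamma> \<le> 4 + 8 * c"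
      by (rule order_trans[OF add_mono[OF le1 le2] le3])
    moreover have "s * (2 + 2 * c) = 2 * s + 2 * s * c" by (simp add: algebra_simps)
    ultimately show ?thesis by simp
  qed
  show "\<gamma> + 2 * s \<le> 4"
  proof -
    let ?f = "\<lambda>x::real. 2 * sin x - x"
    have D: "DERIV ?f x :> 2 * cos x - 1" for x by (auto intro!: derivative_eq_intros)
    \<comment> \<open>The maximum is at \<pi>/3, where the cosine is 1/2.\<close>
    have "?f \<phi> \<le> ?f (pi / 3)"
    proof (cases "\<phi> \<le> pi / 3")
      case True
      show ?thesis
      proof (rule DERIV_nonneg_imp_nondecreasing[OF True])
        fix x assume x: "\<phi> \<le> x" "x \<le> pi / 3"
        have "cos (pi / 3) \<le> cos x" using x assms by (intro cos_monotone_0_pi_le) auto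
        then show "\<exists>y. DERIV ?f x :> y \<and> 0 \<le> y" using D[of x] by (intro exI[of _ "2 * cos x - 1"]) (simp add: cos_60)
      qed
    next
      case False
      then have le: "pi / 3 \<le> \<phi>" by simp
      show ?thesis
      proof (rule DERIV_nonpos_imp_nonincreasing[OF le])
        fix x assume x: "pi / 3 \<le> x" "x \<le> \<phi>"
        have "cos x \<le> cos (pi / 3)" using x assms by (intro cos_monotone_0_pi_le) auto
        then show "\<exists>y. DERIV ?f x :> y \<and> y \<le> 0" using D[of x] by (intro exI[of _ "2 * cos x - 1"]) (simp add: cos_60)
      qed
    qed
    moreover have "sqrt 3 \<le> 1.75" by (rule real_le_lsqrt) (auto simp: power2_eq_square)
    moreover have "?f (pi / 3) = sqrt 3 - pi / 3" by (simp add: sin_60)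
    ultimately show ?thesis using pi by (simp add: s_def \<gamma>_def)
  qed
qed

text \<open>Closed form of the bound on the integral of \<open>circle_overlap\<close>, see
  \<open>nn_integral_circle_overlap\<close>. The arctangent is the length of a window on which the
  overlap is estimated by 1; the other term is an increment of an antiderivative.\<close>

definition mean_overlap :: "real \<Rightarrow> real \<Rightarrow> real" where
  "mean_overlap a \<gamma> = arctan (a * sin \<gamma> / (1 - a * cos \<gamma>))
     + a * (sin \<gamma> * (- ln a) + (a - cos \<gamma>) * \<gamma>) / (1 - 2 * a * cos \<gamma> + a\<^sup>2)"

text \<open>After arctan t \<le> t the claim is linear in - ln a with a coefficient of favorable
  sign, so this logarithm may be replaced by the rational lower bound of
  \<open>ln_inverse_ge\<close>. Clearing denominators leaves a cubic in \<open>a\<close>.\<close>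

lemma mean_overlap_obtuse:
  assumes a: "0 < a" "a \<le> 1" and g: "pi / 2 \<le> \<gamma>" "\<gamma> \<le> pi"
  shows "mean_overlap a \<gamma> \<le> a * (2 - ln a)"
proof -
  define s c l where "s = sin \<gamma>" and "c = - cos \<gamma>" and "l = - ln a"
  have sc: "s = sin (pi - \<gamma>)" "c = cos (pi - \<gamma>)" by (simp_all add: s_def c_def)
  have bnd: "3 * s + c * \<gamma> \<le> 4" "2 * s + 2 * s * c + (1 + 2 * c) * \<gamma> \<le> 4 + 8 * c" "\<gamma> + 2 * s \<le> 4"
    using acute_angle_bounds[of "pi - \<gamma>"] g unfolding sc by auto
  have s: "0 \<le> s" "s \<le> 1" and c: "0 \<le> c" "c \<le> 1"
    using g sin_ge_zero[of \<gamma>] cos_ge_zero[of "pi - \<gamma>"] cos_ge_minus_one[of \<gamma>] by (simp_all add: s_def c_def)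
  define r2 where "r2 = 1 + 2 * a * c + a\<^sup>2"
  have r2: "1 \<le> r2" using a c by (simp add: r2_def)
  have l: "2 * (1 - a) / (1 + a) \<le> l" using ln_inverse_ge[OF a] by (simp add: l_def)
  have ac: "0 \<le> a * c" using a c by simp
  have "arctan (a * s / (1 + a * c)) \<le> a * s / (1 + a * c)"
    using a s c by (intro arctan_le_self) auto
  also have "\<dots> \<le> a * s"
  proof -
    have "a * s * 1 \<le> a * s * (1 + a * c)" using ac a s by (intro mult_left_mono) auto
    then show ?thesis using ac by (simp add: divide_le_eq)
  qed
  finally have th: "arctan (a * s / (1 + a * c)) \<le> a * s" .
  have poly: "2 * s * (1 - a) + (1 + a) * (c + a) * \<gamma> + s * (1 + a) * r2 \<le> 4 * r2"
  proof -
    define p0 p1 p2 where "p0 = 3 * s + c * \<gamma> - 4"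
      and "p1 = - 2 * s + (1 + c) * \<gamma> + s * (1 + 2 * c) - 8 * c" and "p2 = \<gamma> + s * (1 + 2 * c) - 4"
    have eq: "2 * s * (1 - a) + (1 + a) * (c + a) * \<gamma> + s * (1 + a) * r2 - 4 * r2 = p0 + p1 * a + p2 * a\<^sup>2 + s * (a * a\<^sup>2)"
      by (simp add: p0_def p1_def p2_def r2_def power2_eq_square algebra_simps)
    have p0: "p0 \<le> 0" using bnd by (simp add: p0_def)
    have p01: "p0 + p1 \<le> 0" using bnd by (simp add: p0_def p1_def algebra_simps)
    have "p0 + p1 + p2 + s = (1 + c) * (2 * (\<gamma> + 2 * s - 4))"
      by (simp add: p0_def p1_def p2_def algebra_simps)
    also have "\<dots> \<le> 0" using bnd c by (intro mult_nonneg_nonpos) auto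
    finally have p0123: "p0 + p1 + p2 + s \<le> 0" .
    have a2: "0 \<le> a\<^sup>2" "a\<^sup>2 \<le> a" "a * a\<^sup>2 \<le> a\<^sup>2" using a by (auto simp: power2_eq_square mult_left_le_one_le mult_le_one)
    \<comment> \<open>A linear function on [0, 1] is nonpositive if it is so at both ends. The
      quadratic term is afterwards bounded by a linear one or by 0, according to its sign.\<close>
    have lin: "p0 + q * a \<le> 0" if "p0 + q \<le> 0" for q
    proof -
      have "p0 + q * a = (1 - a) * p0 + a * (p0 + q)" by (simp add: algebra_simps)
      also have "\<dots> \<le> 0" using mult_nonneg_nonpos[of "1 - a" p0] mult_nonneg_nonpos[of a "p0 + q"] a p0 that by simp
      finally show ?thesis .
    qed
    have "s * (a * a\<^sup>2) \<le> s * a\<^sup>2" using a2 s by (intro mult_left_mono) auto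
    then have *: "p2 * a\<^sup>2 + s * (a * a\<^sup>2) \<le> (p2 + s) * a\<^sup>2" by (simp add: algebra_simps)
    have "p0 + p1 * a + p2 * a\<^sup>2 + s * (a * a\<^sup>2) \<le> 0"
    proof (cases "p2 + s \<ge> 0")
      case True
      then have "(p2 + s) * a\<^sup>2 \<le> (p2 + s) * a" using a2 by (intro mult_left_mono) auto
      moreover have "p0 + (p1 + p2 + s) * a \<le> 0" using p0123 by (intro lin) auto
      ultimately show ?thesis using * by (simp add: algebra_simps)
    next
      case False
      then have "(p2 + s) * a\<^sup>2 \<le> 0" using a2 by (intro mult_nonpos_nonneg) auto
      then show ?thesis using * lin[OF p01] by (simp add: algebra_simps)
    qed
    then show ?thesis using eq by simp
  qed
  have "(s * l + (c + a) * \<gamma>) / r2 + s \<le> 2 + l"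
  proof -
    define l0 where "l0 = 2 * (1 - a) / (1 + a)"
    \<comment> \<open>The relation \<open>s \<le> 1 \<le> r2\<close> is what permits passing from l
      to its lower bound l0.\<close>
    have "s * (l - l0) \<le> r2 * (l - l0)"
      using r2 s l by (intro mult_right_mono) (auto simp: l0_def)
    moreover have "s * l0 + (c + a) * \<gamma> + s * r2 \<le> (2 + l0) * r2"
    proof -
      have eq: "(1 + a) * l0 = 2 * (1 - a)" using a by (simp add: l0_def)
      have "(1 + a) * (s * l0 + (c + a) * \<gamma> + s * r2) = s * ((1 + a) * l0) + (1 + a) * (c + a) * \<gamma> + s * (1 + a) * r2"
        by (simp add: algebra_simps)
      also have "\<dots> = 2 * s * (1 - a) + (1 + a) * (c + a) * \<gamma> + s * (1 + a) * r2"
        unfolding eq by (simp add: algebra_simps)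
      also have "\<dots> \<le> 4 * r2" by (rule poly)
      also have "\<dots> = (2 * (1 + a) + (1 + a) * l0) * r2" unfolding eq by (simp add: algebra_simps)
      also have "\<dots> = (1 + a) * ((2 + l0) * r2)" by (simp add: algebra_simps)
      finally show ?thesis using a by (subst (asm) mult_le_cancel_left_pos) auto
    qed
    ultimately have "s * l + (c + a) * \<gamma> \<le> (2 + l - s) * r2" by (simp add: algebra_simps)
    then have "(s * l + (c + a) * \<gamma>) / r2 \<le> 2 + l - s" using r2 by (simp add: divide_le_eq)
    then show ?thesis by simp
  qed
  then have "a * ((s * l + (c + a) * \<gamma>) / r2 + s) \<le> a * (2 + l)" using a by (intro mult_left_mono) auto
  then show ?thesis using th
    by (simp add: mean_overlap_def s_def[symmetric] r2_def c_def l_def algebra_simps)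
qed

text \<open>The derivative in the angle is nonnegative, so acute angles reduce to the right angle,
  which the obtuse case includes.\<close>

lemma mean_overlap_acute:
  assumes a: "0 < a" "a \<le> 1" and g: "0 < \<gamma>" "\<gamma> \<le> pi / 2"
  shows "mean_overlap a \<gamma> \<le> mean_overlap a (pi / 2)"
proof -
  have "\<exists>y. DERIV (mean_overlap a) x :> y \<and> 0 \<le> y" if x: "\<gamma> \<le> x" "x \<le> pi / 2" for x
  proof -
    define s c l where "s = sin x" and "c = cos x" and "l = - ln a"
    have s: "0 < s" and c: "0 \<le> c" using x g by (auto simp: s_def c_def sin_gt_zero cos_ge_zero)
    have sc: "s\<^sup>2 + c\<^sup>2 = 1" by (simp add: s_def c_def)
    have "c\<^sup>2 < 1\<^sup>2" using sc s by (metis less_add_same_cancel2 one_power2 zero_less_power)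
    then have c1: "c < 1" by (rule power2_less_imp_less) simp
    have "a * c \<le> c" using a c by (simp add: mult_left_le_one_le)
    then have q: "0 < 1 - a * c" using c1 by simp
    define r2 where "r2 = 1 - 2 * a * c + a\<^sup>2"
    have r2': "r2 = (1 - a * c)\<^sup>2 + (a * s)\<^sup>2"
      using arg_cong[OF sc, of "\<lambda>t. a\<^sup>2 * t"] by (simp add: r2_def power2_eq_square algebra_simps)
    then have r2: "0 < r2" using q by (simp add: add_pos_nonneg)
    have l0: "0 \<le> l" using a by (simp add: l_def)
    have D: "DERIV (mean_overlap a) x :>
       ((a * c * (1 - a * c) - a * s * (a * s)) / ((1 - a * c) * (1 - a * c))) * inverse (1 + (a * s / (1 - a * c))\<^sup>2)
       + (a * (c * l + (s * x + (a - c))) * r2 - a * (s * l + (a - c) * x) * (2 * a * s)) / (r2 * r2)"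
    proof -
      have "DERIV (\<lambda>x. a * sin x / (1 - a * cos x)) x :> (a * c * (1 - a * c) - a * s * (a * s)) / ((1 - a * c) * (1 - a * c))"
        using q unfolding s_def c_def by (auto intro!: derivative_eq_intros)
      from DERIV_chain2[OF DERIV_arctan this]
      have 1: "DERIV (\<lambda>x. arctan (a * sin x / (1 - a * cos x))) x :>
         ((a * c * (1 - a * c) - a * s * (a * s)) / ((1 - a * c) * (1 - a * c))) * inverse (1 + (a * s / (1 - a * c))\<^sup>2)"
        by (simp add: s_def c_def mult.commute)
      have 2: "DERIV (\<lambda>x. a * (sin x * (- ln a) + (a - cos x) * x)) x :> a * (c * l + (s * x + (a - c)))"
        unfolding s_def c_def l_def by (auto intro!: derivative_eq_intros)
      have 3: "DERIV (\<lambda>x. 1 - 2 * a * cos x + a\<^sup>2) x :> 2 * a * s"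
        unfolding s_def by (auto intro!: derivative_eq_intros)
      have "1 - 2 * a * cos x + a\<^sup>2 \<noteq> 0" using r2 by (simp add: r2_def c_def)
      from DERIV_add[OF 1 DERIV_divide[OF 2 3 this]] show ?thesis
        by (simp only: mean_overlap_def[abs_def] s_def c_def l_def r2_def)
    qed
    have t1: "((a * c * (1 - a * c) - a * s * (a * s)) / ((1 - a * c) * (1 - a * c))) * inverse (1 + (a * s / (1 - a * c))\<^sup>2)
      = a * (c - a) / r2"
    proof -
      have "1 + (a * s / (1 - a * c))\<^sup>2 = r2 / (1 - a * c)\<^sup>2" using q by (simp add: r2' field_simps)
      moreover have "a * c * (1 - a * c) - a * s * (a * s) = a * (c - a)"
        using arg_cong[OF sc, of "\<lambda>t. a\<^sup>2 * t"] by (simp add: power2_eq_square algebra_simps)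
      moreover have "t / (u * u) * inverse (r2 / u\<^sup>2) = t / r2" if "u \<noteq> 0" for t u
        using that r2 by (simp add: power2_eq_square field_simps)
      ultimately show ?thesis using q by simp
    qed
    have t2: "a * (c - a) / r2 + (a * (c * l + (s * x + (a - c))) * r2 - a * (s * l + (a - c) * x) * (2 * a * s)) / (r2 * r2)
      = a * (l * ((1 + a\<^sup>2) * c - 2 * a) + x * s * (1 - a\<^sup>2)) / (r2 * r2)"
    proof -
      have "(c - a) * r2 + ((c * l + (s * x + (a - c))) * r2 - (s * l + (a - c) * x) * (2 * a * s))
        = l * (c * r2 - 2 * a * s\<^sup>2) + x * s * (r2 - 2 * a * (a - c))"
        by (simp add: power2_eq_square algebra_simps)
      also have "c * r2 - 2 * a * s\<^sup>2 = (1 + a\<^sup>2) * c - 2 * a"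
        using arg_cong[OF sc, of "\<lambda>t. 2 * a * t"] by (simp add: r2_def power2_eq_square algebra_simps)
      also have "r2 - 2 * a * (a - c) = 1 - a\<^sup>2" by (simp add: r2_def power2_eq_square algebra_simps)
      finally have "a * ((c - a) * r2 + ((c * l + (s * x + (a - c))) * r2 - (s * l + (a - c) * x) * (2 * a * s)))
        = a * (l * ((1 + a\<^sup>2) * c - 2 * a) + x * s * (1 - a\<^sup>2))" by simp
      moreover have "a * (c - a) / r2 = a * (c - a) * r2 / (r2 * r2)" using r2 by simp
      ultimately show ?thesis by (simp add: add_divide_distrib[symmetric] algebra_simps)
    qed
    \<comment> \<open>The expression is at least 2 a l (c + x s - 1), by 2 a \<le> 1 + a^2 and 2 a l
      \<le> 1 - a^2; the last factor is nonnegative because cos t + t sin t increases from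
      1.\<close>
    have "0 \<le> l * ((1 + a\<^sup>2) * c - 2 * a) + x * s * (1 - a\<^sup>2)"
    proof -
      have al: "2 * a * l \<le> 1 - a\<^sup>2"
      proof -
        have "(\<lambda>a::real. 1 - a\<^sup>2 + 2 * (a * ln a)) 1 \<le> (\<lambda>a. 1 - a\<^sup>2 + 2 * (a * ln a)) a"
        proof (rule DERIV_nonpos_imp_nonincreasing[OF a(2)])
          fix t :: real assume t: "a \<le> t" "t \<le> 1"
          have "DERIV (\<lambda>a. 1 - a\<^sup>2 + 2 * (a * ln a)) t :> - 2 * t + 2 * (ln t + 1)"
            using t a by (auto intro!: derivative_eq_intros)
          moreover have "ln t \<le> t - 1" using t a by (intro ln_le_minus_one) auto
          ultimately show "\<exists>y. DERIV (\<lambda>a. 1 - a\<^sup>2 + 2 * (a * ln a)) t :> y \<and> y \<le> 0"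
            by (intro exI[of _ "- 2 * t + 2 * (ln t + 1)"]) auto
        qed
        then show ?thesis by (simp add: l_def)
      qed
      have xs: "0 \<le> x * s" using x g s by simp
      have "(x * s) * (2 * a * l) \<le> (x * s) * (1 - a\<^sup>2)" using al xs by (rule mult_left_mono)
      moreover have "l * (2 * a * c - 2 * a) \<le> l * ((1 + a\<^sup>2) * c - 2 * a)"
      proof -
        have "2 * a \<le> 1 + a\<^sup>2" using sum_squares_bound[of 1 a] by simp
        then have "2 * a * c \<le> (1 + a\<^sup>2) * c" using c by (rule mult_right_mono)
        then show ?thesis using l0 by (intro mult_left_mono) auto
      qed
      moreover have "0 \<le> 2 * a * l * (c + x * s - 1)"
      proof -
        have "(\<lambda>t. cos t + t * sin t) 0 \<le> (\<lambda>t. cos t + t * sin t) x"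
        proof (rule DERIV_nonneg_imp_nondecreasing[where f = "\<lambda>t. cos t + t * sin t"])
          fix t assume t: "0 \<le> t" "t \<le> x"
          have "DERIV (\<lambda>t. cos t + t * sin t) t :> t * cos t" by (auto intro!: derivative_eq_intros)
          moreover have "0 \<le> t * cos t" using t x by (intro mult_nonneg_nonneg cos_ge_zero) auto
          ultimately show "\<exists>y. DERIV (\<lambda>t. cos t + t * sin t) t :> y \<and> 0 \<le> y" by blast
        qed (use x g in auto)
        then show ?thesis using a l0 by (simp add: s_def c_def)
      qed
      ultimately show ?thesis by (simp add: algebra_simps)
    qed
    then have "0 \<le> a * (l * ((1 + a\<^sup>2) * c - 2 * a) + x * s * (1 - a\<^sup>2)) / (r2 * r2)"
      using a r2 by simp
    then show ?thesis using D unfolding t1 t2 by blast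
  qed
  then show ?thesis by (rule DERIV_nonneg_imp_nondecreasing[where f = "mean_overlap a", OF g(2)])
qed

lemma mean_overlap_le:
  assumes a: "0 < a" "a \<le> 1" and g: "0 < \<gamma>" "\<gamma> < pi"
  shows "mean_overlap a \<gamma> \<le> a * (2 - ln a)"
proof (cases "\<gamma> \<le> pi / 2")
  case True
  then show ?thesis using mean_overlap_acute[OF a g(1) True] mean_overlap_obtuse[OF a, of "pi / 2"] by simp
next
  case False
  then show ?thesis using mean_overlap_obtuse[OF a, of \<gamma>] g by simp
qed

text \<open>The overlap in a triangle x, q, z whose sides at q have lengths a (to x) and 1 (to z)
  and enclose the angle \<gamma>. The direction has the coordinates sin \<xi> along z - q and cos
  \<xi> along a perpendicular vector.\<close>

definition circle_overlap :: "real \<Rightarrow> real \<Rightarrow> real \<Rightarrow> real" where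
  "circle_overlap a \<gamma> \<xi> = max 0 (min 1 (a * sin (\<gamma> - \<xi>) / (a * sin (\<gamma> - \<xi>) + sin \<xi>)))"

lemma circle_overlap_measurable [measurable]: "circle_overlap a \<gamma> \<in> borel_measurable borel"
  unfolding circle_overlap_def[abs_def] by measurable

context
  fixes a \<gamma> :: real
  assumes a: "0 < a" "a \<le> 1" and \<gamma>: "0 < \<gamma>" "\<gamma> < pi"
begin

text \<open>The angle of that triangle at z. By \<open>denom_eq\<close> the denominator of
  \<open>circle_overlap\<close>, which is the projection of z - x, changes sign at -
  \<theta>.\<close>

private definition "\<theta> = arctan (a * sin \<gamma> / (1 - a * cos \<gamma>))"

private lemma sin\<gamma>: "0 < sin \<gamma>"
  using \<gamma> by (intro sin_gt_zero) auto

private lemma q: "0 < 1 - a * cos \<gamma>"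
proof (cases "cos \<gamma> \<le> 0")
  case True
  then have "a * cos \<gamma> \<le> 0" using a by (simp add: mult_nonneg_nonpos)
  then show ?thesis by simp
next
  case False
  have "cos \<gamma> < cos 0" using \<gamma> by (intro cos_monotone_0_pi) auto
  moreover have "a * cos \<gamma> \<le> cos \<gamma>" using a False by (simp add: mult_left_le_one_le)
  ultimately show ?thesis by simp
qed

private lemma \<theta>_bounds: "0 < \<theta>" "\<theta> < pi / 2"
  using q sin\<gamma> a arctan_ubound[of "a * sin \<gamma> / (1 - a * cos \<gamma>)"] by (simp_all add: \<theta>_def)

private lemma denom_eq:
  "a * sin (\<gamma> - \<xi>) + sin \<xi> = (1 - a * cos \<gamma>) / cos \<theta> * sin (\<theta> + \<xi>)"
proof -
  have c: "cos \<theta> > 0" using \<theta>_bounds by (intro cos_gt_zero) auto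
  have "tan \<theta> = a * sin \<gamma> / (1 - a * cos \<gamma>)" by (simp add: \<theta>_def tan_arctan)
  then have "sin \<theta> / cos \<theta> = a * sin \<gamma> / (1 - a * cos \<gamma>)" by (simp add: tan_def)
  then have s: "(1 - a * cos \<gamma>) / cos \<theta> * sin \<theta> = a * sin \<gamma>"
    using q c by (simp add: field_simps)
  have "(1 - a * cos \<gamma>) / cos \<theta> * sin (\<theta> + \<xi>)
    = (1 - a * cos \<gamma>) / cos \<theta> * sin \<theta> * cos \<xi> + (1 - a * cos \<gamma>) / cos \<theta> * cos \<theta> * sin \<xi>"
    by (simp add: sin_add algebra_simps)
  also have "\<dots> = a * sin \<gamma> * cos \<xi> + (1 - a * cos \<gamma>) * sin \<xi>" unfolding s using c by simp
  finally show ?thesis by (simp add: sin_diff algebra_simps)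
qed

text \<open>The law of sines, a sin (\<gamma> + \<theta>) = sin \<theta>, is \<open>denom_eq\<close>
  at the zero - \<theta>; \<open>jordan_sin\<close> then converts the sine into the angle.\<close>

private lemma \<theta>_le: "\<theta> \<le> pi / 2 * a"
proof -
  have "a * sin (\<gamma> + \<theta>) = sin \<theta>" using denom_eq[of "- \<theta>"] by simp
  moreover have "a * sin (\<gamma> + \<theta>) \<le> a" using a by simp
  ultimately have "2 / pi * \<theta> \<le> a" using jordan_sin[of \<theta>] \<theta>_bounds by simp
  then show ?thesis by (simp add: field_simps)
qed

private lemma overlap_left:
  assumes "\<gamma> - pi \<le> \<xi>" "\<xi> < - \<theta>"
  shows "circle_overlap a \<gamma> \<xi> = 0"
proof -
  have "0 < sin (- (\<theta> + \<xi>))" using assms \<gamma> \<theta>_bounds by (intro sin_gt_zero) auto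
  then have "sin (\<theta> + \<xi>) < 0" unfolding sin_minus by simp
  then have "a * sin (\<gamma> - \<xi>) + sin \<xi> < 0"
    unfolding denom_eq using q \<theta>_bounds by (intro mult_pos_neg divide_pos_pos cos_gt_zero) auto
  moreover have "0 \<le> a * sin (\<gamma> - \<xi>)" using assms a \<theta>_bounds \<gamma> by (intro mult_nonneg_nonneg sin_ge_zero) auto
  ultimately have "a * sin (\<gamma> - \<xi>) / (a * sin (\<gamma> - \<xi>) + sin \<xi>) \<le> 0" by (simp add: divide_nonneg_neg)
  then show ?thesis by (simp add: circle_overlap_def)
qed

private lemma denom_pos:
  assumes "0 \<le> \<xi>" "\<xi> \<le> \<gamma>"
  shows "0 \<le> a * sin (\<gamma> - \<xi>)" "0 < a * sin (\<gamma> - \<xi>) + sin \<xi>"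
proof -
  show "0 \<le> a * sin (\<gamma> - \<xi>)" using assms a \<gamma> by (intro mult_nonneg_nonneg sin_ge_zero) auto
  moreover have "0 < sin \<xi>" if "\<xi> > 0" using that assms \<gamma> by (intro sin_gt_zero) auto
  moreover have "0 < a * sin (\<gamma> - \<xi>)" if "\<xi> = 0" using that a sin\<gamma> by simp
  ultimately show "0 < a * sin (\<gamma> - \<xi>) + sin \<xi>" using assms by (cases "\<xi> = 0") (auto intro: add_nonneg_pos)
qed

text \<open>The window is the half turn on which the numerator is nonnegative. There the overlap
  vanishes before - \<theta>, is at most 1 up to 0, and is at most the unclamped quotient from 0 to
  \<gamma>.\<close>

lemma nn_integral_circle_overlap:
  "(\<integral>\<^sup>+\<xi>\<in>{\<gamma> - pi..\<gamma>}. ennreal (circle_overlap a \<gamma> \<xi>) \<partial>lborel) \<le> ennreal (mean_overlap a \<gamma>)"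
proof -
  define F where "F \<xi> = a * sin (\<gamma> - \<xi>) / (a * sin (\<gamma> - \<xi>) + sin \<xi>)" for \<xi>
  have [measurable]: "F \<in> borel_measurable borel" unfolding F_def[abs_def] by measurable
  define s k r2 where "s = sin \<gamma>" and "k = cos \<gamma>" and "r2 = 1 - 2 * a * k + a\<^sup>2"
  have sk: "s\<^sup>2 = 1 - k\<^sup>2" by (simp add: s_def k_def sin_squared_eq)
  have "r2 = (1 - a * k)\<^sup>2 + (a * s)\<^sup>2" by (simp add: r2_def sk power_mult_distrib) (simp add: power2_eq_square algebra_simps)
  then have r2: "0 < r2" using q by (simp add: k_def add_pos_nonneg)
  \<comment> \<open>The numerator is a combination of the denominator d and its derivative, so F = A
    + B d'/d with A = a (a - k) / r2 and B = a s / r2; \<open>K\<close> is the antiderivative of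
    this.\<close>
  define K where "K \<xi> = a * (a - k) / r2 * \<xi> + a * s / r2 * ln (a * sin (\<gamma> - \<xi>) + sin \<xi>)" for \<xi>
  have K: "DERIV K \<xi> :> F \<xi>" if "\<xi> \<in> {0..\<gamma>}" for \<xi>
  proof -
    define d where "d = a * sin (\<gamma> - \<xi>) + sin \<xi>"
    have d: "d > 0" using denom_pos that by (simp add: d_def)
    have deq: "d = a * s * cos \<xi> + (1 - a * k) * sin \<xi>"
      by (simp add: d_def s_def k_def sin_diff algebra_simps)
    have "DERIV K \<xi> :> a * (a - k) / r2 + a * s / r2 * ((cos \<xi> - a * cos (\<gamma> - \<xi>)) / d)"
      unfolding K_def[abs_def] using d r2 unfolding d_def by (auto intro!: derivative_eq_intros simp: mult_ac)
    moreover have "a * (a - k) / r2 + a * s / r2 * ((cos \<xi> - a * cos (\<gamma> - \<xi>)) / d) = F \<xi>"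
    proof -
      have "(a - k) * d + s * (cos \<xi> - a * cos (\<gamma> - \<xi>)) = r2 * sin (\<gamma> - \<xi>)"
        using arg_cong[OF sk, of "\<lambda>t. a * sin \<xi> * t"]
        by (simp add: deq r2_def s_def[symmetric] k_def[symmetric] sin_diff cos_diff power2_eq_square algebra_simps)
      then have "a * ((a - k) * d + s * (cos \<xi> - a * cos (\<gamma> - \<xi>))) / (r2 * d) = a * (r2 * sin (\<gamma> - \<xi>)) / (r2 * d)"
        by simp
      also have "\<dots> = F \<xi>" using r2 by (simp add: F_def d_def)
      finally have eq: "a * ((a - k) * d + s * (cos \<xi> - a * cos (\<gamma> - \<xi>))) / (r2 * d) = F \<xi>" .
      have "a * (a - k) / r2 + a * s / r2 * (t / d) = a * ((a - k) * d + s * t) / (r2 * d)" for t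
        using r2 d by (simp add: field_simps)
      then show ?thesis using eq by simp
    qed
    ultimately show ?thesis by simp
  qed
  have Fpos: "0 \<le> F \<xi>" if "\<xi> \<in> {0..\<gamma>}" for \<xi>
    using denom_pos[of \<xi>] that by (simp add: F_def)
  have IF: "(\<integral>\<^sup>+\<xi>\<in>{0..\<gamma>}. ennreal (F \<xi>) \<partial>lborel) = ennreal (K \<gamma> - K 0)"
    using K Fpos \<gamma> by (intro nn_integral_FTC_Icc) auto
  have K\<gamma>: "K \<gamma> - K 0 = a * (s * (- ln a) + (a - k) * \<gamma>) / r2"
    using a sin\<gamma> r2 by (simp add: K_def s_def ln_mult add_divide_distrib diff_divide_distrib algebra_simps)
  have "(\<integral>\<^sup>+\<xi>\<in>{\<gamma> - pi..\<gamma>}. ennreal (circle_overlap a \<gamma> \<xi>) \<partial>lborel)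
    \<le> (\<integral>\<^sup>+\<xi>. indicator {- \<theta>..0} \<xi> + ennreal (F \<xi>) * indicator {0..\<gamma>} \<xi> \<partial>lborel)"
  proof (rule nn_integral_mono)
    fix \<xi> :: real
    consider "\<xi> \<notin> {\<gamma> - pi..\<gamma>}" | "\<gamma> - pi \<le> \<xi>" "\<xi> < - \<theta>" | "- \<theta> \<le> \<xi>" "\<xi> \<le> 0" | "0 < \<xi>" "\<xi> \<le> \<gamma>" by fastforce
    then show "ennreal (circle_overlap a \<gamma> \<xi>) * indicator {\<gamma> - pi..\<gamma>} \<xi> \<le> indicator {- \<theta>..0} \<xi> + ennreal (F \<xi>) * indicator {0..\<gamma>} \<xi>"
    proof cases
      case 2
      then show ?thesis using overlap_left by simp
    next
      case 3
      have "ennreal (circle_overlap a \<gamma> \<xi>) \<le> 1" by (simp add: circle_overlap_def)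
      then have "ennreal (circle_overlap a \<gamma> \<xi>) * indicator {\<gamma> - pi..\<gamma>} \<xi> \<le> 1" by (auto split: split_indicator)
      then show ?thesis using 3 by (auto intro: order_trans)
    next
      case 4
      have "circle_overlap a \<gamma> \<xi> \<le> F \<xi>" using Fpos[of \<xi>] 4 by (simp add: circle_overlap_def F_def)
      then show ?thesis using 4 \<gamma> by (auto intro!: ennreal_leI split: split_indicator)
    qed simp
  qed
  also have "\<dots> = (\<integral>\<^sup>+\<xi>. indicator {- \<theta>..0} \<xi> \<partial>lborel) + (\<integral>\<^sup>+\<xi>\<in>{0..\<gamma>}. ennreal (F \<xi>) \<partial>lborel)"
    by (rule nn_integral_add) auto
  also have "\<dots> = ennreal \<theta> + ennreal (K \<gamma> - K 0)"
    using \<theta>_bounds by (simp add: IF)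
  also have "\<dots> = ennreal (\<theta> + (K \<gamma> - K 0))"
  proof -
    have "K 0 \<le> K \<gamma>"
      by (rule DERIV_nonneg_imp_nondecreasing[where f = K]) (use \<gamma> K Fpos in auto)
    then show ?thesis using \<theta>_bounds by (simp add: ennreal_plus)
  qed
  also have "\<theta> + (K \<gamma> - K 0) = mean_overlap a \<gamma>"
    unfolding K\<gamma> by (simp add: mean_overlap_def \<theta>_def s_def k_def r2_def)
  finally show ?thesis .
qed

text \<open>An overlap of at least u requires \<xi> \<ge> - \<theta> and, for \<xi> > 0, sin \<xi>
  \<le> a' sin (\<gamma> - \<xi>) with a' = a (1/u - 1). By \<open>jordan_sin\<close> the two sides
  of 0 contribute at most \<pi>/2 a and \<pi>/2 a', which add up to \<pi> a / (2 u).\<close>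

lemma emeasure_circle_overlap_ge:
  assumes u: "0 < u" "u \<le> 1" and small: "a * (1 / u - 1) < 1"
  shows "emeasure lborel {\<xi> \<in> {\<gamma> - pi..\<gamma>}. u \<le> circle_overlap a \<gamma> \<xi>} \<le> ennreal (pi * (a / (2 * u)))"
proof -
  define a' where "a' = a * (1 / u - 1)"
  have a': "0 \<le> a'" "a' < 1" using u a small by (auto simp: a'_def field_simps)
  have "{\<xi> \<in> {\<gamma> - pi..\<gamma>}. u \<le> circle_overlap a \<gamma> \<xi>} \<subseteq> {- \<theta>..pi / 2 * a'}"
  proof
    fix \<xi> assume \<xi>: "\<xi> \<in> {\<xi> \<in> {\<gamma> - pi..\<gamma>}. u \<le> circle_overlap a \<gamma> \<xi>}"
    have "- \<theta> \<le> \<xi>" using overlap_left[of \<xi>] \<xi> u by force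
    moreover have "\<xi> \<le> pi / 2 * a'"
    proof (cases "\<xi> \<le> 0")
      case True
      have "0 \<le> pi / 2 * a'" using a' by simp
      then show ?thesis using True by linarith
    next
      case False
      note d = denom_pos[of \<xi>]
      have "u \<le> a * sin (\<gamma> - \<xi>) / (a * sin (\<gamma> - \<xi>) + sin \<xi>)"
        using \<xi> u by (auto simp: circle_overlap_def le_max_iff_disj)
      then have "u * (a * sin (\<gamma> - \<xi>) + sin \<xi>) \<le> a * sin (\<gamma> - \<xi>)"
        using d \<xi> False by (simp add: le_divide_eq)
      moreover have ua: "u * a' = a * (1 - u)" using u by (simp add: a'_def field_simps)
      have "u * (a' * sin (\<gamma> - \<xi>)) = a * (1 - u) * sin (\<gamma> - \<xi>)" unfolding ua[symmetric] by simp
      ultimately have "u * sin \<xi> \<le> u * (a' * sin (\<gamma> - \<xi>))"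
        by (simp add: algebra_simps)
      then have le: "sin \<xi> \<le> a' * sin (\<gamma> - \<xi>)" using u by simp
      have pos: "0 < sin \<xi>" using False \<xi> \<gamma> by (intro sin_gt_zero) auto
      \<comment> \<open>Beyond \<pi>/2 one has sin (\<gamma> - \<xi>) \<le> sin \<xi>, which
        contradicts a' < 1.\<close>
      have "\<xi> \<le> pi / 2"
      proof (rule ccontr)
        assume c: "\<not> \<xi> \<le> pi / 2"
        have "sin (\<gamma> - \<xi>) \<le> sin (pi - \<xi>)"
          using c \<xi> \<gamma> by (intro sin_monotone_2pi_le) auto
        then have "a' * sin (\<gamma> - \<xi>) \<le> a' * sin \<xi>" using a' by (intro mult_left_mono) auto
        also have "\<dots> < 1 * sin \<xi>" using a' pos by (intro mult_strict_right_mono) auto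
        finally show False using le by simp
      qed
      then have "2 / pi * \<xi> \<le> sin \<xi>" using False by (intro jordan_sin) auto
      also have "\<dots> \<le> a' * sin (\<gamma> - \<xi>)" by (rule le)
      also have "\<dots> \<le> a'" using a' by (simp add: mult_left_le)
      finally show ?thesis by (simp add: field_simps)
    qed
    ultimately show "\<xi> \<in> {- \<theta>..pi / 2 * a'}" by simp
  qed
  then have "emeasure lborel {\<xi> \<in> {\<gamma> - pi..\<gamma>}. u \<le> circle_overlap a \<gamma> \<xi>} \<le> emeasure lborel {- \<theta>..pi / 2 * a'}"
    by (intro emeasure_mono) auto
  also have "\<dots> = ennreal (pi / 2 * a' + \<theta>)"
  proof -
    have "0 \<le> pi / 2 * a'" using a' by simp
    then have "- \<theta> \<le> pi / 2 * a'" using \<theta>_bounds by linarith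
    then show ?thesis by (subst emeasure_lborel_Icc) auto
  qed
  also have "\<dots> \<le> ennreal (pi * (a / (2 * u)))"
  proof (rule ennreal_leI)
    have "pi / 2 * a' + pi / 2 * a = pi * (a / (2 * u))" using u by (simp add: a'_def field_simps)
    then show "pi / 2 * a' + \<theta> \<le> pi * (a / (2 * u))" using \<theta>_le by simp
  qed
  finally show ?thesis .
qed

end

section \<open>From the circle to random directions in space\<close>

definition direction_overlap :: "'a::euclidean_space \<Rightarrow> 'a \<Rightarrow> 'a \<Rightarrow> real" where
  "direction_overlap w v U = max 0 (min 1 ((w \<bullet> U) / ((w + v) \<bullet> U)))"

lemma direction_overlap_measurable [measurable]: "direction_overlap w v \<in> borel_measurable borel"
  unfolding direction_overlap_def[abs_def] by measurable

lemma direction_overlap_bounds: "0 \<le> direction_overlap w v U" "direction_overlap w v U \<le> 1"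
  by (auto simp: direction_overlap_def)

text \<open>In the plane spanned by \<open>w\<close> and \<open>v\<close> the overlap is \<^const>\<open>circle_overlap\<close>; if they are
  parallel, it is constant.\<close>

lemma direction_overlap_cases:
  fixes w v :: "'a::euclidean_space"
  assumes w: "w \<noteq> 0" and le: "norm w \<le> norm v"
  defines "a \<equiv> norm w / norm v"
  obtains (parallel) "\<And>U. direction_overlap w v U \<le> a / (1 + a)"
  | (plane) e f \<gamma> g where "e \<bullet> e = 1" "f \<bullet> f = 1" "e \<bullet> f = 0" "0 < \<gamma>" "\<gamma> < pi"
    "(\<lambda>(x, y). g x y) \<in> borel_measurable (borel \<Otimes>\<^sub>M borel)"
    "\<And>c x y. c \<noteq> 0 \<Longrightarrow> g (c * x) (c * y) = g x y"
    "\<And>U. direction_overlap w v U = g (U \<bullet> e) (U \<bullet> f)"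
    "\<And>\<xi>. g (sin \<xi>) (cos \<xi>) = circle_overlap a \<gamma> \<xi>"
proof -
  have v: "v \<noteq> 0" "norm v > 0" using w le by auto
  have a: "0 < a" "a \<le> 1" using w v le by (auto simp: a_def)
  define e where "e = v /\<^sub>R norm v"
  define w1 where "w1 = w /\<^sub>R norm w"
  define c where "c = w1 \<bullet> e"
  have ee: "e \<bullet> e = 1" using v by (simp add: e_def dot_square_norm power2_eq_square)
  have ww: "w1 \<bullet> w1 = 1" using w by (simp add: w1_def dot_square_norm power2_eq_square)
  have veq: "v = norm v *\<^sub>R e" using v by (simp add: e_def)
  have weq: "w = norm w *\<^sub>R w1" using w by (simp add: w1_def)
  define d where "d = w1 - c *\<^sub>R e"
  have de: "d \<bullet> e = 0" by (simp add: d_def c_def inner_diff_left ee)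
  have dd: "d \<bullet> d = 1 - c\<^sup>2"
    by (simp add: d_def inner_diff_left inner_diff_right ee ww c_def inner_commute power2_eq_square)
  have ratio: "(w \<bullet> U) / ((w + v) \<bullet> U) = a * (w1 \<bullet> U) / (a * (w1 \<bullet> U) + e \<bullet> U)" for U
  proof -
    have "w \<bullet> U = norm v * (a * (w1 \<bullet> U))" using v by (subst weq) (simp add: a_def)
    moreover have "v \<bullet> U = norm v * (e \<bullet> U)" by (subst veq) simp
    ultimately have "(w \<bullet> U) / ((w + v) \<bullet> U) = norm v * (a * (w1 \<bullet> U)) / (norm v * (a * (w1 \<bullet> U) + e \<bullet> U))"
      by (simp add: inner_add_left distrib_left)
    then show ?thesis using v by simp
  qed
  show ?thesis
  proof (cases "d = 0")
    case True
    then have w1: "w1 = c *\<^sub>R e" by (simp add: d_def)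
    have "c\<^sup>2 = 1" using dd True by simp
    then have c: "c = 1 \<or> c = -1" by (simp add: power2_eq_1_iff)
    have "direction_overlap w v U \<le> a / (1 + a)" for U
    proof (cases "e \<bullet> U = 0")
      case True
      then show ?thesis using a by (simp add: direction_overlap_def ratio w1)
    next
      case False
      have "a * (w1 \<bullet> U) / (a * (w1 \<bullet> U) + e \<bullet> U) = (e \<bullet> U) * (a * c) / ((e \<bullet> U) * (a * c + 1))"
        by (simp add: w1 algebra_simps)
      also have "\<dots> = a * c / (a * c + 1)" using False by simp
      \<comment> \<open>For c = 1 this is an equality. For c = -1 the quotient is nonpositive, also
        at a = 1, where division by 0 gives 0.\<close>
      also have "\<dots> \<le> a / (1 + a)"
      proof -
        have "- a / (1 - a) \<le> 0" using a by (simp add: divide_nonpos_nonneg)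
        also have "0 \<le> a / (1 + a)" using a by simp
        finally show ?thesis using c by (auto simp: add.commute)
      qed
      finally show ?thesis using a by (simp add: direction_overlap_def ratio)
    qed
    then show ?thesis by (rule parallel)
  next
    case False
    then have "0 < 1 - c\<^sup>2" using dd by (metis inner_gt_zero_iff)
    then have c2: "c\<^sup>2 < 1\<^sup>2" by simp
    then have c1: "\<bar>c\<bar> < 1" by (simp add: abs_square_less_1)
    \<comment> \<open>The minus sign makes \<gamma> the angle between v and - w, which for w = q - x
      and v = z - q is the angle at q.\<close>
    define \<gamma> where "\<gamma> = arccos (- c)"
    have \<gamma>: "0 < \<gamma>" "\<gamma> < pi" "cos \<gamma> = - c"
      using c1 arccos_lt_bounded[of "- c"] by (auto simp: \<gamma>_def)
    define s where "s = sin \<gamma>"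
    have s: "0 < s" "s\<^sup>2 = 1 - c\<^sup>2" using \<gamma> by (auto simp: s_def sin_gt_zero sin_squared_eq)
    define f where "f = d /\<^sub>R s"
    have ff: "f \<bullet> f = 1" using s dd by (simp add: f_def power2_eq_square field_simps)
    have ef: "e \<bullet> f = 0" using de by (simp add: f_def inner_commute)
    have w1eq: "w1 = c *\<^sub>R e + s *\<^sub>R f" using s by (simp add: f_def d_def)
    define g where "g x y = max 0 (min 1 (a * (c * x + s * y) / (a * (c * x + s * y) + x)))" for x y
    show ?thesis
    proof (rule plane[of e f \<gamma> g])
      show "(\<lambda>(x, y). g x y) \<in> borel_measurable (borel \<Otimes>\<^sub>M borel)"
        unfolding g_def split_beta by measurable
      show "g (t * x) (t * y) = g x y" if "t \<noteq> 0" for t x y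
      proof -
        have "a * (c * (t * x) + s * (t * y)) / (a * (c * (t * x) + s * (t * y)) + t * x)
          = t * (a * (c * x + s * y)) / (t * (a * (c * x + s * y) + x))" by (simp add: algebra_simps)
        then show ?thesis using that by (simp add: g_def)
      qed
      show "direction_overlap w v U = g (U \<bullet> e) (U \<bullet> f)" for U
        unfolding direction_overlap_def ratio by (simp add: g_def w1eq inner_add_left inner_commute[of U])
      show "g (sin \<xi>) (cos \<xi>) = circle_overlap a \<gamma> \<xi>" for \<xi>
        by (simp add: g_def circle_overlap_def sin_diff \<gamma> s_def[symmetric] algebra_simps)
    qed (use ee ff ef \<gamma> in auto)
  qed
qed

lemma prob_space_sphere_uniform: "prob_space (sphere_uniform :: 'a::euclidean_space measure)"
proof -
  have "prob_space (uniform_measure lborel (ball (0::'a) 1))"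
    using emeasure_lborel_ball_finite[of "0::'a" 1] content_ball_pos[of 1 "0::'a"]
    by (intro prob_space_uniform_measure) (auto simp: measure_def)
  then show ?thesis unfolding sphere_uniform_def by (rule prob_space.prob_space_distr) simp
qed

lemma sets_sphere_uniform [simp, measurable_cong]: "sets sphere_uniform = sets borel"
  by (simp add: sphere_uniform_def)

lemma space_sphere_uniform [simp]: "space sphere_uniform = UNIV"
  by (simp add: sphere_uniform_def)

text \<open>As 4 / (1 + a) = 2 + 2 (1 - a) / (1 + a), the bound \<open>ln_inverse_ge\<close> leaves
  only \<pi> \<le> 4. This settles parallel vectors, the only case in dimension 1.\<close>

lemma ratio_le_node_cost:
  assumes "0 \<le> a" "a \<le> 1"
  shows "a / (1 + a) \<le> node_cost a"
proof (cases "a = 0")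
  case False
  then have a: "0 < a" using assms by simp
  have "pi \<le> 4" using pi_approx by simp
  then have "a * (pi / (1 + a)) \<le> a * (4 / (1 + a))" using a by (intro mult_left_mono divide_right_mono) auto
  also have "\<dots> = a * (2 + 2 * (1 - a) / (1 + a))" using a by (simp add: field_simps)
  also have "\<dots> \<le> a * (2 - ln a)" using a assms ln_inverse_ge[of a] by (intro mult_left_mono) auto
  finally show ?thesis using a by (simp add: node_cost_eq field_simps)
qed simp

lemma nn_integral_direction_overlap:
  fixes w v :: "'a::euclidean_space"
  assumes le: "norm w \<le> norm v"
  shows "(\<integral>\<^sup>+U. ennreal (direction_overlap w v U) \<partial>sphere_uniform) \<le> ennreal (node_cost (norm w / norm v))"
proof (cases "w = 0")
  case True
  then show ?thesis by (simp add: direction_overlap_def)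
next
  case False
  define a where "a = norm w / norm v"
  have "0 < norm v" using False le by (meson less_le_trans zero_less_norm_iff)
  then have a: "0 < a" "a \<le> 1" using False le by (auto simp: a_def divide_le_eq)
  interpret prob_space "sphere_uniform :: 'a measure" by (rule prob_space_sphere_uniform)
  from False le have "(\<integral>\<^sup>+U. ennreal (direction_overlap w v U) \<partial>sphere_uniform) \<le> ennreal (node_cost a)"
  proof (cases rule: direction_overlap_cases)
    case parallel
    have "(\<integral>\<^sup>+U. ennreal (direction_overlap w v U) \<partial>sphere_uniform) \<le> (\<integral>\<^sup>+U. ennreal (a / (1 + a)) \<partial>(sphere_uniform :: 'a measure))"
      by (intro nn_integral_mono ennreal_leI) (use parallel a_def in auto)
    also have "\<dots> = ennreal (a / (1 + a))" using emeasure_space_1 by simp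
    also have "\<dots> \<le> ennreal (node_cost a)" using ratio_le_node_cost a by (intro ennreal_leI) auto
    finally show ?thesis .
  next
    case (plane e f \<gamma> g)
    have g: "(\<lambda>(x, y). ennreal (g x y)) \<in> borel_measurable (borel \<Otimes>\<^sub>M borel)"
      using plane(6) unfolding split_beta by measurable
    \<comment> \<open>The choice \<phi> = \<pi> - \<gamma> produces the half turn of
      \<open>nn_integral_circle_overlap\<close>.\<close>
    have "ennreal pi * (\<integral>\<^sup>+U. ennreal (direction_overlap w v U) \<partial>sphere_uniform)
      = (\<integral>\<^sup>+\<xi>\<in>{- (pi - \<gamma>)..pi - (pi - \<gamma>)}. ennreal (circle_overlap a \<gamma> \<xi>) \<partial>lborel)"
      unfolding plane(8) a_def plane(9)[symmetric]
      by (rule nn_integral_sphere_uniform_plane[OF plane(1-3) g]) (use plane in auto)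
    also have "\<dots> \<le> ennreal (mean_overlap a \<gamma>)"
      using nn_integral_circle_overlap[OF a plane(4,5)] by simp
    also have "\<dots> \<le> ennreal (a * (2 - ln a))"
      using mean_overlap_le[OF a plane(4,5)] by (rule ennreal_leI)
    also have "\<dots> = ennreal pi * ennreal (node_cost a)"
      using a node_cost_nonneg[of a] by (subst ennreal_mult[symmetric]) (simp_all add: node_cost_eq)
    finally show ?thesis by (subst (asm) ennreal_mult_le_mult_iff) auto
  qed
  then show ?thesis by (simp add: a_def)
qed

lemma emeasure_direction_overlap_ge:
  fixes w v :: "'a::euclidean_space"
  assumes le: "norm w \<le> norm v"
    and u: "0 < u" "u \<le> 1" and small: "norm w / norm v * (1 / u - 1) < 1"
  shows "emeasure sphere_uniform {U. u \<le> direction_overlap w v U} \<le> ennreal (norm w / norm v / (2 * u))"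
proof (cases "w = 0")
  case True
  then show ?thesis using u by (simp add: direction_overlap_def)
next
  case False
  define a where "a = norm w / norm v"
  have "0 < norm v" using False le by (meson less_le_trans zero_less_norm_iff)
  then have a: "0 < a" "a \<le> 1" using False le by (auto simp: a_def divide_le_eq)
  from False le have "emeasure sphere_uniform {U. u \<le> direction_overlap w v U} \<le> ennreal (a / (2 * u))"
  proof (cases rule: direction_overlap_cases)
    case parallel
    have "a / (1 + a) < u" using small u a unfolding a_def[symmetric] by (simp add: field_simps)
    then have "{U. u \<le> direction_overlap w v U} = {}" using parallel unfolding a_def[symmetric] by (smt (verit) Collect_empty_eq)
    then show ?thesis by simp
  next
    case (plane e f \<gamma> g)
    have g: "(\<lambda>(x, y). of_bool (u \<le> g x y) :: ennreal) \<in> borel_measurable (borel \<Otimes>\<^sub>M borel)"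
      using plane(6) unfolding split_beta of_bool_def by measurable
    have m: "{U. u \<le> direction_overlap w v U} \<in> sets borel" by measurable
    have "ennreal pi * emeasure sphere_uniform {U. u \<le> direction_overlap w v U}
      = ennreal pi * (\<integral>\<^sup>+U. of_bool (u \<le> g (U \<bullet> e) (U \<bullet> f)) \<partial>sphere_uniform)"
    proof -
      have "emeasure sphere_uniform {U. u \<le> direction_overlap w v U}
        = (\<integral>\<^sup>+U. indicator {U. u \<le> direction_overlap w v U} U \<partial>sphere_uniform)"
        using m by (intro nn_integral_indicator[symmetric]) simp
      also have "\<dots> = (\<integral>\<^sup>+U. of_bool (u \<le> g (U \<bullet> e) (U \<bullet> f)) \<partial>sphere_uniform)"
        unfolding plane(8) by (intro nn_integral_cong) (simp add: indicator_def)
      finally show ?thesis by simp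
    qed
    also have "\<dots> = (\<integral>\<^sup>+\<xi>\<in>{- (pi - \<gamma>)..pi - (pi - \<gamma>)}. of_bool (u \<le> circle_overlap a \<gamma> \<xi>) \<partial>lborel)"
      unfolding a_def plane(9)[symmetric]
      by (rule nn_integral_sphere_uniform_plane[OF plane(1-3) g]) (use plane in auto)
    also have "\<dots> = (\<integral>\<^sup>+\<xi>. indicator {\<xi> \<in> {\<gamma> - pi..\<gamma>}. u \<le> circle_overlap a \<gamma> \<xi>} \<xi> \<partial>lborel)"
      by (intro nn_integral_cong) (auto simp: indicator_def)
    also have "\<dots> = emeasure lborel {\<xi> \<in> {\<gamma> - pi..\<gamma>}. u \<le> circle_overlap a \<gamma> \<xi>}"
      by (rule nn_integral_indicator) measurable
    also have "\<dots> \<le> ennreal (pi * (a / (2 * u)))"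
      using small unfolding a_def[symmetric] by (rule emeasure_circle_overlap_ge[OF a plane(4,5) u])
    also have "\<dots> = ennreal pi * ennreal (a / (2 * u))" using a u by (intro ennreal_mult) auto
    finally show ?thesis by (subst (asm) ennreal_mult_le_mult_iff) auto
  qed
  then show ?thesis by (simp add: a_def)
qed

subsection \<open>Separation at a node\<close>

abbreviation uniform_fraction :: "real measure" where
  "uniform_fraction \<equiv> uniform_measure lborel {1/4..3/4}"

abbreviation split_measure :: "('a::euclidean_space \<times> real) measure" where
  "split_measure \<equiv> sphere_uniform \<Otimes>\<^sub>M uniform_fraction"

lemma prob_space_uniform_fraction: "prob_space uniform_fraction"
  by (intro prob_space_uniform_measure) auto

lemma prob_space_split_measure: "prob_space (split_measure :: ('a::euclidean_space \<times> real) measure)"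
proof -
  interpret A: prob_space "sphere_uniform :: 'a measure" by (rule prob_space_sphere_uniform)
  interpret B: prob_space uniform_fraction by (rule prob_space_uniform_fraction)
  interpret pair_prob_space "sphere_uniform :: 'a measure" uniform_fraction ..
  show ?thesis by unfold_locales
qed

lemma sets_split_measure [measurable_cong]:
  "sets (split_measure :: ('a::euclidean_space \<times> real) measure) = sets (borel \<Otimes>\<^sub>M borel)"
  by (intro sets_pair_measure_cong) auto

lemma space_split_measure: "space (split_measure :: ('a::euclidean_space \<times> real) measure) = UNIV"
  by (simp add: space_pair_measure)

definition separating :: "'a::euclidean_space \<Rightarrow> 'a set \<Rightarrow> 'a set \<Rightarrow> ('a \<times> real) set" where
  "separating q N S = {ub. \<exists>x\<in>N. (x \<bullet> fst ub < split_value S ub) \<noteq> (q \<bullet> fst ub < split_value S ub)}"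

lemma separating_measurable [measurable]:
  fixes S :: "'a::euclidean_space set"
  assumes "finite S" "N \<subseteq> S"
  shows "separating q N S \<in> sets split_measure"
proof -
  note [measurable] = measurable_split_value[OF assms(1)]
  have [simp]: "finite N" using assms finite_subset by blast
  have "separating q N S = {ub \<in> space split_measure. \<exists>x\<in>N. (x \<bullet> fst ub < split_value S ub) \<noteq> (q \<bullet> fst ub < split_value S ub)}"
    by (simp add: separating_def space_split_measure)
  also have "\<dots> \<in> sets split_measure" by measurable
  finally show ?thesis .
qed

lemma AE_sphere_uniform_inner_neq_0:
  fixes u :: "'a::euclidean_space"
  assumes "u \<noteq> 0"
  shows "AE U in sphere_uniform. U \<bullet> u \<noteq> 0"
proof -
  have "AE z in uniform_measure lborel (ball 0 1). sgn z \<bullet> u \<noteq> 0"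
  proof (rule AE_uniform_measureI)
    show "AE z in lborel. z \<in> ball 0 1 \<longrightarrow> sgn z \<bullet> u \<noteq> 0"
      using AE_lborel_inner_neq_0[OF assms] by eventually_elim (auto simp: sgn_div_norm)
  qed auto
  then show ?thesis unfolding sphere_uniform_def by (subst AE_distr_iff) auto
qed

lemma AE_generic_direction:
  fixes S :: "'a::euclidean_space set"
  assumes "finite S"
  shows "AE U in sphere_uniform. inj_on (\<lambda>x. x \<bullet> U) S \<and> (\<forall>x\<in>S. x \<noteq> q \<longrightarrow> x \<bullet> U \<noteq> q \<bullet> U)"
proof -
  have "AE U in sphere_uniform. \<forall>x\<in>insert q S. \<forall>y\<in>insert q S. x \<noteq> y \<longrightarrow> x \<bullet> U \<noteq> y \<bullet> U"
  proof (intro AE_finite_allI)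
    fix x y assume "x \<in> insert q S" "y \<in> insert q S"
    show "AE U in sphere_uniform. x \<noteq> y \<longrightarrow> x \<bullet> U \<noteq> y \<bullet> U"
    proof (cases "x = y")
      case False
      then have "AE U in sphere_uniform. U \<bullet> (x - y) \<noteq> 0" by (intro AE_sphere_uniform_inner_neq_0) auto
      then show ?thesis by eventually_elim (auto simp: inner_diff_right inner_commute)
    qed simp
  qed (use assms in auto)
  then show ?thesis by eventually_elim (auto simp: inj_on_def)
qed

lemma emeasure_split_measure_le:
  fixes A :: "('a::euclidean_space \<times> real) set"
  assumes A: "A \<in> sets split_measure"
    and [measurable]: "L \<in> borel_measurable borel"
    and sec: "AE U in sphere_uniform. emeasure uniform_fraction (Pair U -` A) \<le> ennreal (L U)"
  shows "emeasure split_measure A \<le> (\<integral>\<^sup>+U. ennreal (L U) \<partial>sphere_uniform)"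
proof -
  interpret B: prob_space uniform_fraction by (rule prob_space_uniform_fraction)
  have "emeasure split_measure A = (\<integral>\<^sup>+U. emeasure uniform_fraction (Pair U -` A) \<partial>sphere_uniform)"
    by (rule B.emeasure_pair_measure_alt[OF A])
  also have "\<dots> \<le> (\<integral>\<^sup>+U. ennreal (L U) \<partial>sphere_uniform)"
    using sec by (rule nn_integral_mono_AE)
  finally show ?thesis .
qed

lemma overlap_eq_direction:
  assumes "projected_points S (\<lambda>x. x \<bullet> U)"
  shows "projected_points.overlap (\<lambda>x. x \<bullet> U) (q \<bullet> U) x z = direction_overlap (q - x) (z - q) U"
  by (simp add: projected_points.overlap_def[OF assms] direction_overlap_def inner_diff_left)

lemma separating_section:
  assumes "projected_points S (\<lambda>x. x \<bullet> U)"
  shows "(U, b) \<in> separating q N S \<longleftrightarrow> projected_points.separates S (\<lambda>x. x \<bullet> U) N (q \<bullet> U) b"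
  by (simp add: projected_points.separates_def[OF assms] separating_def split_value_def)

text \<open>A point projected between q and x has overlap 1, so the tail bound at u = 1 applies,
  where its smallness condition is trivial.\<close>

lemma nn_integral_direction_between:
  fixes q x z :: "'a::euclidean_space"
  assumes "norm (q - x) \<le> norm (q - z)"
  shows "(\<integral>\<^sup>+U. ennreal (of_bool (1 \<le> direction_overlap (q - x) (z - q) U)) \<partial>sphere_uniform)
    \<le> ennreal (norm (q - x) / norm (q - z) / 2)"
proof -
  have "{U. 1 \<le> direction_overlap (q - x) (z - q) U} \<in> sets borel" by measurable
  then have "(\<integral>\<^sup>+U. indicator {U. 1 \<le> direction_overlap (q - x) (z - q) U} U \<partial>sphere_uniform)
    = emeasure sphere_uniform {U. 1 \<le> direction_overlap (q - x) (z - q) U}"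
    by (intro nn_integral_indicator) simp
  moreover have "\<dots> \<le> ennreal (norm (q - x) / norm (z - q) / (2 * 1))"
    using assms by (intro emeasure_direction_overlap_ge) (auto simp: norm_minus_commute)
  moreover have "ennreal (of_bool P) = (if P then 1 else 0)" for P by simp
  ultimately show ?thesis by (simp add: indicator_def norm_minus_commute of_bool_def)
qed

lemma ennreal_affine_sum:
  assumes "0 \<le> c" "0 \<le> k" "\<And>z x. z \<in> Z \<Longrightarrow> x \<in> Y \<Longrightarrow> 0 \<le> f x z" "\<And>z. z \<in> Z \<Longrightarrow> 0 \<le> g z"
  shows "ennreal (c * (k + (\<Sum>z\<in>Z. (\<Sum>x\<in>Y. f x z) + g z)))
    = ennreal c * (ennreal k + (\<Sum>z\<in>Z. (\<Sum>x\<in>Y. ennreal (f x z)) + ennreal (g z)))"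
proof -
  have "(\<Sum>z\<in>Z. (\<Sum>x\<in>Y. ennreal (f x z)) + ennreal (g z)) = (\<Sum>z\<in>Z. ennreal ((\<Sum>x\<in>Y. f x z) + g z))"
    using assms by (intro sum.cong refl) (simp add: sum_nonneg)
  also have "\<dots> = ennreal (\<Sum>z\<in>Z. (\<Sum>x\<in>Y. f x z) + g z)"
    using assms by (intro sum_ennreal add_nonneg_nonneg sum_nonneg) auto
  finally show ?thesis
    using assms by (simp add: ennreal_mult sum_nonneg)
qed

text \<open>For almost every direction \<open>separation_length\<close> bounds the width of the
  separating fractions; the factor 2 is the density of the fraction, and card S - 1 comes from
  \<open>position\<close>. Only \<open>x0\<close> is charged by its overlap. For the other elements
  of \<open>N\<close> the event that \<open>z\<close> lies between suffices, and its probability has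
  no logarithm.\<close>

lemma emeasure_separating:
  fixes S :: "'a::euclidean_space set"
  assumes S: "finite S" "2 \<le> card S" and N: "N \<subseteq> S" "x0 \<in> N"
    and near: "\<And>x z. x \<in> N \<Longrightarrow> z \<in> S - N \<Longrightarrow> norm (q - x) \<le> norm (q - z)"
  shows "emeasure split_measure (separating q N S) \<le> ennreal (2 / (real (card S) - 1) * (real (card N - 1) +
    (\<Sum>z\<in>S - N. (\<Sum>x\<in>N - {x0}. norm (q - x) / norm (q - z) / 2) + node_cost (norm (q - x0) / norm (q - z)))))"
proof -
  define m1 where "m1 = real (card S) - 1"
  have m1: "0 < m1" using S by (simp add: m1_def)
  define B where "B x z U = (of_bool (1 \<le> direction_overlap (q - x) (z - q) U) :: real)" for x z U
  define X where "X z U = direction_overlap (q - x0) (z - q) U" for z U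
  have [measurable]: "B x z \<in> borel_measurable borel" "X z \<in> borel_measurable borel" for x z
    unfolding B_def[abs_def] X_def[abs_def] of_bool_def by measurable
  have nn: "0 \<le> B x z U" "0 \<le> X z U" for x z U
    by (auto simp: B_def X_def direction_overlap_bounds)
  define L where "L U = 2 / m1 * (real (card N - 1) + (\<Sum>z\<in>S - N. (\<Sum>x\<in>N - {x0}. B x z U) + X z U))" for U
  have L0: "0 \<le> L U" for U
    using m1 nn unfolding L_def by (intro mult_nonneg_nonneg add_nonneg_nonneg sum_nonneg) auto
  have sec: "AE U in sphere_uniform. emeasure uniform_fraction (Pair U -` separating q N S) \<le> ennreal (L U)"
    using AE_generic_direction[OF S(1), of q]
  proof eventually_elim
    case (elim U)
    interpret projected_points S "\<lambda>x. x \<bullet> U" using S elim by unfold_locales auto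
    have pp: "projected_points S (\<lambda>x. x \<bullet> U)" ..
    have len: "position c - position b \<le> m1 * (L U / 2)"
      if "b \<in> Pair U -` separating q N S" "c \<in> Pair U -` separating q N S" "0 \<le> b" "b < 1" "0 \<le> c" "c < 1" for b c
    proof -
      have "position c - position b \<le> real (card N - 1) +
        (\<Sum>z\<in>S - N. (\<Sum>x\<in>N - {x0}. of_bool (between (q \<bullet> U) x z)) + overlap (q \<bullet> U) x0 z)"
      proof (rule separation_length[OF N])
        fix z assume z: "z \<in> S - N"
        then have "z \<noteq> q" using near[OF N(2) z] N by auto
        then show "z \<bullet> U \<noteq> q \<bullet> U" using elim z by blast
      qed (use that separating_section[OF pp] in auto)
      also have "\<dots> \<le> real (card N - 1) + (\<Sum>z\<in>S - N. (\<Sum>x\<in>N - {x0}. B x z U) + X z U)"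
      proof (intro add_left_mono sum_mono add_mono)
        fix x z show "of_bool (between (q \<bullet> U) x z) \<le> B x z U"
          using overlap_between[of "q \<bullet> U" x z] overlap_eq_direction[OF pp, of q x z] by (auto simp: B_def)
        show "overlap (q \<bullet> U) x0 z \<le> X z U" using overlap_eq_direction[OF pp, of q x0 z] by (simp add: X_def)
      qed
      also have "\<dots> = m1 * (L U / 2)" using m1 by (simp add: L_def)
      finally show ?thesis .
    qed
    have "emeasure uniform_fraction (Pair U -` separating q N S) \<le> ennreal (2 * (L U / 2))"
    proof (rule emeasure_uniform_width)
      show "Pair U -` separating q N S \<in> sets borel"
        using sets_Pair1[OF separating_measurable[OF S(1) N(1)], of U q] by simp
      show "0 \<le> L U / 2" using L0[of U] by simp
      fix b c assume bc: "b \<in> Pair U -` separating q N S" "c \<in> Pair U -` separating q N S"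
        "1 / 4 < b" "b < 3 / 4" "1 / 4 < c" "c < 3 / 4"
      have "(c - b) * m1 \<le> L U / 2 * m1"
        using len[of b c] bc by (simp add: position_def m1_def algebra_simps)
      then show "c - b \<le> L U / 2" using m1 by (simp add: mult_le_cancel_right)
    qed
    then show ?case by simp
  qed
  have "emeasure split_measure (separating q N S) \<le> (\<integral>\<^sup>+U. ennreal (L U) \<partial>sphere_uniform)"
    by (rule emeasure_split_measure_le[OF separating_measurable[OF S(1) N(1)] _ sec])
      (simp add: L_def[abs_def])
  also have "\<dots> = (\<integral>\<^sup>+U. ennreal (2 / m1) * (ennreal (real (card N - 1)) + (\<Sum>z\<in>S - N. (\<Sum>x\<in>N - {x0}. ennreal (B x z U)) + ennreal (X z U))) \<partial>sphere_uniform)"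
    unfolding L_def using m1 nn by (intro nn_integral_cong ennreal_affine_sum) auto
  also have "\<dots> = ennreal (2 / m1) * (ennreal (real (card N - 1)) + (\<Sum>z\<in>S - N. (\<Sum>x\<in>N - {x0}. (\<integral>\<^sup>+U. ennreal (B x z U) \<partial>sphere_uniform)) + (\<integral>\<^sup>+U. ennreal (X z U) \<partial>sphere_uniform)))"
    using prob_space.emeasure_space_1[OF prob_space_sphere_uniform[where 'a = 'a]]
    by (simp add: nn_integral_cmult nn_integral_add nn_integral_sum)
  also have "\<dots> \<le> ennreal (2 / m1) * (ennreal (real (card N - 1)) +
    (\<Sum>z\<in>S - N. (\<Sum>x\<in>N - {x0}. ennreal (norm (q - x) / norm (q - z) / 2)) + ennreal (node_cost (norm (q - x0) / norm (q - z)))))"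
  proof (intro mult_left_mono add_left_mono sum_mono add_mono)
    fix z assume z: "z \<in> S - N"
    show "(\<integral>\<^sup>+U. ennreal (B x z U) \<partial>sphere_uniform) \<le> ennreal (norm (q - x) / norm (q - z) / 2)" if "x \<in> N - {x0}" for x
      unfolding B_def using near[of x z] z that by (intro nn_integral_direction_between) auto
    show "(\<integral>\<^sup>+U. ennreal (X z U) \<partial>sphere_uniform) \<le> ennreal (node_cost (norm (q - x0) / norm (q - z)))"
      unfolding X_def using nn_integral_direction_overlap[of "q - x0" "z - q"] near[OF N(2) z]
      by (simp add: norm_minus_commute)
  qed auto
  also have "\<dots> = ennreal (2 / m1 * (real (card N - 1) +
    (\<Sum>z\<in>S - N. (\<Sum>x\<in>N - {x0}. norm (q - x) / norm (q - z) / 2) + node_cost (norm (q - x0) / norm (q - z)))))"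
  proof -
    have n0: "0 \<le> node_cost (norm (q - x0) / norm (q - z))" if "z \<in> S - N" for z
      using near[OF N(2) that] by (intro node_cost_nonneg) (auto simp: divide_le_eq)
    then show ?thesis using m1 by (intro ennreal_affine_sum[symmetric]) auto
  qed
  finally show ?thesis by (simp add: m1_def)
qed

lemma emeasure_separating_pair:
  fixes q x z :: "'a::euclidean_space"
  assumes xz: "x \<noteq> z" and near: "norm (q - x) \<le> norm (q - z)"
  defines "a \<equiv> norm (q - x) / norm (q - z)"
  shows "emeasure split_measure (separating q {x} {x, z}) \<le> ennreal (9/10 * node_cost a + 39/100 * a)"
proof (cases "x = q")
  case True
  then show ?thesis by (simp add: separating_def)
next
  case False
  have z: "z \<noteq> q" using xz near by auto
  have a: "0 \<le> a" "a \<le> 1" using near by (auto simp: a_def divide_le_eq)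
  define X where "X U = direction_overlap (q - x) (z - q) U" for U
  have [measurable]: "X \<in> borel_measurable borel" unfolding X_def[abs_def] by measurable
  define L where "L U = 9/10 * X U + 13/40 * of_bool (5/11 \<le> X U)" for U
  have Lm [measurable]: "L \<in> borel_measurable borel" unfolding L_def[abs_def] of_bool_def by measurable
  have X: "0 \<le> X U" "X U \<le> 1" for U by (auto simp: X_def direction_overlap_bounds)
  have gen: "AE U in sphere_uniform. inj_on (\<lambda>y. y \<bullet> U) {x, z} \<and> (\<forall>y\<in>{x, z}. y \<noteq> q \<longrightarrow> y \<bullet> U \<noteq> q \<bullet> U)"
    by (rule AE_generic_direction) simp
  have sec: "AE U in sphere_uniform. emeasure uniform_fraction (Pair U -` separating q {x} {x, z}) \<le> ennreal (L U)"
    using gen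
  proof eventually_elim
    case (elim U)
    interpret projected_points "{x, z}" "\<lambda>x. x \<bullet> U" using xz elim by unfold_locales auto
    have pp: "projected_points {x, z} (\<lambda>x. x \<bullet> U)" ..
    have "emeasure uniform_fraction (Pair U -` separating q {x} {x, z}) \<le> ennreal (2 * max 0 (min (1/2) (X U - 1/4)))"
    proof (rule emeasure_uniform_width)
      show "Pair U -` separating q {x} {x, z} \<in> sets borel"
        using sets_Pair1[OF separating_measurable[of "{x, z}" "{x}"], of U q] by simp
      fix b c assume bc: "b \<in> Pair U -` separating q {x} {x, z}" "c \<in> Pair U -` separating q {x} {x, z}"
        "1 / 4 < b" "b < 3 / 4" "1 / 4 < c" "c < 3 / 4"
      have "1 - X U \<le> b \<or> c \<le> X U"
        using separation_pair[OF refl xz, of "q \<bullet> U"] bc elim z False separating_section[OF pp, of _ q "{x}"]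
          overlap_eq_direction[OF pp, of q x z] by (auto simp: X_def)
      then show "c - b \<le> max 0 (min (1/2) (X U - 1/4))" using bc by linarith
    qed simp
    also have "\<dots> \<le> ennreal (L U)"
    proof (rule ennreal_leI)
      show "2 * max 0 (min (1/2) (X U - 1/4)) \<le> L U"
        using X[of U] by (cases "5/11 \<le> X U") (auto simp: L_def max_def min_def)
    qed
    finally show ?case .
  qed
  \<comment> \<open>The tail bound yields 11/10 a, but only for 6/5 a < 1. The weaker 6/5 a covers
    the other case too, and 13/40 times 6/5 is 39/100.\<close>
  have P: "emeasure sphere_uniform {U. 5/11 \<le> X U} \<le> ennreal (6/5 * a)"
  proof (cases "6/5 * a < 1")
    case True
    have "emeasure sphere_uniform {U. 5/11 \<le> X U} \<le> ennreal (norm (q - x) / norm (z - q) / (2 * (5/11)))"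
      unfolding X_def using True near by (intro emeasure_direction_overlap_ge) (auto simp: a_def norm_minus_commute)
    also have "norm (q - x) / norm (z - q) / (2 * (5/11)) = 11/10 * a" by (simp add: a_def norm_minus_commute)
    also have "ennreal (11/10 * a) \<le> ennreal (6/5 * a)" using a by (intro ennreal_leI) simp
    finally show ?thesis .
  next
    case False
    have "emeasure sphere_uniform {U. 5/11 \<le> X U} \<le> 1"
      by (rule prob_space.emeasure_le_1[OF prob_space_sphere_uniform])
    also have "1 \<le> ennreal (6/5 * a)" using False by simp
    finally show ?thesis .
  qed
  have "emeasure split_measure (separating q {x} {x, z}) \<le> (\<integral>\<^sup>+U. ennreal (L U) \<partial>sphere_uniform)"
    by (rule emeasure_split_measure_le[OF separating_measurable Lm sec]) auto
  also have "\<dots> = (\<integral>\<^sup>+U. ennreal (9/10) * ennreal (X U) + ennreal (13/40) * indicator {U. 5/11 \<le> X U} U \<partial>sphere_uniform)"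
    using X by (intro nn_integral_cong) (auto simp: L_def ennreal_plus ennreal_mult[symmetric] indicator_def)
  also have "\<dots> = ennreal (9/10) * (\<integral>\<^sup>+U. ennreal (X U) \<partial>sphere_uniform) + ennreal (13/40) * emeasure sphere_uniform {U. 5/11 \<le> X U}"
    by (subst nn_integral_add) (auto simp: nn_integral_cmult nn_integral_cmult_indicator)
  also have "\<dots> \<le> ennreal (9/10) * ennreal (node_cost a) + ennreal (13/40) * ennreal (6/5 * a)"
  proof (intro add_mono mult_left_mono P)
    show "(\<integral>\<^sup>+U. ennreal (X U) \<partial>sphere_uniform) \<le> ennreal (node_cost a)"
      unfolding X_def a_def using nn_integral_direction_overlap[of "q - x" "z - q"] near by (simp add: norm_minus_commute)
  qed auto
  also have "\<dots> = ennreal (9/10 * node_cost a + 39/100 * a)"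
    using a node_cost_nonneg[OF a] by (simp add: ennreal_mult[symmetric] ennreal_plus[symmetric] del: ennreal_plus)
  finally show ?thesis .
qed

subsection \<open>Recursion over the tree\<close>

definition miss_prob :: "'a::euclidean_space \<Rightarrow> 'a set \<Rightarrow> nat \<Rightarrow> 'a set \<Rightarrow> real" where
  "miss_prob q N n\<^sub>o S = measure rp_random {\<omega> \<in> space rp_random. \<not> N \<subseteq> rp_leaf q (rp_build n\<^sub>o \<omega> S)}"

lemma miss_prob_leaf:
  assumes "card S \<le> n\<^sub>o" "N \<subseteq> S"
  shows "miss_prob q N n\<^sub>o S = 0"
proof -
  have "rp_leaf q (rp_build n\<^sub>o \<omega> S) = S" for \<omega> using assms by (subst rp_build.simps) simp
  then show ?thesis using assms by (simp add: miss_prob_def)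
qed

text \<open>The root reads the coordinate [] and the subtree those starting with \<open>b\<close>.
  These are disjoint, hence independent, and reindexing along the injective map from p to b # p
  returns the law of \<open>rp_random\<close>.\<close>

lemma measure_root_child:
  fixes C :: "('a::euclidean_space \<times> real) set"
  assumes C: "C \<in> sets split_measure" and D: "D \<in> sets rp_random"
  shows "measure rp_random {\<omega> \<in> space rp_random. \<omega> [] \<in> C \<and> (\<lambda>p. \<omega> (b # p)) \<in> D}
    = measure split_measure C * measure rp_random D"
proof -
  let ?R = "rp_random :: (bool list \<Rightarrow> 'a \<times> real) measure"
  let ?M = "\<lambda>_ :: bool list. split_measure :: ('a \<times> real) measure"
  interpret M: prob_space "split_measure :: ('a \<times> real) measure" by (rule prob_space_split_measure)
  interpret R: prob_space ?R by (rule prob_space_rp_random)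
  have rp: "?R = PiM UNIV ?M" by (simp add: rp_random_def)
  have coord: "(\<lambda>\<omega>. \<omega> i) \<in> ?R \<rightarrow>\<^sub>M split_measure" for i
    unfolding rp by (rule measurable_component_singleton) simp
  have "R.indep_vars ?M (\<lambda>i \<omega>. \<omega> i) UNIV"
  proof (subst R.indep_vars_iff_distr_eq_PiM')
    have "distr ?R (PiM UNIV ?M) (\<lambda>x. \<lambda>i\<in>UNIV. x i) = ?R"
      unfolding rp by (simp add: restrict_UNIV)
    moreover have "distr ?R (?M i) (\<lambda>\<omega>. \<omega> i) = ?M i" for i
      unfolding rp by (rule distr_PiM_component) (auto intro: prob_space_split_measure)
    ultimately show "distr ?R (PiM UNIV ?M) (\<lambda>x. \<lambda>i\<in>UNIV. x i) = PiM UNIV (\<lambda>i. distr ?R (?M i) (\<lambda>\<omega>. \<omega> i))"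
      by (simp add: rp)
  qed (use coord in auto)
  then have ind: "R.indep_var (PiM {[]} ?M) (\<lambda>\<omega>. restrict (\<lambda>i. \<omega> i) {[]}) (PiM (range ((#) b)) ?M) (\<lambda>\<omega>. restrict (\<lambda>i. \<omega> i) (range ((#) b)))"
    by (rule R.indep_var_restrict) auto
  have m1: "(\<lambda>f. f []) \<in> PiM {[]} ?M \<rightarrow>\<^sub>M split_measure"
    by (rule measurable_component_singleton) simp
  have m2: "(\<lambda>f p. f (b # p)) \<in> PiM (range ((#) b)) ?M \<rightarrow>\<^sub>M ?R"
    unfolding rp by (rule measurable_PiM_single') (auto simp: space_PiM)
  let ?C = "(\<lambda>f. f []) -` C \<inter> space (PiM {[]} ?M)"
  let ?D = "(\<lambda>f p. f (b # p)) -` D \<inter> space (PiM (range ((#) b)) ?M)"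
  have sp: "restrict \<omega> {[]} \<in> space (PiM {[]} ?M)" "restrict \<omega> (range ((#) b)) \<in> space (PiM (range ((#) b)) ?M)" for \<omega>
    by (auto simp: space_PiM space_split_measure)
  have "R.prob ((\<lambda>\<omega>. (restrict \<omega> {[]}, restrict \<omega> (range ((#) b)))) -` (?C \<times> ?D) \<inter> space ?R)
    = R.prob ((\<lambda>\<omega>. restrict \<omega> {[]}) -` ?C \<inter> space ?R) * R.prob ((\<lambda>\<omega>. restrict \<omega> (range ((#) b))) -` ?D \<inter> space ?R)"
    by (rule R.indep_varD[OF ind measurable_sets[OF m1 C] measurable_sets[OF m2 D]])
  also have "(\<lambda>\<omega>. restrict \<omega> {[]}) -` ?C \<inter> space ?R = (\<lambda>\<omega>. \<omega> []) -` C \<inter> space ?R"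
    using sp by auto
  also have "(\<lambda>\<omega>. restrict \<omega> (range ((#) b))) -` ?D \<inter> space ?R = (\<lambda>\<omega> p. \<omega> (b # p)) -` D \<inter> space ?R"
    using sp by auto
  also have "(\<lambda>\<omega>. (restrict \<omega> {[]}, restrict \<omega> (range ((#) b)))) -` (?C \<times> ?D) \<inter> space ?R
    = {\<omega> \<in> space ?R. \<omega> [] \<in> C \<and> (\<lambda>p. \<omega> (b # p)) \<in> D}"
    using sp by auto
  also have "R.prob ((\<lambda>\<omega>. \<omega> []) -` C \<inter> space ?R) = measure split_measure C"
  proof -
    have "measure split_measure C = measure (distr ?R split_measure (\<lambda>\<omega>. \<omega> [])) C"
      unfolding rp by (subst distr_PiM_component) (auto intro: prob_space_split_measure)
    then show ?thesis using coord C by (simp add: measure_distr)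
  qed
  also have "R.prob ((\<lambda>\<omega> p. \<omega> (b # p)) -` D \<inter> space ?R) = measure ?R D"
  proof -
    have "distr (PiM UNIV ?M) (PiM UNIV (\<lambda>i. ?M (b # i))) (\<lambda>\<omega>. \<lambda>n\<in>UNIV. \<omega> (b # n)) = PiM UNIV (\<lambda>i. ?M (b # i))"
      by (rule distr_PiM_reindex) (auto intro: prob_space_split_measure)
    then have "measure ?R D = measure (distr ?R ?R (\<lambda>\<omega> p. \<omega> (b # p))) D"
      by (simp add: rp restrict_UNIV)
    also have "\<dots> = R.prob ((\<lambda>\<omega> p. \<omega> (b # p)) -` D \<inter> space ?R)"
    proof (rule measure_distr[OF _ D])
      show "(\<lambda>\<omega> p. \<omega> (b # p)) \<in> ?R \<rightarrow>\<^sub>M ?R"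
        unfolding rp by (rule measurable_PiM_single') (auto simp: space_PiM)
    qed
    finally show ?thesis by simp
  qed
  finally show ?thesis .
qed

text \<open>For distinct pairs of subset and side these events are disjoint, which allows summing
  over the possible children of \<open>q\<close>. The side is recorded because it determines which
  coordinates drive the subtree.\<close>

definition root_cell :: "'a::euclidean_space \<Rightarrow> 'a set \<Rightarrow> 'a set \<times> bool \<Rightarrow> ('a \<times> real) set" where
  "root_cell q S Ab = {ub. (q \<bullet> fst ub < split_value S ub) = (\<not> snd Ab) \<and>
     (\<forall>x\<in>S. (x \<in> fst Ab) = ((x \<bullet> fst ub < split_value S ub) = (\<not> snd Ab)))}"

lemma root_cell_measurable:
  fixes S :: "'a::euclidean_space set"
  assumes "finite S"
  shows "root_cell q S Ab \<in> sets split_measure"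
proof -
  note [measurable] = measurable_split_value[OF assms(1)]
  have "root_cell q S Ab = {ub \<in> space split_measure. (q \<bullet> fst ub < split_value S ub) = (\<not> snd Ab) \<and>
     (\<forall>x\<in>S. (x \<in> fst Ab) = ((x \<bullet> fst ub < split_value S ub) = (\<not> snd Ab)))}"
    by (simp add: root_cell_def space_split_measure)
  also have "\<dots> \<in> sets split_measure" using assms by measurable
  finally show ?thesis .
qed

lemma root_cell_disjoint:
  assumes "A \<subseteq> S" "B \<subseteq> S" "(A, b) \<noteq> (B, c)"
  shows "root_cell q S (A, b) \<inter> root_cell q S (B, c) = {}"
  using assms by (auto simp: root_cell_def)

lemma rp_leaf_root_cell:
  fixes q :: "'a::euclidean_space" and S :: "'a set" and \<omega> :: "bool list \<Rightarrow> 'a \<times> real"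
  assumes "finite S" "n\<^sub>o < card S"
  defines "A \<equiv> \<lambda>\<omega>. {x \<in> S. (x \<bullet> fst (\<omega> []) < split_value S (\<omega> [])) = (q \<bullet> fst (\<omega> []) < split_value S (\<omega> []))}"
    and "b \<equiv> \<lambda>\<omega>. \<not> q \<bullet> fst (\<omega> []) < split_value S (\<omega> [])"
  shows "rp_leaf q (rp_build n\<^sub>o \<omega> S) = S \<or> rp_leaf q (rp_build n\<^sub>o \<omega> S) = rp_leaf q (rp_build n\<^sub>o (\<lambda>p. \<omega> (b \<omega> # p)) (A \<omega>))"
    and "\<omega> [] \<in> root_cell q S (A \<omega>, b \<omega>)"
proof -
  show "rp_leaf q (rp_build n\<^sub>o \<omega> S) = S \<or> rp_leaf q (rp_build n\<^sub>o \<omega> S) = rp_leaf q (rp_build n\<^sub>o (\<lambda>p. \<omega> (b \<omega> # p)) (A \<omega>))"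
  proof (cases "q \<bullet> fst (\<omega> []) < split_value S (\<omega> [])")
    case True
    then have "A \<omega> = {x \<in> S. x \<bullet> fst (\<omega> []) < split_value S (\<omega> [])}" "b \<omega> = False"
      by (auto simp: A_def b_def)
    then show ?thesis using True assms(2) by (subst (1 2) rp_build.simps) (simp add: Let_def)
  next
    case False
    then have "A \<omega> = {x \<in> S. \<not> x \<bullet> fst (\<omega> []) < split_value S (\<omega> [])}" "b \<omega> = True"
      by (auto simp: A_def b_def)
    then show ?thesis using False assms(2) by (subst (1 2) rp_build.simps) (simp add: Let_def)
  qed
  show "\<omega> [] \<in> root_cell q S (A \<omega>, b \<omega>)"
    by (auto simp: root_cell_def A_def b_def)
qed

text \<open>\<open>fractile_split_card\<close> asks for an injective projection and an interior
  fraction, and both are almost sure.\<close>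

lemma unbalanced_null:
  fixes S :: "'a::euclidean_space set"
  assumes S: "finite S" "2 \<le> card S"
  shows "measure split_measure {ub. \<exists>b. 3 * card S < 4 * card {x \<in> S. (x \<bullet> fst ub < split_value S ub) = b}} = 0" (is "measure _ ?B = 0")
    and "{ub. \<exists>b. 3 * card S < 4 * card {x \<in> S. (x \<bullet> fst ub < split_value S ub) = b}} \<in> sets split_measure"
proof -
  note [measurable] = measurable_split_value[OF S(1)]
  have card: "real (card {x \<in> S. P x}) = (\<Sum>x\<in>S. if P x then 1 else 0)" for P
    using S by (simp add: sum.If_cases Int_def)
  have "?B = {ub \<in> space split_measure. \<exists>b. real (3 * card S) < 4 * (\<Sum>x\<in>S. if (x \<bullet> fst ub < split_value S ub) = b then 1 else 0)}"
    unfolding card[symmetric] space_split_measure of_nat_less_iff[symmetric, where 'a = real] by simp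
  also have "\<dots> \<in> sets split_measure" by measurable
  finally show m: "?B \<in> sets split_measure" .
  have "emeasure split_measure ?B \<le> (\<integral>\<^sup>+U. ennreal ((\<lambda>_. 0) U) \<partial>(sphere_uniform :: 'a measure))"
  proof (rule emeasure_split_measure_le[OF m])
    show "AE U in sphere_uniform. emeasure uniform_fraction (Pair U -` ?B) \<le> ennreal 0"
      using AE_generic_direction[OF S(1), of 0]
    proof eventually_elim
      case (elim U)
      have *: False if b: "b \<in> Pair U -` ?B" "1/4 < b" "b < 3/4" for b
      proof -
        obtain t where t: "3 * card S < 4 * card {x \<in> S. (x \<bullet> U < split_value S (U, b)) = t}"
          using b by auto
        have "4 * card {x \<in> S. x \<bullet> U < split_value S (U, b)} \<le> 3 * card S" "4 * card {x \<in> S. \<not> x \<bullet> U < split_value S (U, b)} \<le> 3 * card S"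
          using fractile_split_card[OF S, of "\<lambda>x. x \<bullet> U" b] elim b by (auto simp: split_value_def)
        then show False using t by (cases t) auto
      qed
      have "emeasure uniform_fraction (Pair U -` ?B) \<le> ennreal (2 * 0)"
        using * sets_Pair1[OF m, of U] by (intro emeasure_uniform_width) auto
      then show ?case by simp
    qed
  qed simp
  then show "measure split_measure ?B = 0" by (simp add: measure_def)
qed

text \<open>A miss at \<open>S\<close> requires that the root separates, that the split is
  unbalanced (a null event), or that a balanced child containing \<open>q\<close> and
  \<open>N\<close> is missed. The last event is decomposed over the finitely many children; the
  choice of a child is independent of the randomness below it, and the probabilities of the choices
  add up to at most 1.\<close>

lemma miss_prob_step:
  fixes S :: "'a::euclidean_space set"
  assumes S: "finite S" "n\<^sub>o < card S" "1 \<le> n\<^sub>o" and N: "N \<subseteq> S" and c: "0 \<le> c"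
    and IH: "\<And>A. N \<subseteq> A \<Longrightarrow> A \<subseteq> S \<Longrightarrow> 4 * card A \<le> 3 * card S \<Longrightarrow> miss_prob q N n\<^sub>o A \<le> c"
  shows "miss_prob q N n\<^sub>o S \<le> measure split_measure (separating q N S) + c"
proof -
  interpret M: prob_space "split_measure :: ('a \<times> real) measure" by (rule prob_space_split_measure)
  interpret R: prob_space "rp_random :: (bool list \<Rightarrow> 'a \<times> real) measure" by (rule prob_space_rp_random)
  define T where "T = {A. N \<subseteq> A \<and> A \<subseteq> S \<and> 4 * card A \<le> 3 * card S} \<times> (UNIV :: bool set)"
  have "finite {A. N \<subseteq> A \<and> A \<subseteq> S \<and> 4 * card A \<le> 3 * card S}"
    by (rule finite_subset[of _ "Pow S"]) (use S in auto)
  then have finT: "finite T" unfolding T_def by simp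
  define D where "D A = {\<omega> \<in> space rp_random. \<not> N \<subseteq> rp_leaf q (rp_build n\<^sub>o \<omega> A)}" for A
  define E where "E Ab = {\<omega> \<in> space rp_random. \<omega> [] \<in> root_cell q S Ab \<and> (\<lambda>p. \<omega> (snd Ab # p)) \<in> D (fst Ab)}" for Ab
  define B where "B = {ub. \<exists>b. 3 * card S < 4 * card {x \<in> S. (x \<bullet> fst ub < split_value S ub) = b}}"
  have B: "measure split_measure B = 0" "B \<in> sets split_measure"
    unfolding B_def using unbalanced_null[of S] S by auto
  have coord [measurable]: "(\<lambda>\<omega>. \<omega> []) \<in> (rp_random :: (bool list \<Rightarrow> 'a \<times> real) measure) \<rightarrow>\<^sub>M split_measure"
    unfolding rp_random_def by (rule measurable_component_singleton) simp
  have shift: "(\<lambda>\<omega> p. \<omega> (b # p)) \<in> (rp_random :: (bool list \<Rightarrow> 'a \<times> real) measure) \<rightarrow>\<^sub>M rp_random" for b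
    unfolding rp_random_def by (rule measurable_PiM_single') (auto simp: space_PiM)
  have Dm: "D A \<in> sets rp_random" if "A \<subseteq> S" for A
    unfolding D_def using finite_subset[OF that S(1)] by (rule sets_rp_event)
  have root: "measure rp_random {\<omega> \<in> space rp_random. \<omega> [] \<in> C} = measure split_measure C"
    if "C \<in> sets split_measure" for C :: "('a \<times> real) set"
    using measure_root_child[OF that sets.top, of True] measurable_space[OF shift[of True]] R.prob_space
    by (simp cong: conj_cong)
  have rootm: "{\<omega> \<in> space rp_random. \<omega> [] \<in> C} \<in> sets (rp_random :: (bool list \<Rightarrow> 'a \<times> real) measure)" if "C \<in> sets split_measure" for C
    using measurable_sets[OF coord that] by (simp add: vimage_def Int_def conj_commute)
  have Em: "E Ab \<in> sets rp_random" if "Ab \<in> T" for Ab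
  proof -
    have "fst Ab \<subseteq> S" using that by (auto simp: T_def)
    from measurable_sets[OF shift Dm[OF this], of "snd Ab"] have "{\<omega> \<in> space rp_random. (\<lambda>p. \<omega> (snd Ab # p)) \<in> D (fst Ab)} \<in> sets rp_random"
      by (simp add: vimage_def Int_def conj_commute)
    moreover have "E Ab = {\<omega> \<in> space rp_random. \<omega> [] \<in> root_cell q S Ab} \<inter> {\<omega> \<in> space rp_random. (\<lambda>p. \<omega> (snd Ab # p)) \<in> D (fst Ab)}"
      by (auto simp: E_def)
    ultimately show ?thesis using rootm[OF root_cell_measurable[OF S(1)]] by simp
  qed
  let ?Sep = "{\<omega> \<in> space rp_random. \<omega> [] \<in> separating q N S}"
  let ?Bad = "{\<omega> \<in> space rp_random. \<omega> [] \<in> B}"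
  have sub: "D S \<subseteq> ?Sep \<union> ?Bad \<union> (\<Union>Ab\<in>T. E Ab)"
  proof
    fix \<omega> assume \<omega>: "\<omega> \<in> D S"
    then have sp: "\<omega> \<in> space rp_random" by (simp add: D_def)
    define A where "A = {x \<in> S. (x \<bullet> fst (\<omega> []) < split_value S (\<omega> [])) = (q \<bullet> fst (\<omega> []) < split_value S (\<omega> []))}"
    define b where "b = (\<not> q \<bullet> fst (\<omega> []) < split_value S (\<omega> []))"
    show "\<omega> \<in> ?Sep \<union> ?Bad \<union> (\<Union>Ab\<in>T. E Ab)"
    proof (cases "\<omega> [] \<in> separating q N S \<or> \<omega> [] \<in> B")
      case False
      then have NA: "N \<subseteq> A" using N by (auto simp: separating_def A_def)
      have "4 * card A \<le> 3 * card S" using False by (auto simp: B_def A_def not_less)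
      then have T: "(A, b) \<in> T" using NA by (auto simp: T_def A_def)
      \<comment> \<open>A trivial split would make \<open>S\<close> the leaf, which contains
        \<open>N\<close> and thus is no miss.\<close>
      have "rp_leaf q (rp_build n\<^sub>o \<omega> S) = rp_leaf q (rp_build n\<^sub>o (\<lambda>p. \<omega> (b # p)) A)"
        using rp_leaf_root_cell(1)[OF S(1,2), of q \<omega>] \<omega> N unfolding A_def b_def D_def by blast
      then have "(\<lambda>p. \<omega> (b # p)) \<in> D A"
        using \<omega> measurable_space[OF shift sp] by (simp add: D_def)
      then have "\<omega> \<in> E (A, b)"
        using sp rp_leaf_root_cell(2)[OF S(1,2), of \<omega> q] by (simp add: E_def A_def b_def)
      then show ?thesis using T by blast
    qed (use sp in auto)
  qed
  have sets3: "?Sep \<in> sets rp_random" "?Bad \<in> sets rp_random" "(\<Union>Ab\<in>T. E Ab) \<in> sets rp_random"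
    using rootm[OF separating_measurable[OF S(1) N]] rootm[OF B(2)] Em finT by auto
  have "miss_prob q N n\<^sub>o S \<le> R.prob (?Sep \<union> ?Bad \<union> (\<Union>Ab\<in>T. E Ab))"
    using sub sets3 unfolding miss_prob_def D_def by (intro R.finite_measure_mono) auto
  also have "\<dots> \<le> R.prob (?Sep \<union> ?Bad) + R.prob (\<Union>Ab\<in>T. E Ab)"
    using sets3 by (intro measure_Un_le) auto
  also have "R.prob (?Sep \<union> ?Bad) \<le> R.prob ?Sep + R.prob ?Bad"
    using sets3 by (intro measure_Un_le) auto
  also have "R.prob ?Sep = measure split_measure (separating q N S)" by (rule root[OF separating_measurable[OF S(1) N]])
  also have "R.prob ?Bad = 0" using root[OF B(2)] B(1) by simp
  also have "R.prob (\<Union>Ab\<in>T. E Ab) \<le> (\<Sum>Ab\<in>T. R.prob (E Ab))"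
    using finT Em by (intro R.finite_measure_subadditive_finite) auto
  also have "\<dots> = (\<Sum>Ab\<in>T. measure split_measure (root_cell q S Ab) * miss_prob q N n\<^sub>o (fst Ab))"
  proof (intro sum.cong refl)
    fix Ab assume "Ab \<in> T"
    then have "fst Ab \<subseteq> S" by (auto simp: T_def)
    then show "R.prob (E Ab) = measure split_measure (root_cell q S Ab) * miss_prob q N n\<^sub>o (fst Ab)"
      unfolding E_def using measure_root_child[OF root_cell_measurable[OF S(1)] Dm] by (simp add: D_def miss_prob_def)
  qed
  also have "\<dots> \<le> (\<Sum>Ab\<in>T. measure split_measure (root_cell q S Ab) * c)"
    by (intro sum_mono mult_left_mono IH) (auto simp: T_def)
  also have "\<dots> = measure split_measure (\<Union>Ab\<in>T. root_cell q S Ab) * c"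
  proof -
    have "disjoint_family_on (root_cell q S) T"
      unfolding disjoint_family_on_def
    proof (intro ballI impI)
      fix P Q assume "P \<in> T" "Q \<in> T" "P \<noteq> Q"
      then show "root_cell q S P \<inter> root_cell q S Q = {}"
        using root_cell_disjoint[of "fst P" S "fst Q" "snd P" "snd Q" q] by (auto simp: T_def)
    qed
    then show ?thesis
      using finT root_cell_measurable[OF S(1)]
      by (subst M.finite_measure_finite_Union) (auto simp: sum_distrib_right)
  qed
  also have "\<dots> \<le> 1 * c" using c by (intro mult_right_mono M.prob_le_1) auto
  finally show ?thesis by simp
qed

subsection \<open>Charging cells to levels\<close>

lemma ln_numerics:
  "1671/1000 \<le> ln (16/3 :: real)" "1266/1000 \<le> ln (32/9 :: real)" "114/100 \<le> ln (256/81 :: real)"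
  "ln (40/3 :: real) \<le> 278/100" "ln (80/11 :: real) \<le> 21/10" "178/100 \<le> ln (6 :: real)" "ln (2::real) \<le> 6932/10000"
proof -
  have l2: "ln (2::real) \<in> {307/443<..<4615/6658}"
    using ln_approx_bounds[of 2 3] by (simp add: eval_nat_numeral)
  have l3: "ln (3::real) \<in> {1.098..1.0987}"
    using ln_approx_bounds[of 3 4] by (simp add: eval_nat_numeral)
  have "16/3 = 2^4 / (3::real)" "32/9 = 2^5 / (3::real)^2" "256/81 = 2^8 / (3::real)^4" "6 = 2 * (3::real)" by simp_all
  then have "ln (16/3 :: real) = 4 * ln 2 - ln 3" "ln (32/9 :: real) = 5 * ln 2 - 2 * ln 3"
    "ln (256/81 :: real) = 8 * ln 2 - 4 * ln 3" "ln (6 :: real) = ln 2 + ln 3"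
    by (simp_all only: ln_divide_pos ln_mult_pos ln_realpow zero_less_power zero_less_numeral of_nat_numeral)
  then show "1671/1000 \<le> ln (16/3 :: real)" "1266/1000 \<le> ln (32/9 :: real)" "114/100 \<le> ln (256/81 :: real)" "178/100 \<le> ln (6 :: real)"
    using l2 l3 by simp_all
  have "ln (40/3) \<le> ln (2^4 :: real)" "ln (80/11) \<le> ln (2^3 :: real)" by (subst ln_le_cancel_iff; simp)+
  then show "ln (40/3 :: real) \<le> 278/100" "ln (80/11 :: real) \<le> 21/10" "ln (2::real) \<le> 6932/10000"
    using l2 by (simp_all only: ln_realpow zero_less_numeral) simp_all
qed

lemma level_cost_scaled:
  assumes "0 < u" "0 < x"
  shows "level_cost (u * x) = u * x * (1 + ln (2 / u) - ln x)"
  using assms by (simp add: level_cost_eq ln_mult ln_div)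

text \<open>The function - y ln y increases up to 1/e, and its maximum 1/e is below 37/100.\<close>

lemma neg_mult_ln_le:
  assumes "0 < y" "y \<le> x" "x \<le> (1::real)"
  shows "- (y * ln y) \<le> max (- (x * ln x)) (37/100)"
proof (cases "ln x + 1 \<le> 0")
  case True
  then have "y * (0 - ln y) \<le> x * (0 - ln x)" using assms by (intro mult_const_minus_ln_mono) auto
  then show ?thesis by simp
next
  case False
  have "inverse (2 ^ 32) \<le> (1/1000 :: real)" by simp
  then have "5837465777 / 2147483648 - 1/1000 \<le> exp (1::real)" using abs_le_D2[OF e_approx_32] by linarith
  moreover have "271/100 \<le> (5837465777 / 2147483648 - 1/1000 :: real)" by simp
  ultimately have e: "271/100 \<le> exp (1::real)" by (rule order_trans[rotated])
  have "ln (1 / (exp 1 * y)) \<le> 1 / (exp 1 * y) - 1" using assms by (intro ln_le_minus_one) auto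
  then have "y * (- ln y) \<le> y * (1 / (exp 1 * y))" using assms by (intro mult_left_mono) (auto simp: ln_div ln_mult)
  also have "\<dots> = 1 / exp 1" using assms by simp
  also have "\<dots> \<le> 37/100" using e by (simp add: field_simps)
  finally show ?thesis by simp
qed

lemma pi_bounds: "31415/10000 < pi" "pi < (31416/10000)"
  using pi_approx by auto

lemma inverse_pi_bounds: "1 / pi \<le> 31832/100000" "3183/10000 \<le> 1 / pi"
  using pi_bounds by (auto simp: field_simps)

text \<open>A cell of two points also has to pay the deficits of its ancestors with three and four
  points, which are of the form \<open>- y * ln y\<close>.\<close>

lemma pair_cost_le:
  assumes "0 < y" "y \<le> x" "x \<le> 1"
  shows "9/10 * node_cost x + 39/100 * x + 781/10000 * - (y * ln y) \<le> level_cost (3/8 * x)"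
proof -
  define l where "l = - ln x"
  have x: "0 < x" and l: "0 \<le> l" using assms by (auto simp: l_def)
  have "node_cost x = x * ((2 + l) * (1 / pi))" using x by (simp add: node_cost_eq l_def)
  also have "\<dots> \<le> x * ((2 + l) * (31832/100000))"
    using x l inverse_pi_bounds by (intro mult_left_mono) auto
  also have "\<dots> = (63664/100000) * x + 31832/100000 * (x * l)" by (simp add: algebra_simps)
  finally have "9/10 * node_cost x + 39/100 * x \<le> 963/1000 * x + 2865/10000 * (x * l)"
    using mult_nonneg_nonneg[of x l] x l by linarith
  also have "\<dots> = x * (963/1000 + 2865/10000 * l)" by (simp add: algebra_simps)
  finally have 1: "9/10 * node_cost x + 39/100 * x \<le> x * (963/1000 + 2865/10000 * l)" .
  have "3/8 * x * (1 + 1671/1000 + l) \<le> 3/8 * x * (1 + ln (16/3) + l)"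
    using x ln_numerics(1) by (intro mult_left_mono) auto
  then have 2: "x * (10015/10000 + 375/1000 * l) \<le> level_cost (3/8 * x)"
    using level_cost_scaled[of "3/8" x] x mult_nonneg_nonneg[of x l] l by (simp add: l_def algebra_simps)
  \<comment> \<open>The coefficients on the right are the differences 1.0015 - 0.963 and 0.375 -
    0.2865 of the two estimates above; 781/10000 is the sum of the deficit coefficients 39/10000 and
    742/10000.\<close>
  have "781/10000 * - (y * ln y) \<le> x * (385/10000 + 885/10000 * l)"
  proof -
    show ?thesis
    proof (cases "- (y * ln y) \<le> x * l")
      case True
      have "x * (385/10000 + 885/10000 * l) = 385/10000 * x + 885/10000 * (x * l)" by (simp add: algebra_simps)
      moreover have "0 \<le> x * l" using x l by simp
      ultimately show ?thesis using True x by linarith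
    next
      case False
      \<comment> \<open>Only x > 1/e is possible here, so the crude maximum 37/100 is
        enough.\<close>
      then have y: "- (y * ln y) \<le> 37/100" using neg_mult_ln_le[OF assms] by (simp add: l_def)
      have "- 1 < ln x"
      proof (rule ccontr)
        assume "\<not> - 1 < ln x"
        then have "y * (0 - ln y) \<le> x * (0 - ln x)" using assms by (intro mult_const_minus_ln_mono) auto
        then show False using False by (simp add: l_def)
      qed
      then have "exp (- 1) < x" using x by (metis exp_less_cancel_iff exp_ln)
      moreover have "36/100 \<le> exp (- 1 :: real)" using e_less_272 by (simp add: exp_minus field_simps)
      ultimately have x36: "36/100 \<le> x" by simp
      have "ln x \<le> x - 1" using x by (rule ln_le_minus_one)
      then have "1 - x \<le> l" by (simp add: l_def)
      then have "x * (1 - x) \<le> x * l" using x by (intro mult_left_mono) auto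
      moreover have "0 \<le> (x - 36/100) * (1 - x)" using x36 assms by simp
      then have "36/100 * (1 - x) \<le> x * (1 - x)" by (simp add: algebra_simps)
      ultimately have "36/100 * (1 - x) \<le> x * l" by simp
      then have "885/10000 * (36/100 * (1 - x)) \<le> 885/10000 * (x * l)" by (intro mult_left_mono) auto
      moreover have "x * (385/10000 + 885/10000 * l) = 385/10000 * x + 885/10000 * (x * l)" by (simp add: algebra_simps)
      moreover have "781/10000 * - (y * ln y) \<le> 781/10000 * (37/100)" using y by (intro mult_left_mono) auto
      moreover have "781/10000 * (37/100) \<le> 385/10000 * x + 885/10000 * (36/100 * (1 - x))"
        using x36 assms by (simp add: field_simps)
      ultimately show ?thesis by linarith
    qed
  qed
  then show ?thesis using 1 2 by (simp add: algebra_simps)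
qed

text \<open>For an average t, a level z < 32/9 offers the ratio 2 t / z, which is at least 9/16 t.
  The deficit coefficient 742/10000 is 2/\<pi> - 9/16 rounded up.\<close>

lemma triple_cost_le:
  assumes "0 < t" "t \<le> 1"
  shows "2 * node_cost t \<le> level_cost (9/16 * t) + 742/10000 * - (t * ln t)"
proof -
  define l where "l = - ln t"
  have t: "0 < t" and l: "0 \<le> l" using assms by (auto simp: l_def)
  have "2 * node_cost t = t * ((4 + 2 * l) * (1 / pi))" using t by (simp add: node_cost_eq l_def)
  also have "\<dots> \<le> t * ((4 + 2 * l) * (31832/100000))"
    using t l inverse_pi_bounds by (intro mult_left_mono) auto
  also have "\<dots> \<le> t * (9/16 * (1 + 1266/1000 + l) + 742/10000 * l)"
    using t l by (intro mult_left_mono) (auto simp: field_simps)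
  also have "\<dots> \<le> t * (9/16 * (1 + ln (32/9) + l) + 742/10000 * l)"
    using t ln_numerics(2) by (intro mult_left_mono add_right_mono) auto
  also have "\<dots> = level_cost (9/16 * t) + 742/10000 * (t * l)"
    using t level_cost_scaled[of "9/16" t] by (simp add: l_def algebra_simps)
  finally show ?thesis by (simp add: l_def)
qed

text \<open>As for three points: 81/128 is 3 divided by 128/27, and 39/10000 is 2/\<pi> - 81/128
  rounded up.\<close>

lemma quadruple_cost_le:
  assumes "0 < r" "r \<le> 1"
  shows "2 * node_cost r \<le> level_cost (81/128 * r) + 39/10000 * - (r * ln r)"
proof -
  define l where "l = - ln r"
  have r: "0 < r" and l: "0 \<le> l" using assms by (auto simp: l_def)
  have "2 * node_cost r = r * ((4 + 2 * l) * (1 / pi))" using r by (simp add: node_cost_eq l_def)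
  also have "\<dots> \<le> r * ((4 + 2 * l) * (31832/100000))"
    using r l inverse_pi_bounds by (intro mult_left_mono) auto
  also have "\<dots> \<le> r * (81/128 * (1 + 114/100 + l) + 39/10000 * l)"
    using r l by (intro mult_left_mono) (auto simp: field_simps)
  also have "\<dots> \<le> r * (81/128 * (1 + ln (256/81) + l) + 39/10000 * l)"
    using r ln_numerics(3) by (intro mult_left_mono add_right_mono) auto
  also have "\<dots> = level_cost (81/128 * r) + 39/10000 * (r * l)"
    using r level_cost_scaled[of "81/128" r] by (simp add: l_def algebra_simps)
  finally show ?thesis by (simp add: l_def)
qed

text \<open>In the range of \<open>split_cost_4_3_le\<close>, cells of four and three points lack
  2/\<pi> - 9/16 and 2/\<pi> - 1/2, which 3/40 and 11/80 exceed slightly. A level below 3 offers x /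
  3.\<close>

lemma surplus_cost_le:
  assumes "0 \<le> x" "x \<le> 1"
  shows "level_cost (3/40 * x) + level_cost (11/80 * x) \<le> level_cost (1/3 * x)"
proof (cases "x = 0")
  case False
  define l where "l = - ln x"
  have x: "0 < x" and l: "0 \<le> l" using assms False by (auto simp: l_def)
  have 1: "2 / (3/40) = 2 * (40/3 :: real)" "2 / (11/80) = 2 * (80/11 :: real)" "2 / (1/3) = (6::real)" by simp_all
  have "level_cost (3/40 * x) = 3/40 * x * (1 + (ln 2 + ln (40/3)) + l)" "level_cost (11/80 * x) = 11/80 * x * (1 + (ln 2 + ln (80/11)) + l)"
    "level_cost (1/3 * x) = 1/3 * x * (1 + ln 6 + l)"
    using x by (simp_all only: level_cost_scaled divide_pos_pos zero_less_numeral zero_less_one 1 ln_mult_pos l_def) simp_all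
  moreover have "3/40 * x * (1 + (ln 2 + ln (40/3)) + l) \<le> 3/40 * x * (1 + (6932/10000 + 278/100) + l)"
    "11/80 * x * (1 + (ln 2 + ln (80/11)) + l) \<le> 11/80 * x * (1 + (6932/10000 + 21/10) + l)"
    "1/3 * x * (1 + 178/100 + l) \<le> 1/3 * x * (1 + ln 6 + l)"
    using x ln_numerics(4-7) by (auto intro!: mult_left_mono)
  moreover have "3/40 * x * (1 + (6932/10000 + 278/100) + l) + 11/80 * x * (1 + (6932/10000 + 21/10) + l) \<le> 1/3 * x * (1 + 178/100 + l)"
  proof -
    have "3/40 * x * (1 + (6932/10000 + 278/100) + l) + 11/80 * x * (1 + (6932/10000 + 21/10) + l) = x * (3/40 * (44732/10000) + 11/80 * (37932/10000) + (3/40 + 11/80) * l)"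
      "1/3 * x * (1 + 178/100 + l) = x * (1/3 * (278/100) + 1/3 * l)"
      by (simp_all add: algebra_simps)
    moreover have "x * (3/40 * (44732/10000) + 11/80 * (37932/10000) + (3/40 + 11/80) * l) \<le> x * (1/3 * (278/100) + 1/3 * l)"
      using x l by (intro mult_left_mono) (auto simp: field_simps)
    ultimately show ?thesis by linarith
  qed
  ultimately show ?thesis by linarith
qed simp

section \<open>Sums over levels\<close>

definition level_sum :: "(real \<Rightarrow> real) \<Rightarrow> nat \<Rightarrow> real \<Rightarrow> real" where
  "level_sum g n\<^sub>o z = (\<Sum>i | real n\<^sub>o \<le> (3/4) ^ i * z. g ((3/4) ^ i * z))"

lemma finite_levels:
  assumes "1 \<le> n\<^sub>o" "0 \<le> z"
  shows "finite {i. real n\<^sub>o \<le> (3/4) ^ i * z}"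
proof (cases "z = 0")
  case False
  then obtain k where k: "(3/4) ^ k < real n\<^sub>o / z"
    using real_arch_pow_inv[of "real n\<^sub>o / z" "3/4"] assms by auto
  have "i < k" if "real n\<^sub>o \<le> (3/4) ^ i * z" for i
  proof (rule ccontr)
    assume "\<not> i < k"
    then have "(3/4) ^ i \<le> (3/4 :: real) ^ k" by (intro power_decreasing) auto
    then have "(3/4) ^ i < real n\<^sub>o / z" using k by (rule order_le_less_trans)
    then show False using that assms False by (simp add: field_simps)
  qed
  then have "{i. real n\<^sub>o \<le> (3/4) ^ i * z} \<subseteq> {..<k}" by auto
  then show ?thesis by (rule finite_subset) simp
qed (use assms in auto)

text \<open>The start \<open>z\<close> of the sum is an arbitrary real number, so the tail is a
  \<open>level_sum\<close> again.\<close>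

lemma level_sum_rec:
  assumes "1 \<le> n\<^sub>o" "real n\<^sub>o \<le> z"
  shows "level_sum g n\<^sub>o z = g z + level_sum g n\<^sub>o (3/4 * z)"
proof -
  have eq: "{i. real n\<^sub>o \<le> (3/4) ^ i * z} = insert 0 (Suc ` {i. real n\<^sub>o \<le> (3/4) ^ i * (3/4 * z)})"
  proof (intro set_eqI)
    fix i show "i \<in> {i. real n\<^sub>o \<le> (3/4) ^ i * z} \<longleftrightarrow> i \<in> insert 0 (Suc ` {i. real n\<^sub>o \<le> (3/4) ^ i * (3/4 * z)})"
      using assms by (cases i) (auto simp: mult_ac)
  qed
  have "finite {i. real n\<^sub>o \<le> (3/4) ^ i * (3/4 * z)}" using assms by (intro finite_levels) auto
  then show ?thesis
    unfolding level_sum_def eq by (subst sum.insert) (auto simp: sum.reindex mult_ac)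
qed

lemma level_sum_nonneg:
  assumes "\<And>z. real n\<^sub>o \<le> z \<Longrightarrow> 0 \<le> g z"
  shows "0 \<le> level_sum g n\<^sub>o z"
  unfolding level_sum_def using assms by (intro sum_nonneg) auto

text \<open>Each cell size is matched with the unique level in a window of ratio \<open>4/3\<close> above it.\<close>

lemma level_sum_window:
  assumes n\<^sub>o: "1 \<le> n\<^sub>o" "n\<^sub>o < m" and z: "real m \<le> z" and g: "\<And>z. real n\<^sub>o \<le> z \<Longrightarrow> 0 \<le> g z"
    and claim: "\<And>w. real m \<le> w \<Longrightarrow> w < 4/3 * real m \<Longrightarrow> w \<le> z \<Longrightarrow> c \<le> level_sum g n\<^sub>o w"
  shows "c \<le> level_sum g n\<^sub>o z"
proof -
  have fin: "finite {i. real m \<le> (3/4) ^ i * z}" using n\<^sub>o z by (intro finite_levels) auto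
  moreover have "0 \<in> {i. real m \<le> (3/4) ^ i * z}" using z by simp
  ultimately have max: "real m \<le> (3/4) ^ Max {i. real m \<le> (3/4) ^ i * z} * z"
    using Max_in[of "{i. real m \<le> (3/4) ^ i * z}"] by blast
  define i where "i = Max {i. real m \<le> (3/4) ^ i * z}"
  have "\<not> real m \<le> (3/4) ^ Suc i * z"
    using Max_ge[OF fin, of "Suc i"] by (auto simp: i_def)
  then have "(3/4) ^ i * z < 4/3 * real m" by simp
  moreover have "(3/4) ^ i * z \<le> z" using z by (simp add: mult_left_le_one_le power_le_one)
  ultimately have "c \<le> level_sum g n\<^sub>o ((3/4) ^ i * z)" using max by (intro claim) (auto simp: i_def)
  also have "\<dots> \<le> level_sum g n\<^sub>o z"
  proof -
    have "level_sum g n\<^sub>o ((3/4) ^ i * z) \<le> level_sum g n\<^sub>o z" if "real n\<^sub>o \<le> (3/4) ^ i * z" for i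
      using that
    proof (induction i)
      case (Suc i)
      have le: "(3/4) ^ Suc i * z \<le> (3/4) ^ i * z" using z by simp
      then have n: "real n\<^sub>o \<le> (3/4) ^ i * z" using Suc.prems by linarith
      have "level_sum g n\<^sub>o ((3/4) ^ i * z) = g ((3/4) ^ i * z) + level_sum g n\<^sub>o ((3/4) ^ Suc i * z)"
        using level_sum_rec[OF n\<^sub>o(1) n] by (simp add: mult_ac)
      then show ?case using Suc.IH[OF n] g[OF n] by simp
    qed simp
    moreover have "real n\<^sub>o \<le> (3/4) ^ i * z" using max n\<^sub>o by (simp add: i_def)
    ultimately show ?thesis by blast
  qed
  finally show ?thesis .
qed


text \<open>Here \<open>f j\<close> stands for the distance of the nearest point divided by that of
  the j-th nearest. Charging cells to levels uses nothing else of the geometry.\<close>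

locale decreasing_ratios =
  fixes f :: "nat \<Rightarrow> real"
  assumes f_nonneg: "2 \<le> j \<Longrightarrow> 0 \<le> f j" and f_le_1: "2 \<le> j \<Longrightarrow> f j \<le> 1"
    and f_antimono: "2 \<le> i \<Longrightarrow> i \<le> j \<Longrightarrow> f j \<le> f i"
begin

definition total :: "nat \<Rightarrow> real" where
  "total m = (\<Sum>j = 2..m. f j)"

definition cost :: "real \<Rightarrow> real" where
  "cost z = level_cost (total (nat \<lfloor>z\<rfloor>) / z)"

text \<open>A pair gets the refined bound of \<open>emeasure_separating_pair\<close>, because 2
  \<open>node_cost (f 2)\<close> can exceed what a level close to 8/3 offers.\<close>

definition split_cost :: "nat \<Rightarrow> real" where
  "split_cost m = (if m = 2 then 9/10 * node_cost (f 2) + 39/100 * f 2 else 2 * node_cost (total m / (real m - 1)))"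

lemma total_nonneg: "0 \<le> total m"
  unfolding total_def by (intro sum_nonneg f_nonneg) auto

lemma total_mono: "m \<le> n \<Longrightarrow> total m \<le> total n"
  unfolding total_def by (intro sum_mono2) (auto intro: f_nonneg)

lemma total_le: "1 \<le> m \<Longrightarrow> total m \<le> real m - 1"
proof -
  assume m: "1 \<le> m"
  have "total m \<le> (\<Sum>j = 2..m. 1)" unfolding total_def by (intro sum_mono f_le_1) auto
  then show ?thesis using m by simp
qed

lemma total_Suc: "1 \<le> m \<Longrightarrow> total (Suc m) = total m + f (Suc m)"
  by (simp add: total_def)

text \<open>The average of a decreasing sequence decreases, since the next term is at most each
  earlier one.\<close>

lemma total_average:
  assumes "2 \<le> m"
  shows "total (Suc m) * (real m - 1) \<le> total m * real m"
proof -
  have "(real m - 1) * f (Suc m) = (\<Sum>j = 2..m. f (Suc m))" using assms by (simp add: of_nat_diff)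
  also have "\<dots> \<le> total m" unfolding total_def by (intro sum_mono f_antimono) auto
  finally show ?thesis using assms by (simp add: total_Suc algebra_simps)
qed

lemma total_ratio_le_1: "0 < z \<Longrightarrow> total (nat \<lfloor>z\<rfloor>) / z \<le> 1"
proof -
  assume z: "0 < z"
  have "total (nat \<lfloor>z\<rfloor>) \<le> z"
  proof (cases "nat \<lfloor>z\<rfloor> = 0")
    case True
    then show ?thesis using z by (simp add: total_def)
  next
    case False
    then have "total (nat \<lfloor>z\<rfloor>) \<le> real (nat \<lfloor>z\<rfloor>) - 1" by (intro total_le) linarith
    also have "\<dots> \<le> z" using z by linarith
    finally show ?thesis .
  qed
  then show ?thesis using z by simp
qed

lemma cost_nonneg: "0 < z \<Longrightarrow> 0 \<le> cost z"
  unfolding cost_def using total_nonneg by (intro level_cost_nonneg order_trans[OF total_ratio_le_1]) auto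

text \<open>All payments go through this criterion: monotonicity of \<open>total\<close> and of
  \<open>level_cost\<close> turns them into a linear inequality.\<close>

lemma level_cost_le_cost:
  assumes "0 \<le> c" "c * z \<le> total m" "real m \<le> z" "0 < z"
  shows "level_cost c \<le> cost z"
proof -
  have "m \<le> nat \<lfloor>z\<rfloor>" using assms by linarith
  then have "c * z \<le> total (nat \<lfloor>z\<rfloor>)" using assms total_mono by (meson order_trans)
  then have "c \<le> total (nat \<lfloor>z\<rfloor>) / z" using assms by (simp add: le_divide_eq)
  then show ?thesis
    unfolding cost_def using assms(1,4) by (intro level_cost_mono order_trans[OF total_ratio_le_1]) auto
qed

lemma average_bounds:
  assumes "2 \<le> m"
  shows "0 \<le> total m / (real m - 1)" "total m / (real m - 1) \<le> 1"
  using assms total_nonneg[of m] total_le[of m] by (auto simp: divide_le_eq)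

text \<open>For the average a = total m / (m - 1), the upper limit on z is what makes 2 a z / \<pi>
  at most \<open>total m\<close>. From m = 7 on, the whole window below 4 m / 3 satisfies
  it.\<close>

lemma split_cost_le_single:
  assumes m: "3 \<le> m" "real m \<le> z" "z \<le> pi / 2 * (real m - 1)"
  shows "split_cost m \<le> cost z"
proof -
  define a where "a = total m / (real m - 1)"
  have a: "0 \<le> a" using average_bounds[of m] m by (auto simp: a_def)
  have "split_cost m \<le> level_cost (2 * a / pi)"
    using m a node_cost_le_level_cost[of a] by (simp add: split_cost_def a_def)
  also have "\<dots> \<le> cost z"
  proof (rule level_cost_le_cost[OF _ _ m(2)])
    have "2 * a / pi * z \<le> 2 * a / pi * (pi / 2 * (real m - 1))"
      using m a by (intro mult_left_mono) auto
    also have "\<dots> = total m" using m by (simp add: a_def)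
    finally show "2 * a / pi * z \<le> total m" .
  qed (use m a in auto)
  finally show ?thesis .
qed

text \<open>The argument 2 a / \<pi> is divided into what the two levels certainly offer. The window
  z < 4 m / 3 yields \<open>c1\<close>; the next level, which lies between m - 1 and m, yields
  \<open>c2\<close> because averages decrease.\<close>

lemma split_cost_le_double:
  assumes m: "3 \<le> m" "real m \<le> z" "z < 4/3 * real m" "real m - 1 \<le> 3/4 * z"
  shows "split_cost m \<le> cost z + cost (3/4 * z)"
proof -
  define a where "a = total m / (real m - 1)"
  have a: "0 \<le> a" "a \<le> 1" using average_bounds[of m] m by (auto simp: a_def)
  have tm: "total m = a * (real m - 1)" using m by (simp add: a_def)
  have tm1: "a * (real m - 2) \<le> total (m - 1)"
  proof -
    have "total m * (real m - 2) \<le> total (m - 1) * (real m - 1)"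
      using total_average[of "m - 1"] m by (simp add: of_nat_diff)
    then have "(a * (real m - 2)) * (real m - 1) \<le> total (m - 1) * (real m - 1)" by (simp add: tm mult_ac)
    then show ?thesis using m by (simp add: mult_le_cancel_right)
  qed
  define c1 c2 where "c1 = a * (3 * (real m - 1) / (4 * real m))" and "c2 = a * ((real m - 2) / real m)"
  have c: "0 \<le> c1" "0 \<le> c2" using a m by (auto simp: c1_def c2_def)
  have "split_cost m \<le> level_cost (2 * a / pi)"
    using m a node_cost_le_level_cost[of a] by (simp add: split_cost_def a_def)
  also have "\<dots> \<le> level_cost (c1 + c2)"
  proof (rule level_cost_mono)
    have "2 / pi \<le> 2/3" using pi_bounds by (simp add: field_simps)
    also have "\<dots> \<le> 3 * (real m - 1) / (4 * real m) + (real m - 2) / real m" using m by (simp add: field_simps)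
    finally have "a * (2 / pi) \<le> a * (3 * (real m - 1) / (4 * real m) + (real m - 2) / real m)"
      using a by (intro mult_left_mono) auto
    then show "2 * a / pi \<le> c1 + c2" by (simp add: c1_def c2_def distrib_left mult_ac)
    have "3 * (real m - 1) / (4 * real m) \<le> 1" "(real m - 2) / real m \<le> 1" using m by (auto simp: field_simps)
    then have "a * (3 * (real m - 1) / (4 * real m)) \<le> 1" "a * ((real m - 2) / real m) \<le> 1"
      using a m by (intro mult_le_one; simp)+
    then show "c1 + c2 \<le> 2" by (simp add: c1_def c2_def)
  qed (use a in auto)
  also have "\<dots> \<le> level_cost c1 + level_cost c2" using c by (rule level_cost_add_le)
  also have "level_cost c1 \<le> cost z"
  proof (rule level_cost_le_cost[OF c(1) _ m(2)])
    have "c1 * z \<le> c1 * (4/3 * real m)" using c m by (intro mult_left_mono) auto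
    also have "\<dots> = total m" using m by (simp add: c1_def tm)
    finally show "c1 * z \<le> total m" .
  qed (use m in auto)
  also have "level_cost c2 \<le> cost (3/4 * z)"
  proof (rule level_cost_le_cost[OF c(2)])
    have "c2 * (3/4 * z) \<le> c2 * real m" using c m by (intro mult_left_mono) auto
    also have "\<dots> = a * (real m - 2)" using m by (simp add: c2_def)
    finally show "c2 * (3/4 * z) \<le> total (m - 1)" using tm1 by simp
    show "real (m - 1) \<le> 3/4 * z" using m by (simp add: of_nat_diff)
  qed (use m in auto)
  finally show ?thesis by simp
qed

lemma total_small: "total 2 = f 2" "total 3 = f 2 + f 3" "total 4 = f 2 + f 3 + f 4"
  by (simp_all add: total_def numeral_eq_Suc)

text \<open>Both deficits are estimated by the larger of \<open>h t\<close> and \<open>h u\<close>,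
  so that \<open>pair_cost_le\<close> applies with the sum 781/10000 of the coefficients.\<close>

lemma deficit_le:
  assumes "0 \<le> t" "t \<le> f 2" "0 \<le> u" "u \<le> f 2" "2 \<le> z" "z < 8/3" "0 \<le> c" "c \<le> 39/10000" "0 \<le> d" "d \<le> 742/10000"
  shows "split_cost 2 + c * - (t * ln t) + d * - (u * ln u) \<le> cost z"
proof (cases "f 2 = 0")
  case True
  then show ?thesis using assms cost_nonneg[of z] by (simp add: split_cost_def)
next
  case False
  have x: "0 < f 2" "f 2 \<le> 1" using False f_nonneg[of 2] f_le_1[of 2] by auto
  define h where "h y = - (y * ln y)" for y :: real
  have nn: "0 \<le> h y" if "0 \<le> y" "y \<le> f 2" for y
  proof (cases "y = 0")
    case False
    then have "ln y \<le> 0" using that x by simp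
    then show ?thesis using that by (simp add: h_def mult_nonneg_nonpos)
  qed (simp add: h_def)
  define y where "y = (if h t \<le> h u then u else t)"
  have y: "0 \<le> y" "y \<le> f 2" "h t \<le> h y" "h u \<le> h y"
    using assms by (auto simp: y_def)
  have "c * h t \<le> 39/10000 * h y" "d * h u \<le> 742/10000 * h y"
    using y assms nn[of t] nn[of u] by (intro mult_mono; simp)+
  moreover have "split_cost 2 + 781/10000 * h y \<le> level_cost (3/8 * f 2)"
  proof (cases "y = 0")
    case True
    have "9/10 * node_cost (f 2) + 39/100 * f 2 + 781/10000 * h (f 2) \<le> level_cost (3/8 * f 2)"
      using pair_cost_le[of "f 2" "f 2"] x by (simp add: h_def)
    then show ?thesis using True nn[of "f 2"] x by (simp add: split_cost_def h_def)
  next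
    case False
    then show ?thesis using pair_cost_le[of y "f 2"] x y by (simp add: split_cost_def h_def)
  qed
  moreover have "level_cost (3/8 * f 2) \<le> cost z"
  proof (rule level_cost_le_cost[where m = 2])
    have "3/8 * f 2 * z \<le> 3/8 * f 2 * (8/3)" using x assms by (intro mult_left_mono) auto
    then show "3/8 * f 2 * z \<le> total 2" by (simp add: total_small)
  qed (use x assms in auto)
  ultimately have "split_cost 2 + c * h t + d * h u \<le> cost z" by linarith
  then show ?thesis by (simp only: h_def)
qed

text \<open>Below 32/9 the next level is under 8/3, so a pair inside the cell can take over the
  deficit through \<open>deficit_le\<close>.\<close>

lemma split_cost_3_le:
  assumes "3 \<le> z" "z < 32/9"
  shows "split_cost 3 \<le> cost z + 742/10000 * - (total 3 / 2 * ln (total 3 / 2))"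
proof -
  define t where "t = total 3 / 2"
  have t: "0 \<le> t" "t \<le> 1" using average_bounds[of 3] by (auto simp: t_def)
  have "level_cost (9/16 * t) \<le> cost z"
  proof (rule level_cost_le_cost[where m = 3])
    have "9/16 * t * z \<le> 9/16 * t * (32/9)" using t assms by (intro mult_left_mono) auto
    then show "9/16 * t * z \<le> total 3" by (simp add: t_def)
  qed (use t assms in auto)
  moreover have "2 * node_cost t \<le> level_cost (9/16 * t) + 742/10000 * - (t * ln t)"
    using triple_cost_le[of t] t by (cases "t = 0") auto
  ultimately show ?thesis by (simp add: split_cost_def t_def)
qed

text \<open>Below 128/27 the next two levels are under 32/9 and 8/3, as the bounds for three and two
  points require.\<close>

lemma split_cost_4_le:
  assumes "4 \<le> z" "z < 128/27"
  shows "split_cost 4 \<le> cost z + 39/10000 * - (total 4 / 3 * ln (total 4 / 3))"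
proof -
  define r where "r = total 4 / 3"
  have r: "0 \<le> r" "r \<le> 1" using average_bounds[of 4] by (auto simp: r_def)
  have "level_cost (81/128 * r) \<le> cost z"
  proof (rule level_cost_le_cost[where m = 4])
    have "81/128 * r * z \<le> 81/128 * r * (128/27)" using r assms by (intro mult_left_mono) auto
    then show "81/128 * r * z \<le> total 4" by (simp add: r_def)
  qed (use r assms in auto)
  moreover have "2 * node_cost r \<le> level_cost (81/128 * r) + 39/10000 * - (r * ln r)"
    using quadruple_cost_le[of r] r by (cases "r = 0") auto
  ultimately show ?thesis by (simp add: split_cost_def r_def)
qed

text \<open>In this range the fourth level 27/64 z is still at least 2 and is left to a pair. Thus
  the third level, which is below 3, is free to pay what the other two lack.\<close>

lemma split_cost_4_3_le:
  assumes "128/27 \<le> z" "z < 16/3"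
  shows "split_cost 4 + split_cost 3 \<le> cost z + cost (3/4 * z) + cost (9/16 * z)"
proof -
  define r t where "r = total 4 / 3" and "t = total 3 / 2"
  have r: "0 \<le> r" "r \<le> 1" and t: "0 \<le> t" "t \<le> 1"
    using average_bounds[of 4] average_bounds[of 3] by (auto simp: r_def t_def)
  have x: "0 \<le> f 2" "f 2 \<le> 1" using f_nonneg[of 2] f_le_1[of 2] by auto
  have rx: "r \<le> f 2" and tx: "t \<le> f 2"
    using f_antimono[of 2 3] f_antimono[of 2 4] by (auto simp: r_def t_def total_small)
  have pi23: "2 / pi \<le> 63664/100000" using inverse_pi_bounds by simp
  have "split_cost 4 \<le> level_cost (2 * r / pi)" "split_cost 3 \<le> level_cost (2 * t / pi)"
    using node_cost_le_level_cost[OF r(1)] node_cost_le_level_cost[OF t(1)] by (simp_all add: split_cost_def r_def t_def)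
  moreover have "level_cost (2 * r / pi) \<le> level_cost (9/16 * r + 3/40 * f 2)"
  proof (rule level_cost_mono)
    have "r * (2 / pi) \<le> r * (63664/100000)" using r pi23 by (intro mult_left_mono) auto
    then show "2 * r / pi \<le> 9/16 * r + 3/40 * f 2" using rx r by simp
  qed (use r x in auto)
  moreover have "level_cost (9/16 * r + 3/40 * f 2) \<le> level_cost (9/16 * r) + level_cost (3/40 * f 2)"
    using r x by (intro level_cost_add_le) auto
  moreover have "level_cost (2 * t / pi) \<le> level_cost (1/2 * t + 11/80 * f 2)"
  proof (rule level_cost_mono)
    have "t * (2 / pi) \<le> t * (63664/100000)" using t pi23 by (intro mult_left_mono) auto
    then show "2 * t / pi \<le> 1/2 * t + 11/80 * f 2" using tx t by simp
  qed (use t x in auto)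
  moreover have "level_cost (1/2 * t + 11/80 * f 2) \<le> level_cost (1/2 * t) + level_cost (11/80 * f 2)"
    using t x by (intro level_cost_add_le) auto
  moreover have "level_cost (9/16 * r) \<le> cost z"
  proof (rule level_cost_le_cost[where m = 4])
    have "9/16 * r * z \<le> 9/16 * r * (16/3)" using r assms by (intro mult_left_mono) auto
    then show "9/16 * r * z \<le> total 4" by (simp add: r_def)
  qed (use r assms in auto)
  moreover have "level_cost (1/2 * t) \<le> cost (3/4 * z)"
  proof (rule level_cost_le_cost[where m = 3])
    have "1/2 * t * (3/4 * z) \<le> 1/2 * t * 4" using t assms by (intro mult_left_mono) auto
    then show "1/2 * t * (3/4 * z) \<le> total 3" by (simp add: t_def)
  qed (use t assms in auto)
  moreover have "level_cost (1/3 * f 2) \<le> cost (9/16 * z)"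
  proof (rule level_cost_le_cost[where m = 2])
    have "1/3 * f 2 * (9/16 * z) \<le> 1/3 * f 2 * 3" using x assms by (intro mult_left_mono) auto
    then show "1/3 * f 2 * (9/16 * z) \<le> total 2" by (simp add: total_small)
  qed (use x assms in auto)
  moreover have "level_cost (3/40 * f 2) + level_cost (11/80 * f 2) \<le> level_cost (1/3 * f 2)"
    by (rule surplus_cost_le[OF x])
  ultimately show ?thesis by linarith
qed

lemma split_cost_nonneg: "2 \<le> m \<Longrightarrow> 0 \<le> split_cost m"
  using node_cost_nonneg[OF average_bounds[of m]] node_cost_nonneg[of "f 2"] f_nonneg[of 2] f_le_1[of 2]
  by (auto simp: split_cost_def)

lemma level_sum_cost_rec:
  assumes "1 \<le> n\<^sub>o" "real n\<^sub>o \<le> z"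
  shows "level_sum cost n\<^sub>o z = cost z + level_sum cost n\<^sub>o (3/4 * z)"
  using assms by (rule level_sum_rec)

lemma level_sum_cost_nonneg: "1 \<le> n\<^sub>o \<Longrightarrow> 0 \<le> level_sum cost n\<^sub>o z"
  by (intro level_sum_nonneg cost_nonneg) auto

text \<open>A cell of at least seven points is paid by its own level. Cells of three to six points may use the
  next level as well if their children are small enough to leave it free. The
  remaining cells of three and four points leave a deficit to their subcells.\<close>

lemma split_cost_sum_le:
  fixes M :: "'b set \<Rightarrow> real"
  assumes n\<^sub>o: "1 \<le> n\<^sub>o"
    and leaf: "\<And>S. good S \<Longrightarrow> card S \<le> n\<^sub>o \<Longrightarrow> M S \<le> 0"
    and step: "\<And>S c. good S \<Longrightarrow> n\<^sub>o < card S \<Longrightarrow> 0 \<le> c \<Longrightarrow>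
      (\<And>A. good A \<Longrightarrow> 4 * card A \<le> 3 * card S \<Longrightarrow> M A \<le> c) \<Longrightarrow> M S \<le> split_cost (card S) + c"
  shows "good S \<Longrightarrow> real (card S) \<le> z \<Longrightarrow> M S \<le> level_sum cost n\<^sub>o z"
proof (induction "card S" arbitrary: S z rule: less_induct)
  case less
  note good = less.prems(1)
  note rec = level_sum_cost_rec[OF n\<^sub>o] and nonneg = level_sum_cost_nonneg[OF n\<^sub>o]
  define m where "m = card S"
  show ?case
  proof (cases "m \<le> n\<^sub>o")
    case True
    then show ?thesis using leaf[OF good] nonneg[of z] by (simp add: m_def)
  next
    case False
    then have m: "2 \<le> m" "n\<^sub>o < m" using n\<^sub>o by auto
    then have nm: "real n\<^sub>o \<le> real m - 1" by linarith
    \<comment> \<open>A pair passes nothing on: a child has at most three quarters of two points, so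
      it is a leaf.\<close>
    have pair: "M A \<le> split_cost 2" if A: "good A" "card A \<le> 2" for A
    proof (cases "card A \<le> n\<^sub>o")
      case False
      then have "card A = 2" using A n\<^sub>o by auto
      moreover have "M B \<le> 0" if "good B" "4 * card B \<le> 3 * card A" for B
        using that A n\<^sub>o by (intro leaf) auto
      ultimately show ?thesis using step[OF A(1), of 0] False by simp
    qed (use leaf[OF A(1)] split_cost_nonneg[of 2] in auto)
    show ?thesis
    proof (rule level_sum_window[OF n\<^sub>o _ less.prems(2)])
      fix z assume z': "real (card S) \<le> z" "z < 4/3 * real (card S)"
      then have z: "real m \<le> z" "z < 4/3 * real m" by (simp_all add: m_def)
      have IH: "M A \<le> level_sum cost n\<^sub>o w" if "good A" "card A < m" "real (card A) \<le> w" for A w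
        using less.hyps[of A w] that by (simp add: m_def)
      have first: "level_sum cost n\<^sub>o z = cost z + level_sum cost n\<^sub>o (3/4 * z)"
        using z nm by (intro rec) auto
      have second: "level_sum cost n\<^sub>o (3/4 * z) = cost (3/4 * z) + level_sum cost n\<^sub>o (9/16 * z)" if "real m - 1 \<le> 3/4 * z"
        using rec[of "3/4 * z"] that nm by simp
      have double: "M S \<le> level_sum cost n\<^sub>o z"
        if "3 \<le> m" "real m - 1 \<le> 3/4 * z" "real (3 * m div 4) \<le> 9/16 * z"
      proof -
        have "M S \<le> split_cost m + level_sum cost n\<^sub>o (9/16 * z)"
          unfolding m_def
        proof (rule step[OF good _ nonneg])
          fix A assume A: "good A" "4 * card A \<le> 3 * card S"
          then have "card A \<le> 3 * m div 4" by (simp add: m_def)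
          then show "M A \<le> level_sum cost n\<^sub>o (9/16 * z)" using that A m by (intro IH) (auto simp: m_def)
        qed (use m m_def in simp)
        also have "split_cost m \<le> cost z + cost (3/4 * z)"
          using that z by (intro split_cost_le_double) auto
        finally show ?thesis using first second that by simp
      qed
      \<comment> \<open>For three points, 32/9 decides whether two levels can be spent while a pair
        still finds a level of its own. For four points, \<open>n\<^sub>o\<close> decides whether
        cells of three points are leaves. From five points on, the question is whether z is in the
        range of \<open>split_cost_le_single\<close>.\<close>
      consider "m = 2" | "m = 3" "z < 32/9" | "m = 3" "32/9 \<le> z" | "m = 4" "n\<^sub>o = 3" | "m = 4" "n\<^sub>o \<le> 2"
        | "5 \<le> m" "m \<le> 6" "pi / 2 * (real m - 1) < z" | "5 \<le> m" "z \<le> pi / 2 * (real m - 1)"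
        | "7 \<le> m" "pi / 2 * (real m - 1) < z"
        using m by linarith
      then show "M S \<le> level_sum cost n\<^sub>o z"
      proof cases
        case 1
        have "split_cost 2 \<le> cost z"
          using deficit_le[of 0 0 z 0 0] z 1 f_nonneg[of 2] by simp
        then show ?thesis using pair[OF good] first nonneg[of "3/4 * z"] 1 by (simp add: m_def)
      next
        case 2
        have "M S \<le> split_cost (card S) + split_cost 2"
          by (rule step[OF good _ split_cost_nonneg pair]) (use m 2 in \<open>auto simp: m_def\<close>)
        also have "\<dots> \<le> cost z + (split_cost 2 + 742/10000 * - (total 3 / 2 * ln (total 3 / 2)))"
          using split_cost_3_le[of z] 2 z by (simp add: m_def)
        also have "split_cost 2 + 742/10000 * - (total 3 / 2 * ln (total 3 / 2)) \<le> cost (3/4 * z)"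
          using deficit_le[of 0 "total 3 / 2" "3/4 * z" 0 "742/10000"] 2 z f_nonneg[of 2] total_nonneg[of 3] f_antimono[of 2 3]
          by (simp add: total_small)
        finally show ?thesis using first second nonneg[of "9/16 * z"] 2 z by simp
      next
        case 3
        show ?thesis by (rule double) (use 3 in auto)
      next
        case 4
        \<comment> \<open>All children are leaves. The split must be paid by two levels, since 9/16
          z < 3 is no longer in the sum.\<close>
        have "M S \<le> split_cost (card S) + 0"
          by (rule step[OF good]) (use m 4 leaf in \<open>auto simp: m_def\<close>)
        also have "split_cost (card S) \<le> cost z + cost (3/4 * z)"
          using split_cost_le_double[of m z] 4 z by (simp add: m_def)
        finally show ?thesis using first second nonneg[of "9/16 * z"] 4 z by simp
      next
        case 5
        have third: "level_sum cost n\<^sub>o z = cost z + cost (3/4 * z) + cost (9/16 * z) + level_sum cost n\<^sub>o (27/64 * z)"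
          using first second rec[of "9/16 * z"] 5 z by simp
        have triple: "M A \<le> split_cost 3 + c"
          if A: "good A" "card A \<le> 3" and c: "0 \<le> c" "\<And>B. good B \<Longrightarrow> card B \<le> 2 \<Longrightarrow> M B \<le> c" for A c
        proof (cases "card A \<le> 2")
          case True
          then show ?thesis using c(2)[OF A(1)] split_cost_nonneg[of 3] by simp
        next
          case False
          then have "card A = 3" using A by simp
          then show ?thesis using step[OF A(1), of c] c 5 by simp
        qed
        show ?thesis
        proof (cases "z < 128/27")
          case True
          have "M S \<le> split_cost (card S) + (split_cost 3 + split_cost 2)"
          proof (rule step[OF good])
            fix A assume "good A" "4 * card A \<le> 3 * card S"
            then show "M A \<le> split_cost 3 + split_cost 2"
              using 5 split_cost_nonneg[of 2] pair by (intro triple) (auto simp: m_def)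
          qed (use m 5 split_cost_nonneg in \<open>auto simp: m_def\<close>)
          moreover have "split_cost (card S) \<le> cost z + 39/10000 * - (total 4 / 3 * ln (total 4 / 3))"
            using split_cost_4_le[of z] True 5 z by (simp add: m_def)
          moreover have "split_cost 3 \<le> cost (3/4 * z) + 742/10000 * - (total 3 / 2 * ln (total 3 / 2))"
            using split_cost_3_le[of "3/4 * z"] True 5 z by simp
          moreover have "split_cost 2 + 39/10000 * - (total 4 / 3 * ln (total 4 / 3)) + 742/10000 * - (total 3 / 2 * ln (total 3 / 2)) \<le> cost (9/16 * z)"
            using deficit_le[of "total 4 / 3" "total 3 / 2" "9/16 * z" "39/10000" "742/10000"] True 5 z
              total_nonneg[of 3] total_nonneg[of 4] f_antimono[of 2 3] f_antimono[of 2 4] by (simp add: total_small)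
          ultimately show ?thesis using third nonneg[of "27/64 * z"] by linarith
        next
          case False
          have "M S \<le> split_cost (card S) + (split_cost 3 + level_sum cost n\<^sub>o (27/64 * z))"
          proof (rule step[OF good])
            fix A assume A: "good A" "4 * card A \<le> 3 * card S"
            \<comment> \<open>Pairs are paid from the fourth level on, which is at least 2 because
              128/27 \<le> z.\<close>
            have "M B \<le> level_sum cost n\<^sub>o (27/64 * z)" if "good B" "card B \<le> 2" for B
              using that 5 False by (intro IH) auto
            then show "M A \<le> split_cost 3 + level_sum cost n\<^sub>o (27/64 * z)"
              using 5 A nonneg by (intro triple) (auto simp: m_def)
          qed (use m 5 split_cost_nonneg[of 3] nonneg in \<open>auto simp: m_def\<close>)
          then show ?thesis using split_cost_4_3_le[of z] 5 False z third by (simp add: m_def)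
        qed
      next
        case 6
        \<comment> \<open>With a rational lower bound for \<pi>/2 the conditions of
          \<open>double\<close> can be checked for m = 5 and m = 6 by arithmetic.\<close>
        have "31415/20000 * (real m - 1) < z"
        proof -
          have "31415/20000 * (real m - 1) \<le> pi / 2 * (real m - 1)"
            using pi_bounds m by (intro mult_right_mono) auto
          then show ?thesis using 6 by linarith
        qed
        moreover have "m = 5 \<or> m = 6" using 6 by auto
        ultimately show ?thesis by (intro double) auto
      next
        case 7
        have "M S \<le> split_cost (card S) + level_sum cost n\<^sub>o (3/4 * z)"
          by (rule step[OF good _ nonneg], use m m_def in simp)
            (rule IH, use m z in \<open>auto simp: m_def\<close>)
        moreover have "split_cost (card S) \<le> cost z"
          using split_cost_le_single[of m z] 7 z by (simp add: m_def)
        ultimately show ?thesis using first by simp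
      next
        case 8
        have "31415/20000 * (real m - 1) \<le> pi / 2 * (real m - 1)"
          using pi_bounds m by (intro mult_right_mono) auto
        moreover have "7 \<le> real m" using 8 by simp
        ultimately have False using 8 z by argo
        then show ?thesis ..
      qed
    qed (use m nonneg cost_nonneg n\<^sub>o in \<open>auto simp: m_def\<close>)
  qed
qed

end

subsection \<open>Neighbors of the query\<close>

locale ordered_points =
  fixes q :: "'a::euclidean_space" and y :: "nat \<Rightarrow> 'a" and n :: nat
  assumes inj: "inj_on y {1..n}"
    and ordered: "1 \<le> i \<Longrightarrow> i \<le> j \<Longrightarrow> j \<le> n \<Longrightarrow> norm (q - y i) \<le> norm (q - y j)"
begin

definition ratio :: "nat \<Rightarrow> nat \<Rightarrow> real" where
  "ratio i j = norm (q - y i) / norm (q - y j)"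

lemma ratio_nonneg: "0 \<le> ratio i j"
  by (simp add: ratio_def)

lemma dist_pos:
  assumes "1 \<le> i" "i < j" "j \<le> n"
  shows "0 < norm (q - y j)"
proof (rule ccontr)
  assume "\<not> 0 < norm (q - y j)"
  then have "y i = y j" using ordered[of i j] assms by simp
  then show False using inj_onD[OF inj, of i j] assms by simp
qed

lemma ratio_le_1: "1 \<le> i \<Longrightarrow> i < j \<Longrightarrow> j \<le> n \<Longrightarrow> ratio i j \<le> 1"
  using ordered[of i j] dist_pos[of i j] by (simp add: ratio_def)

lemma ratio_antimono: "1 \<le> i \<Longrightarrow> i < j \<Longrightarrow> j \<le> j' \<Longrightarrow> j' \<le> n \<Longrightarrow> ratio i j' \<le> ratio i j"
  unfolding ratio_def using ordered[of j j'] dist_pos[of i j] dist_pos[of i j']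
  by (intro divide_left_mono mult_pos_pos) auto

lemma ratio_mono: "1 \<le> i \<Longrightarrow> i \<le> i' \<Longrightarrow> i' \<le> n \<Longrightarrow> ratio i j \<le> ratio i' j"
  using ordered[of i i'] by (simp add: ratio_def divide_right_mono)

text \<open>The indices of the remaining points of \<open>S\<close> are replaced by k + 1, ..., card
  S, which is the worst case since ratios decrease. The logarithmic terms of the nearest neighbor
  are combined by \<open>sum_node_cost_le\<close>.\<close>

lemma measure_separating_le:
  assumes k: "1 \<le> k" "k \<le> n" and S: "y ` {1..k} \<subseteq> S" "S \<subseteq> y ` {1..n}" and m: "2 \<le> card S"
  shows "measure split_measure (separating q (y ` {1..k}) S) \<le>
    2 * (real k - 1) / (real (card S) - 1) + (\<Sum>j = k + 1..card S. \<Sum>i = 2..k. ratio i j) / (real (card S) - 1)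
    + 2 * node_cost ((\<Sum>j = k + 1..card S. ratio 1 j) / (real (card S) - 1))"
proof -
  interpret M: prob_space "split_measure :: ('a \<times> real) measure" by (rule prob_space_split_measure)
  define m where "m = card S"
  let ?A = "\<Sum>j = k + 1..m. ratio 1 j" and ?B = "\<Sum>j = k + 1..m. \<Sum>i = 2..k. ratio i j / 2"
  define J where "J = {j \<in> {1..n}. y j \<in> S} - {1..k}"
  have finS: "finite S" using S finite_subset by blast
  have injk: "inj_on y {1..k}" using k by (intro inj_on_subset[OF inj]) auto
  have img: "y ` {j \<in> {1..n}. y j \<in> S} = S" using S by auto
  have injS: "inj_on y {j \<in> {1..n}. y j \<in> S}" using inj by (rule inj_on_subset) auto
  have SJ: "S - y ` {1..k} = y ` J"
    unfolding J_def using img injS S k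
    by (subst inj_on_image_set_diff[OF injS]) auto
  have injJ: "inj_on y J" using injS by (rule inj_on_subset) (auto simp: J_def)
  have finJ: "finite J" by (auto simp: J_def)
  have cN: "card (y ` {1..k}) = k" using card_image[OF injk] by simp
  have cJ: "card J = m - k" "k \<le> m"
    using card_image[OF injJ] card_Diff_subset[OF _ S(1)] cN card_mono[OF finS S(1)]
    unfolding SJ[symmetric] m_def by simp_all
  have N1: "y ` {1..k} - {y 1} = y ` {2..k}"
  proof -
    have "y ` {1..k} - y ` {1} = y ` ({1..k} - {1})"
      using k by (subst inj_on_image_set_diff[OF injk]) auto
    moreover have "{1..k} - {1} = {2..k}" by auto
    ultimately show ?thesis by simp
  qed
  have average: "?A / (real m - 1) \<le> 1"
  proof -
    have "m \<le> n" using S card_mono[of "y ` {1..n}" S] card_image_le[of "{1..n}" y] by (simp add: m_def)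
    then have "?A \<le> (\<Sum>j = k + 1..m. 1)"
      using k by (intro sum_mono ratio_le_1) auto
    also have "\<dots> \<le> real m - 1" using k m by (simp add: m_def)
    finally show ?thesis using m by (simp add: m_def)
  qed
  have "(\<Sum>z\<in>y ` J. (\<Sum>x\<in>y ` {1..k} - {y 1}. norm (q - x) / norm (q - z) / 2) + node_cost (norm (q - y 1) / norm (q - z)))
    = (\<Sum>j\<in>J. (\<Sum>i = 2..k. ratio i j / 2) + node_cost (ratio 1 j))"
  proof -
    have "inj_on y {2..k}" using injk by (rule inj_on_subset) auto
    then show ?thesis
      unfolding N1 by (simp add: sum.reindex[OF injJ] sum.reindex ratio_def)
  qed
  also have "\<dots> = (\<Sum>j\<in>J. \<Sum>i = 2..k. ratio i j / 2) + (\<Sum>j\<in>J. node_cost (ratio 1 j))"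
    by (rule sum.distrib)
  also have "(\<Sum>j\<in>J. \<Sum>i = 2..k. ratio i j / 2) \<le> ?B"
  proof -
    have "(\<Sum>j\<in>J. \<Sum>i = 2..k. ratio i j / 2) \<le> (\<Sum>j = k + 1..k + card J. \<Sum>i = 2..k. ratio i j / 2)"
      by (rule card_sum_antimono_le[OF finJ, where n = n])
        (auto simp: J_def intro!: sum_mono ratio_antimono)
    then show ?thesis using cJ by simp
  qed
  also have "(\<Sum>j\<in>J. node_cost (ratio 1 j)) \<le> (real m - 1) * node_cost (?A / (real m - 1))"
  proof -
    have "(\<Sum>j\<in>J. node_cost (ratio 1 j)) \<le> real (m - 1) * node_cost ((\<Sum>j\<in>J. ratio 1 j) / real (m - 1))"
      using cJ k m by (intro sum_node_cost_le finJ ratio_nonneg) (auto simp: m_def)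
    also have "\<dots> \<le> real (m - 1) * node_cost (?A / real (m - 1))"
    proof (intro mult_left_mono node_cost_mono divide_right_mono)
      have "(\<Sum>j\<in>J. ratio 1 j) \<le> (\<Sum>j = k + 1..k + card J. ratio 1 j)"
        using k by (intro card_sum_antimono_le[OF finJ, where n = n]) (auto simp: J_def intro!: ratio_antimono)
      then show "(\<Sum>j\<in>J. ratio 1 j) \<le> ?A" using cJ by simp
      show "?A / real (m - 1) \<le> 1"
        using average m by (simp add: m_def)
    qed (auto intro!: divide_nonneg_nonneg sum_nonneg ratio_nonneg)
    finally show ?thesis using m by (simp add: m_def)
  qed
  finally have sum: "(\<Sum>z\<in>y ` J. (\<Sum>x\<in>y ` {1..k} - {y 1}. norm (q - x) / norm (q - z) / 2) + node_cost (norm (q - y 1) / norm (q - z)))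
    \<le> ?B + (real m - 1) * node_cost (?A / (real m - 1))"
    by simp
  have "emeasure split_measure (separating q (y ` {1..k}) S) \<le> ennreal (2 / (real (card S) - 1) * (real (card (y ` {1..k}) - 1) +
    (\<Sum>z\<in>S - y ` {1..k}. (\<Sum>x\<in>y ` {1..k} - {y 1}. norm (q - x) / norm (q - z) / 2) + node_cost (norm (q - y 1) / norm (q - z)))))"
  proof (rule emeasure_separating[OF finS m S(1)])
    fix x z assume "x \<in> y ` {1..k}" "z \<in> S - y ` {1..k}"
    then show "norm (q - x) \<le> norm (q - z)" unfolding SJ by (auto simp: J_def intro!: ordered)
  qed (use k in auto)
  also have "\<dots> \<le> ennreal (2 / (real m - 1) * (real k - 1 + (?B + (real m - 1) * node_cost (?A / (real m - 1)))))"
    using sum m k unfolding SJ cN m_def[symmetric] by (intro ennreal_leI mult_left_mono) auto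
  finally have "measure split_measure (separating q (y ` {1..k}) S) \<le>
     2 / (real m - 1) * (real k - 1 + (?B + (real m - 1) * node_cost (?A / (real m - 1))))"
  proof (subst (asm) M.emeasure_eq_measure, subst (asm) ennreal_le_iff)
    show "0 \<le> 2 / (real m - 1) * (real k - 1 + (?B + (real m - 1) * node_cost (?A / (real m - 1))))"
      using k m by (intro mult_nonneg_nonneg add_nonneg_nonneg node_cost_nonneg average sum_nonneg divide_nonneg_nonneg ratio_nonneg)
        (auto simp: m_def)
  qed
  also have "\<dots> = 2 * (real k - 1) / (real m - 1) + (\<Sum>j = k + 1..m. \<Sum>i = 2..k. ratio i j) / (real m - 1)
    + 2 * node_cost (?A / (real m - 1))"
  proof -
    have *: "2 / d * (A + (B / 2 + d * C)) = 2 * A / d + B / d + 2 * C" if "0 < d" for A B C d :: real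
      using that by (simp add: field_simps)
    show ?thesis unfolding sum_divide_distrib[symmetric] using m by (intro *) (simp add: m_def)
  qed
  finally show ?thesis by (simp add: m_def)
qed


text \<open>The value 0 beyond n extends the ratios to all indices, as the locale demands. Levels
  never exceed n, so the bound is not affected.\<close>

definition nearest_ratio :: "nat \<Rightarrow> real" where
  "nearest_ratio j = (if j \<le> n then ratio 1 j else 0)"

sublocale decreasing_ratios nearest_ratio
  by unfold_locales (auto simp: nearest_ratio_def intro: ratio_nonneg ratio_le_1 ratio_antimono)

text \<open>In a pair, the ratio of the second point is at most that of the second nearest data
  point, which enters \<open>split_cost\<close>. Larger cells are the case k = 1 of
  \<open>measure_separating_le\<close>.\<close>

lemma measure_separating_nearest_le:
  assumes S: "y 1 \<in> S" "S \<subseteq> y ` {1..n}" and m: "2 \<le> card S"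
  shows "measure split_measure (separating q {y 1} S) \<le> split_cost (card S)"
proof -
  interpret M: prob_space "split_measure :: ('a \<times> real) measure" by (rule prob_space_split_measure)
  have "card S \<le> n" using S card_mono[of "y ` {1..n}" S] card_image_le[of "{1..n}" y] by simp
  show ?thesis
  proof (cases "card S = 2")
    case True
    then obtain z where z: "S = {y 1, z}" "y 1 \<noteq> z"
      using S(1) by (metis card_2_iff doubleton_eq_iff insertE singletonD)
    then obtain j where "z = y j" "j \<in> {1..n}" using S(2) by auto
    moreover have "j \<noteq> 1" using z calculation by auto
    ultimately have j: "z = y j" "2 \<le> j" "j \<le> n" by auto
    have r: "0 \<le> ratio 1 j" "ratio 1 j \<le> nearest_ratio 2" "nearest_ratio 2 \<le> 1"
      using j ratio_nonneg ratio_antimono[of 1 2 j] f_le_1[of 2] by (auto simp: nearest_ratio_def)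
    have "emeasure split_measure (separating q {y 1} S) \<le> ennreal (9/10 * node_cost (ratio 1 j) + 39/100 * ratio 1 j)"
      unfolding z(1) j(1) ratio_def using z j by (intro emeasure_separating_pair ordered) auto
    moreover have "0 \<le> 9/10 * node_cost (ratio 1 j) + 39/100 * ratio 1 j"
      using r node_cost_nonneg[of "ratio 1 j"] by simp
    ultimately have "measure split_measure (separating q {y 1} S) \<le> 9/10 * node_cost (ratio 1 j) + 39/100 * ratio 1 j"
      by (simp add: M.emeasure_eq_measure)
    also have "\<dots> \<le> split_cost 2"
      using r node_cost_mono[of "ratio 1 j" "nearest_ratio 2"] by (simp add: split_cost_def)
    finally show ?thesis using True by simp
  next
    case False
    have "total (card S) = (\<Sum>j = 2..card S. ratio 1 j)"
      unfolding total_def using \<open>card S \<le> n\<close> by (intro sum.cong) (auto simp: nearest_ratio_def)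
    then show ?thesis
      using measure_separating_le[of 1 S] S m False \<open>card S \<le> n\<close> by (simp add: split_cost_def numeral_2_eq_2)
  qed
qed

lemma miss_nearest_le:
  assumes n: "1 \<le> n" and n\<^sub>o: "1 \<le> n\<^sub>o"
  shows "miss_prob q {y 1} n\<^sub>o (y ` {1..n}) \<le>
    level_sum (\<lambda>z. level_cost ((\<Sum>j = 2..nat \<lfloor>z\<rfloor>. ratio 1 j) / z)) n\<^sub>o n"
proof -
  have cardn: "card (y ` {1..n}) = n" using card_image[OF inj] by simp
  have "miss_prob q {y 1} n\<^sub>o (y ` {1..n}) \<le> level_sum cost n\<^sub>o n"
  proof (rule split_cost_sum_le[where good = "\<lambda>S. y 1 \<in> S \<and> S \<subseteq> y ` {1..n}", OF n\<^sub>o])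
    fix S assume S: "y 1 \<in> S \<and> S \<subseteq> y ` {1..n}"
    then show "miss_prob q {y 1} n\<^sub>o S \<le> 0" if "card S \<le> n\<^sub>o"
      using miss_prob_leaf[OF that, of "{y 1}" q] by simp
    have finS: "finite S" using S finite_subset by blast
    fix c assume c: "n\<^sub>o < card S" "0 \<le> c"
      and IH: "\<And>A. y 1 \<in> A \<and> A \<subseteq> y ` {1..n} \<Longrightarrow> 4 * card A \<le> 3 * card S \<Longrightarrow> miss_prob q {y 1} n\<^sub>o A \<le> c"
    have "miss_prob q {y 1} n\<^sub>o S \<le> measure split_measure (separating q {y 1} S) + c"
      using S c n\<^sub>o by (intro miss_prob_step finS IH) auto
    also have "measure split_measure (separating q {y 1} S) \<le> split_cost (card S)"
      using S c n\<^sub>o by (intro measure_separating_nearest_le) auto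
    finally show "miss_prob q {y 1} n\<^sub>o S \<le> split_cost (card S) + c" by simp
  qed (use n cardn in auto)
  also have "\<dots> = level_sum (\<lambda>z. level_cost ((\<Sum>j = 2..nat \<lfloor>z\<rfloor>. ratio 1 j) / z)) n\<^sub>o n"
    unfolding level_sum_def
  proof (intro sum.cong refl)
    fix i
    have "(3/4) ^ i * real n \<le> real n" by (simp add: mult_left_le_one_le power_le_one)
    then have "nat \<lfloor>(3/4) ^ i * real n\<rfloor> \<le> n" by (simp add: nat_le_iff floor_le_iff)
    then show "cost ((3/4) ^ i * real n) = level_cost ((\<Sum>j = 2..nat \<lfloor>(3/4) ^ i * real n\<rfloor>. ratio 1 j) / ((3/4) ^ i * real n))"
      by (simp add: cost_def total_def nearest_ratio_def)
  qed
  finally show ?thesis .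
qed

end

text \<open>Here \<open>b\<close> averages the ratios of all k neighbors and \<open>a\<close> those
  of the nearest one, which is at most half of it for k \<ge> 2. Only the share \<open>a\<close>
  carries a logarithm, so the factor 2 on the right leaves room. The constant 7/10 is 3/4 times
  14/15, from z < 4 m / 3 and m \<ge> 15.\<close>

lemma averaged_cost_le:
  assumes "0 \<le> a" "a \<le> b / 2" "7/10 * b \<le> c" "c \<le> 1/2"
  shows "(b - a) + 2 * node_cost a \<le> 2 * level_cost c"
proof (cases "b = 0")
  case True
  then show ?thesis using assms level_cost_nonneg[of c] by simp
next
  case False
  then have b: "0 < b" "b \<le> 1" using assms by auto
  define l where "l = - ln b"
  have l: "0 \<le> l" using b by (simp add: l_def)
  have "node_cost a \<le> node_cost (b / 2)" using assms b by (intro node_cost_mono) auto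
  also have "\<dots> = 1 / pi * (b / 2 * (2 + ln 2 + l))"
    using b by (simp add: node_cost_eq ln_div l_def field_simps)
  also have "\<dots> \<le> 1/3 * (b / 2 * (2 + ln 2 + l))"
    using b l pi_gt3 by (intro mult_right_mono) auto
  finally have "(b - a) + 2 * node_cost a \<le> b * (5/3 + ln 2 / 3 + l / 3)"
    using assms by (simp add: algebra_simps)
  also have "\<dots> \<le> b * (7/5 * (1 + ln 2 + l))"
    using b l ln2_ge_two_thirds by (intro mult_left_mono) auto
  also have "\<dots> \<le> 2 * level_cost (7/10 * b)"
  proof -
    have "ln (7/10 * b) \<le> ln b" using b by simp
    then have "7/10 * b * (1 + ln 2 + l) \<le> 7/10 * b * (1 + ln 2 - ln (7/10 * b))"
      using b by (intro mult_left_mono) (auto simp: l_def)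
    then show ?thesis using b by (simp add: level_cost_eq)
  qed
  also have "level_cost (7/10 * b) \<le> level_cost c" using assms b by (intro level_cost_mono) auto
  finally show ?thesis by simp
qed

text \<open>Doubled, such a level cost reaches 1 and makes the bound for several neighbors trivial.
  The limit 4 stays away from 2e, beyond which the cost is negative.\<close>

lemma level_cost_ge_half:
  assumes "1/2 \<le> x" "x \<le> 4"
  shows "1/2 \<le> level_cost x"
proof (cases "x \<le> 2")
  case True
  then have "ln x \<le> ln 2" using assms by simp
  then have "1/2 * 1 \<le> x * (1 + ln 2 - ln x)" using assms by (intro mult_mono) auto
  then show ?thesis using assms by (simp add: level_cost_eq)
next
  case False
  have "ln (4::real) = 2 * ln 2" using ln_realpow[of 2 2] by simp
  moreover have "ln x \<le> ln 4" using assms by simp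
  ultimately have "2 * (1/4) \<le> x * (1 + ln 2 - ln x)"
    using False ln_numerics(7) by (intro mult_mono) auto
  then show ?thesis using assms by (simp add: level_cost_eq)
qed

section \<open>Separation of several neighbors\<close>

context ordered_points
begin

text \<open>Normalized so that, for k \<ge> 1, k times \<open>Phi_k\<close> at level z is
  \<open>neighbor_sum k (nat \<lfloor>z\<rfloor>) / z\<close>.\<close>

definition neighbor_sum :: "nat \<Rightarrow> nat \<Rightarrow> real" where
  "neighbor_sum k m = (\<Sum>j = k + 1..m. \<Sum>i = 1..k. ratio i j)"

lemma neighbor_sum_nonneg: "0 \<le> neighbor_sum k m"
  by (simp add: neighbor_sum_def sum_nonneg ratio_nonneg)

lemma neighbor_sum_mono: "m \<le> m' \<Longrightarrow> neighbor_sum k m \<le> neighbor_sum k m'"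
  unfolding neighbor_sum_def by (intro sum_mono2 sum_nonneg ratio_nonneg) auto

lemma measure_separating_neighbors_le:
  assumes k: "2 \<le> k" "k \<le> n" and S: "y ` {1..k} \<subseteq> S" "S \<subseteq> y ` {1..n}"
    and m: "15 \<le> card S" "real (card S) \<le> z" "z < 4/3 * real (card S)"
    and small: "neighbor_sum k (nat \<lfloor>z\<rfloor>) / z \<le> 1/2"
  shows "measure split_measure (separating q (y ` {1..k}) S) \<le>
    2 * (real k - 1) / (real (card S) - 1) + 2 * level_cost (neighbor_sum k (nat \<lfloor>z\<rfloor>) / z)"
proof -
  define m where "m = card S"
  define a b where "a = (\<Sum>j = k + 1..m. ratio 1 j) / (real m - 1)" and "b = neighbor_sum k m / (real m - 1)"
  have m': "15 \<le> real m" using m by (simp add: m_def)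
  have split: "{1..k} = insert 1 {2..k}" using k by auto
  have "(\<Sum>j = k + 1..m. \<Sum>i = 2..k. ratio i j) / (real m - 1) = b - a"
    unfolding a_def b_def neighbor_sum_def diff_divide_distrib[symmetric] sum_subtractf[symmetric] split by simp
  then have "measure split_measure (separating q (y ` {1..k}) S) \<le> 2 * (real k - 1) / (real m - 1) + ((b - a) + 2 * node_cost a)"
    using measure_separating_le[of k S] k S m by (simp add: m_def a_def)
  also have "(b - a) + 2 * node_cost a \<le> 2 * level_cost (neighbor_sum k (nat \<lfloor>z\<rfloor>) / z)"
  proof (rule averaged_cost_le[OF _ _ _ small])
    show "0 \<le> a" using m' by (auto simp: a_def intro!: divide_nonneg_nonneg sum_nonneg ratio_nonneg)
    \<comment> \<open>The nearest neighbor has at most the ratio of the second one, so its share of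
      each inner sum is at most one half.\<close>
    have "(\<Sum>j = k + 1..m. ratio 1 j) \<le> neighbor_sum k m / 2"
      unfolding neighbor_sum_def sum_divide_distrib
    proof (intro sum_mono)
      fix j
      have "ratio 1 j + ratio 2 j = (\<Sum>i\<in>{1, 2}. ratio i j)" by simp
      also have "\<dots> \<le> (\<Sum>i = 1..k. ratio i j)" using k by (intro sum_mono2 ratio_nonneg) auto
      finally show "ratio 1 j \<le> (\<Sum>i = 1..k. ratio i j / 2)"
        using ratio_mono[of 1 2 j] k by (simp flip: sum_divide_distrib)
    qed
    then have "a \<le> neighbor_sum k m / 2 / (real m - 1)"
      unfolding a_def using m' by (intro divide_right_mono) auto
    then show "a \<le> b / 2" by (simp add: b_def mult.commute)
    have "7/10 * b * z \<le> 7/10 * b * (4/3 * real m)"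
      using m m' neighbor_sum_nonneg[of k m] by (intro mult_left_mono) (auto simp: m_def b_def)
    also have "\<dots> = b * (28/30 * real m)" by simp
    \<comment> \<open>This is where 15 points enter: 28/30 m \<le> m - 1.\<close>
    also have "\<dots> \<le> b * (real m - 1)"
      using m' neighbor_sum_nonneg[of k m] by (intro mult_left_mono) (auto simp: b_def)
    also have "\<dots> = neighbor_sum k m" using m' by (simp add: b_def)
    also have "\<dots> \<le> neighbor_sum k (nat \<lfloor>z\<rfloor>)"
      using m by (intro neighbor_sum_mono) (simp add: m_def le_nat_floor)
    finally show "7/10 * b \<le> neighbor_sum k (nat \<lfloor>z\<rfloor>) / z"
      using m m' by (simp add: m_def le_divide_eq)
  qed
  finally show ?thesis by (simp add: m_def)
qed

text \<open>Where k times \<open>Phi_k\<close> exceeds 1/2, the value 1/2 is taken: doubled, it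
  bounds any probability, so the induction can stop at that level.\<close>

definition capped_cost :: "nat \<Rightarrow> real \<Rightarrow> real" where
  "capped_cost k z = (if neighbor_sum k (nat \<lfloor>z\<rfloor>) / z \<le> 1/2 then level_cost (neighbor_sum k (nat \<lfloor>z\<rfloor>) / z) else 1/2)"

lemma capped_cost_nonneg: "0 \<le> z \<Longrightarrow> 0 \<le> capped_cost k z"
proof -
  assume "0 \<le> z"
  then have "0 \<le> neighbor_sum k (nat \<lfloor>z\<rfloor>) / z" by (intro divide_nonneg_nonneg neighbor_sum_nonneg)
  then show ?thesis using level_cost_nonneg[of "neighbor_sum k (nat \<lfloor>z\<rfloor>) / z"] unfolding capped_cost_def by (split if_split) linarith
qed

text \<open>The summand \<open>- 6 / (card S - 1)\<close> makes the induction close: the first term of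
  the separation bound grows geometrically from the root to the leaves.\<close>

lemma miss_neighbors_capped_le:
  assumes n\<^sub>o: "1 \<le> n\<^sub>o" "16 * (k - 1) < n\<^sub>o" and k: "2 \<le> k" "k \<le> n"
  shows "y ` {1..k} \<subseteq> S \<Longrightarrow> S \<subseteq> y ` {1..n} \<Longrightarrow> n\<^sub>o < card S \<Longrightarrow> real (card S) \<le> z \<Longrightarrow>
    miss_prob q (y ` {1..k}) n\<^sub>o S \<le>
      2 * level_sum (capped_cost k) n\<^sub>o z + (real k - 1) * (8 / real n\<^sub>o - 6 / (real (card S) - 1))"
proof (induction "card S" arbitrary: S z rule: less_induct)
  case less
  interpret R: prob_space "rp_random :: (bool list \<Rightarrow> 'a \<times> real) measure" by (rule prob_space_rp_random)
  define N m where "N = y ` {1..k}" and "m = card S"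
  have finS: "finite S" using less.prems finite_subset by blast
  have m: "17 \<le> n\<^sub>o" "n\<^sub>o < m" using n\<^sub>o k less.prems by (auto simp: m_def)
  then have m': "0 < real n\<^sub>o" "real n\<^sub>o \<le> real m - 1" by auto
  have nonneg: "0 \<le> level_sum (capped_cost k) n\<^sub>o z" for z
    by (intro level_sum_nonneg capped_cost_nonneg) auto
  \<comment> \<open>The claim is rearranged and halved so that a single \<open>level_sum\<close>
    stands on the right, as \<open>level_sum_window\<close> expects.\<close>
  have "(miss_prob q N n\<^sub>o S - (real k - 1) * (8 / real n\<^sub>o - 6 / (real m - 1))) / 2 \<le> level_sum (capped_cost k) n\<^sub>o z"
  proof (rule level_sum_window[OF n\<^sub>o(1) _ less.prems(4)])
    fix w assume w: "real (card S) \<le> w" "w < 4/3 * real (card S)"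
    have rec: "level_sum (capped_cost k) n\<^sub>o w = capped_cost k w + level_sum (capped_cost k) n\<^sub>o (3/4 * w)"
      using w less.prems by (intro level_sum_rec n\<^sub>o) auto
    have "6 / (real m - 1) \<le> 6 / real n\<^sub>o" using m' by (intro divide_left_mono) auto
    moreover have "6 / real n\<^sub>o \<le> 8 / real n\<^sub>o" by (intro divide_right_mono) auto
    ultimately have slack: "0 \<le> (real k - 1) * (8 / real n\<^sub>o - 6 / (real m - 1))"
      using k by (intro mult_nonneg_nonneg) linarith+
    show "(miss_prob q N n\<^sub>o S - (real k - 1) * (8 / real n\<^sub>o - 6 / (real m - 1))) / 2 \<le> level_sum (capped_cost k) n\<^sub>o w"
    proof (cases "neighbor_sum k (nat \<lfloor>w\<rfloor>) / w \<le> 1/2")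
      case False
      then have "capped_cost k w = 1/2" by (simp add: capped_cost_def)
      moreover have "miss_prob q N n\<^sub>o S \<le> 1" unfolding miss_prob_def by (rule R.prob_le_1)
      ultimately show ?thesis using rec nonneg[of "3/4 * w"] slack by simp
    next
      case True
      define c where "c = 2 * level_sum (capped_cost k) n\<^sub>o (3/4 * w) + (real k - 1) * (8 / real n\<^sub>o - 8 / (real m - 1))"
      have "8 / (real m - 1) \<le> 8 / real n\<^sub>o" using m' by (intro divide_left_mono) auto
      then have c: "0 \<le> c"
        unfolding c_def using k nonneg[of "3/4 * w"] by (intro add_nonneg_nonneg mult_nonneg_nonneg) auto
      have "miss_prob q N n\<^sub>o S \<le> measure split_measure (separating q N S) + c"
      proof (rule miss_prob_step[OF finS less.prems(3) n\<^sub>o(1) less.prems(1)[folded N_def] c])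
        fix A assume A: "N \<subseteq> A" "A \<subseteq> S" "4 * card A \<le> 3 * card S"
        show "miss_prob q N n\<^sub>o A \<le> c"
        proof (cases "card A \<le> n\<^sub>o")
          case True
          then show ?thesis using miss_prob_leaf[OF True A(1)] c by simp
        next
          case False
          have "4 * real (card A) \<le> 3 * real m" using A(3) unfolding m_def by linarith
          then have cA: "real (card A) - 1 \<le> 3/4 * (real m - 1)" "real (card A) \<le> 3/4 * w"
            using w by (auto simp: m_def)
          have pos: "0 < real (card A) - 1" using False m by auto
          have "miss_prob q N n\<^sub>o A \<le> 2 * level_sum (capped_cost k) n\<^sub>o (3/4 * w) + (real k - 1) * (8 / real n\<^sub>o - 6 / (real (card A) - 1))"
            unfolding N_def
          proof (rule less.hyps)
            show "card A < card S" using A m by (simp add: m_def)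
          qed (use A less.prems False cA in \<open>auto simp: N_def\<close>)
          also have "\<dots> \<le> c"
          proof -
            \<comment> \<open>As 8 is 4/3 times 6, this is the effect of a child having at most
              three quarters of the points, which persists after subtracting 1 from both
              sizes.\<close>
            have "8 / (real m - 1) = 6 / (3/4 * (real m - 1))" using m' by (simp add: field_simps)
            also have "\<dots> \<le> 6 / (real (card A) - 1)" using cA(1) pos by (intro divide_left_mono) auto
            finally show ?thesis unfolding c_def using k by (intro add_left_mono mult_left_mono) auto
          qed
          finally show ?thesis .
        qed
      qed
      also have "measure split_measure (separating q N S) \<le> 2 * (real k - 1) / (real m - 1) + 2 * capped_cost k w"
        using measure_separating_neighbors_le[OF k less.prems(1,2) _ w True] True m
        by (simp add: capped_cost_def N_def m_def)
      finally have "miss_prob q N n\<^sub>o S \<le> 2 * (real k - 1) / (real m - 1) + 2 * capped_cost k w + c" by simp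
      \<comment> \<open>The 2 of the separation bound and the -8 inherited from the children combine
        to the -6 of the claim.\<close>
      moreover have "2 * (real k - 1) / (real m - 1) + (real k - 1) * (8 / real n\<^sub>o - 8 / (real m - 1))
        = (real k - 1) * (8 / real n\<^sub>o - 6 / (real m - 1))"
        by (simp add: divide_inverse algebra_simps)
      ultimately have "miss_prob q N n\<^sub>o S - (real k - 1) * (8 / real n\<^sub>o - 6 / (real m - 1)) \<le>
          2 * level_sum (capped_cost k) n\<^sub>o w"
        unfolding rec c_def distrib_left by linarith
      then show ?thesis by simp
    qed
  qed (use less.prems capped_cost_nonneg in auto)
  then show ?case by (simp add: N_def m_def)
qed

text \<open>By \<open>bounded\<close> and \<open>level_cost_ge_half\<close>, capping does not
  increase the cost of any level. The induction covers \<open>n\<^sub>o\<close> above 16 (k - 1) and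
  below n; otherwise the additive term is at least 1 or the root is a leaf.\<close>

lemma miss_neighbors_le:
  assumes n\<^sub>o: "1 \<le> n\<^sub>o" and k: "2 \<le> k" "k \<le> n"
    and bounded: "\<And>i. real n\<^sub>o \<le> (3/4) ^ i * real n \<Longrightarrow>
      neighbor_sum k (nat \<lfloor>(3/4) ^ i * real n\<rfloor>) / ((3/4) ^ i * real n) \<le> 4"
  shows "miss_prob q (y ` {1..k}) n\<^sub>o (y ` {1..n}) \<le>
    2 * level_sum (\<lambda>z. level_cost (neighbor_sum k (nat \<lfloor>z\<rfloor>) / z)) n\<^sub>o n + 16 * (real k - 1) / real n\<^sub>o"
proof -
  interpret R: prob_space "rp_random :: (bool list \<Rightarrow> 'a \<times> real) measure" by (rule prob_space_rp_random)
  let ?g = "\<lambda>z. level_cost (neighbor_sum k (nat \<lfloor>z\<rfloor>) / z)"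
  have cardn: "card (y ` {1..n}) = n" using card_image[OF inj] by simp
  have sub: "y ` {1..k} \<subseteq> y ` {1..n}" using k by auto
  have "level_sum (capped_cost k) n\<^sub>o n \<le> level_sum ?g n\<^sub>o n"
    unfolding level_sum_def
  proof (rule sum_mono)
    fix i assume "i \<in> {i. real n\<^sub>o \<le> (3/4) ^ i * real n}"
    then show "capped_cost k ((3/4) ^ i * real n) \<le> ?g ((3/4) ^ i * real n)"
      using bounded[of i] level_cost_ge_half[of "neighbor_sum k (nat \<lfloor>(3/4) ^ i * real n\<rfloor>) / ((3/4) ^ i * real n)"]
      unfolding capped_cost_def mem_Collect_eq by (split if_split) linarith
  qed
  moreover have "0 \<le> level_sum (capped_cost k) n\<^sub>o n" by (intro level_sum_nonneg capped_cost_nonneg) auto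
  ultimately have nonneg: "0 \<le> level_sum ?g n\<^sub>o n" and le: "level_sum (capped_cost k) n\<^sub>o n \<le> level_sum ?g n\<^sub>o n" by auto
  consider "n\<^sub>o \<le> 16 * (k - 1)" | "n \<le> n\<^sub>o" | "16 * (k - 1) < n\<^sub>o" "n\<^sub>o < n" by linarith
  then show ?thesis
  proof cases
    case 1
    then have "real n\<^sub>o \<le> real (16 * (k - 1))" by (simp only: of_nat_le_iff)
    then have "1 \<le> 16 * (real k - 1) / real n\<^sub>o" using n\<^sub>o k by simp
    moreover have "miss_prob q (y ` {1..k}) n\<^sub>o (y ` {1..n}) \<le> 1" unfolding miss_prob_def by (rule R.prob_le_1)
    ultimately show ?thesis using nonneg by linarith
  next
    case 2
    then show ?thesis using miss_prob_leaf[OF _ sub] cardn nonneg k by simp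
  next
    case 3
    have "(real k - 1) * (8 / real n\<^sub>o - 6 / (real n - 1)) \<le> (real k - 1) * (16 / real n\<^sub>o)"
    proof (rule mult_left_mono)
      have "8 / real n\<^sub>o \<le> 16 / real n\<^sub>o" by (intro divide_right_mono) auto
      moreover have "0 \<le> 6 / (real n - 1)" using k by simp
      ultimately show "8 / real n\<^sub>o - 6 / (real n - 1) \<le> 16 / real n\<^sub>o" by linarith
    qed (use k in simp)
    then show ?thesis
      using miss_neighbors_capped_le[OF n\<^sub>o 3(1) k sub, of "real n"] 3 cardn le by (simp add: mult.commute)
  qed
qed

end

section \<open>From the leaf of the query to the answer\<close>

lemma rp_leaf_subset: "rp_leaf q (rp_build n\<^sub>o \<omega> S) \<subseteq> S"
proof (induction n\<^sub>o \<omega> S rule: rp_build.induct)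
  case (1 n\<^sub>o \<omega> S)
  let ?L = "{x \<in> S. x \<bullet> fst (\<omega> []) < split_value S (\<omega> [])}"
    and ?R = "{x \<in> S. \<not> x \<bullet> fst (\<omega> []) < split_value S (\<omega> [])}"
  show ?case
  proof (cases "card S \<le> n\<^sub>o \<or> ?L = {} \<or> ?R = {}")
    case True
    then show ?thesis by (subst rp_build.simps) (simp only: Let_def rp_leaf.simps if_True if_False split: if_split, blast)
  next
    case False
    then have "rp_leaf q (rp_build n\<^sub>o (\<lambda>p. \<omega> (False # p)) ?L) \<subseteq> ?L"
      "rp_leaf q (rp_build n\<^sub>o (\<lambda>p. \<omega> (True # p)) ?R) \<subseteq> ?R"
      by (intro 1(1,2)[OF _ refl refl refl refl]; blast)+
    then show ?thesis by (subst rp_build.simps) (simp only: Let_def rp_leaf.simps split: if_split, blast)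
  qed
qed

text \<open>A leaf is a subset of the data, so if it contains the k nearest data points, these are
  also nearest within the leaf.\<close>

lemma (in ordered_points) failure_le_miss_prob:
  assumes "k \<le> n"
  shows "\<P>(\<omega> in rp_random. \<not> nearest_neighbors q k (rp_leaf q (rp_build n\<^sub>o \<omega> (y ` {1..n}))) (y ` {1..k}))
    \<le> miss_prob q (y ` {1..k}) n\<^sub>o (y ` {1..n})"
proof -
  interpret R: prob_space "rp_random :: (bool list \<Rightarrow> 'a \<times> real) measure" by (rule prob_space_rp_random)
  have "nearest_neighbors q k C (y ` {1..k})" if "y ` {1..k} \<subseteq> C" "C \<subseteq> y ` {1..n}" for C
    unfolding nearest_neighbors_def
  proof (intro conjI ballI)
    show "card (y ` {1..k}) = k"
      using card_image[of y "{1..k}"] inj_on_subset[OF inj, of "{1..k}"] assms by simp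
    fix a c assume ac: "a \<in> y ` {1..k}" "c \<in> C - y ` {1..k}"
    from ac(2) have "c \<in> y ` {1..n}" "c \<notin> y ` {1..k}" using \<open>C \<subseteq> y ` {1..n}\<close> by blast+
    with ac(1) obtain i j where "a = y i" "i \<in> {1..k}" "c = y j" "j \<in> {1..n}" "j \<notin> {1..k}" by blast
    then show "norm (q - a) \<le> norm (q - c)" using ordered[of i j] by simp
  qed (rule that(1))
  then have "{\<omega> \<in> space rp_random. \<not> nearest_neighbors q k (rp_leaf q (rp_build n\<^sub>o \<omega> (y ` {1..n}))) (y ` {1..k})}
    \<subseteq> {\<omega> \<in> space rp_random. \<not> y ` {1..k} \<subseteq> rp_leaf q (rp_build n\<^sub>o \<omega> (y ` {1..n}))}"
    using rp_leaf_subset by blast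
  then show ?thesis
    unfolding miss_prob_def by (intro R.finite_measure_mono sets_rp_event) auto
qed

theorem theorem7:
  fixes q :: "'a::euclidean_space" and x y :: "nat \<Rightarrow> 'a"
    and n n\<^sub>o :: nat and \<beta> l :: real
  assumes "n \<ge> 1" and "n\<^sub>o \<ge> 1"
    and "inj_on x {1..n}"
    and "bij_betw y {1..n} (x ` {1..n})"
    and "\<And>i j. 1 \<le> i \<Longrightarrow> i \<le> j \<Longrightarrow> j \<le> n \<Longrightarrow> norm (q - y i) \<le> norm (q - y j)"
    and "\<beta> = 3 / 4" and "l = log (1 / \<beta>) (real n / real n\<^sub>o)"
  shows
    "\<P>(\<omega> in rp_random. \<not> nearest_neighbors q 1 (rp_leaf q (rp_build n\<^sub>o \<omega> (x ` {1..n}))) {y 1})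
       \<le> (\<Sum>i | real i \<le> l. Phi q y (\<beta> ^ i * n) * ln (2 * exp 1 / Phi q y (\<beta> ^ i * n)))
     \<and>
     (\<forall>k. 1 \<le> k \<and> k \<le> n \<longrightarrow>
        (\<forall>i. real i \<le> l \<longrightarrow> real k * Phi_k q y k (\<beta> ^ i * n) \<le> 4) \<longrightarrow>
        \<P>(\<omega> in rp_random. \<not> nearest_neighbors q k (rp_leaf q (rp_build n\<^sub>o \<omega> (x ` {1..n}))) (y ` {1..k}))
          \<le> 2 * real k * (\<Sum>i | real i \<le> l.
                Phi_k q y k (\<beta> ^ i * n) * ln (2 * exp 1 / (real k * Phi_k q y k (\<beta> ^ i * n))))
             + 16 * (real k - 1) / real n\<^sub>o)"
proof -
  interpret ordered_points q y n
    by unfold_locales (use assms(4,5) in \<open>auto simp: bij_betw_def\<close>)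
  have img: "x ` {1..n} = y ` {1..n}" using assms(4) by (simp add: bij_betw_def)
  \<comment> \<open>The limit l of the sums becomes the condition that the level is at least
    \<open>n\<^sub>o\<close>. For n < \<open>n\<^sub>o\<close> the sums are empty.\<close>
  have levels: "real i \<le> l \<longleftrightarrow> real n\<^sub>o \<le> (3/4) ^ i * real n" for i
  proof -
    have "real i \<le> l \<longleftrightarrow> (4/3) ^ i \<le> real n / real n\<^sub>o"
      using assms(1,2) by (simp add: assms(6,7) le_log_iff powr_realpow)
    also have "\<dots> \<longleftrightarrow> real n\<^sub>o \<le> (3/4) ^ i * real n"
      using assms(2) by (simp add: field_simps)
    finally show ?thesis .
  qed
  define nearest where "nearest = (\<Sum>i | real i \<le> l. Phi q y (\<beta> ^ i * n) * ln (2 * exp 1 / Phi q y (\<beta> ^ i * n)))"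
  have nearest_eq: "nearest = level_sum (\<lambda>z. level_cost (Phi q y z)) n\<^sub>o n"
    by (simp add: nearest_def level_sum_def levels assms(6) level_cost_def)
  have Phi: "Phi q y z = (\<Sum>j = 2..nat \<lfloor>z\<rfloor>. ratio 1 j) / z" for z
    by (simp add: Phi_def ratio_def)
  have Phi_k: "real k * Phi_k q y k z = neighbor_sum k (nat \<lfloor>z\<rfloor>) / z" if "1 \<le> k" for k z
    using that by (simp add: Phi_k_def neighbor_sum_def ratio_def sum_divide_distrib sum_distrib_left mult.commute)
  have miss1: "miss_prob q {y 1} n\<^sub>o (y ` {1..n}) \<le> nearest"
    using miss_nearest_le[OF assms(1,2)] by (simp add: nearest_eq Phi)
  have part1: "\<P>(\<omega> in rp_random. \<not> nearest_neighbors q 1 (rp_leaf q (rp_build n\<^sub>o \<omega> (x ` {1..n}))) {y 1}) \<le> nearest"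
    using failure_le_miss_prob[of 1 n\<^sub>o] assms(1) miss1 unfolding img by simp
  have nearest_nonneg: "0 \<le> nearest"
    using miss1 by (rule order_trans[rotated]) (simp add: miss_prob_def)
  have part2: "\<P>(\<omega> in rp_random. \<not> nearest_neighbors q k (rp_leaf q (rp_build n\<^sub>o \<omega> (x ` {1..n}))) (y ` {1..k}))
      \<le> 2 * real k * (\<Sum>i | real i \<le> l. Phi_k q y k (\<beta> ^ i * n) * ln (2 * exp 1 / (real k * Phi_k q y k (\<beta> ^ i * n))))
        + 16 * (real k - 1) / real n\<^sub>o"
    if k: "1 \<le> k" "k \<le> n" and bounded: "\<And>i. real i \<le> l \<Longrightarrow> real k * Phi_k q y k (\<beta> ^ i * n) \<le> 4" for k
  proof -
    have "real k * (\<Sum>i | real i \<le> l. Phi_k q y k (\<beta> ^ i * n) * ln (2 * exp 1 / (real k * Phi_k q y k (\<beta> ^ i * n))))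
      = level_sum (\<lambda>z. level_cost (real k * Phi_k q y k z)) n\<^sub>o n" (is "_ * ?sum = ?levels")
      unfolding sum_distrib_left level_sum_def levels assms(6) level_cost_def by (simp add: mult.assoc)
    moreover have "miss_prob q (y ` {1..k}) n\<^sub>o (y ` {1..n}) \<le> 2 * ?levels + 16 * (real k - 1) / real n\<^sub>o"
    \<comment> \<open>For k = 1 the nearest neighbor contributes all of the sum, not at most half of
      it as in the argument for several neighbors. The claim is then twice the bound for the nearest
      neighbor, which is nonnegative.\<close>
    proof (cases "k = 1")
      case True
      have "?levels = nearest"
        unfolding nearest_eq True using Phi_k[of 1] by (simp add: Phi neighbor_sum_def numeral_2_eq_2)
      then show ?thesis using True miss1 nearest_nonneg by simp
    next
      case False
      then show ?thesis
        using miss_neighbors_le[of n\<^sub>o k] assms(2) k bounded[unfolded levels assms(6)] by (simp add: Phi_k)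
    qed
    ultimately show ?thesis
      using failure_le_miss_prob[OF k(2), of n\<^sub>o] unfolding img by (simp add: mult.assoc)
  qed
  show ?thesis using part1 part2 unfolding nearest_def by blast
qed

end
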